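(* Suppose that Jensen's principle $\square_\kappa$ holds for a proper class of cardinals $\kappa$. Then the class of abelian groups that are not $\sigma$-closed potentially free, ordered by pure embeddability, is not an Abstract Elementary Class.
   Context: An abelian group $G$ is $\sigma$-closed potentially free if some $\sigma$-closed forcing poset forces $G$ to be a free abelian group (equivalently, to be $\{\mathbb{Z}\}$-filtered). An Abstract Elementary Class $(K,\prec_K)$ must satisfy: (i) $K$ closed under isomorphism; (ii) $\prec_K$ isomorphism-invariant; (iii) $M\prec_K N$ implies $M$ a substructure of $N$; (iv) coherence: if $M_0\subseteq M_1$, $M_0\prec_K M_2$, $M_1\prec_K M_2$ in $K$ then $M_0\prec_K M_1$; (v) Tarski–Vaught chain axioms for continuous increasing $\prec_K$-chains; (vi) Löwenheim–Skolem axiom: there is a cardinal $\mathrm{LS}$ such that whenever $A\subseteq B\in K$ there is $A'\in K$ with $A\subseteq A'\prec_K B$ and $|A'|\le|A|+\mathrm{LS}$. *)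

theory Defs
  imports "HOL-Algebra.Group"
begin

unbundle cardinal_syntax

section \<open>The universe of sets\<close>

text \<open>
  A type of this class is a universe of sets satisfying the axioms of ZFC; the classes of
  the universe are the HOL sets of type \<open>'v set\<close>, and Choice is inherited from HOL. Separation,
  Replacement and Foundation are stated for arbitrary classes and class functions.
\<close>

class zfc_universe =
  fixes elts :: "'a \<Rightarrow> 'a set"
  assumes extensionality: "elts x = elts y \<Longrightarrow> x = y"
    and separation: "Y \<subseteq> elts x \<Longrightarrow> \<exists>y. elts y = Y"
    and union: "\<exists>u. elts u = \<Union> (elts ` elts x)"
    and power_set: "\<exists>u. elts u = {y. elts y \<subseteq> elts x}"
    and replacement: "\<exists>u. elts u = f ` elts x"
    and infinity: "\<exists>w. (\<exists>z\<in>elts w. elts z = {})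
                      \<and> (\<forall>x\<in>elts w. \<exists>y\<in>elts w. elts y = insert x (elts x))"
    and foundation: "wf {(x, y). x \<in> elts y}"

definition small :: "'v::zfc_universe set \<Rightarrow> bool" where
  "small A \<longleftrightarrow> (\<exists>x. elts x = A)"

abbreviation proper_class :: "'v::zfc_universe set \<Rightarrow> bool" where
  "proper_class A \<equiv> \<not> small A"

text \<open>The set with the members \<open>A\<close>; meaningful only for small \<open>A\<close>.\<close>

definition vset :: "'v::zfc_universe set \<Rightarrow> 'v" where
  "vset A = (THE x. elts x = A)"

definition vpair :: "'v::zfc_universe \<Rightarrow> 'v \<Rightarrow> 'v" where
  "vpair x y = vset {vset {x}, vset {x, y}}"


section \<open>Ordinals, cardinals and square\<close>

definition transitive_set :: "'v::zfc_universe \<Rightarrow> bool" where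
  "transitive_set x \<longleftrightarrow> (\<forall>y\<in>elts x. elts y \<subseteq> elts x)"

definition ordinal :: "'v::zfc_universe \<Rightarrow> bool" where
  "ordinal \<alpha> \<longleftrightarrow> transitive_set \<alpha> \<and> (\<forall>\<beta>\<in>elts \<alpha>. transitive_set \<beta>)"

definition limit_ordinal :: "'v::zfc_universe \<Rightarrow> bool" where
  "limit_ordinal \<alpha> \<longleftrightarrow> ordinal \<alpha> \<and> elts \<alpha> \<noteq> {} \<and> (\<forall>\<beta>\<in>elts \<alpha>. \<exists>\<gamma>\<in>elts \<alpha>. \<beta> \<in> elts \<gamma>)"

definition cardinal :: "'v::zfc_universe \<Rightarrow> bool" where
  "cardinal \<kappa> \<longleftrightarrow> ordinal \<kappa> \<and> (\<forall>\<alpha>\<in>elts \<kappa>. |elts \<alpha>| <o |elts \<kappa>| )"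

definition infinite_cardinal :: "'v::zfc_universe \<Rightarrow> bool" where
  "infinite_cardinal \<kappa> \<longleftrightarrow> cardinal \<kappa> \<and> infinite (elts \<kappa>)"

definition successor_cardinal :: "'v::zfc_universe \<Rightarrow> 'v \<Rightarrow> bool" where
  "successor_cardinal \<kappa> \<mu> \<longleftrightarrow>
     cardinal \<mu> \<and> \<kappa> \<in> elts \<mu> \<and> (\<forall>\<nu>. cardinal \<nu> \<and> \<kappa> \<in> elts \<nu> \<longrightarrow> elts \<mu> \<subseteq> elts \<nu>)"

definition unbounded_in :: "'v::zfc_universe set \<Rightarrow> 'v \<Rightarrow> bool" where
  "unbounded_in C \<alpha> \<longleftrightarrow> (\<forall>\<beta>\<in>elts \<alpha>. \<exists>\<gamma>\<in>C \<inter> elts \<alpha>. \<beta> \<in> elts \<gamma>)"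

definition limit_points :: "'v::zfc_universe set \<Rightarrow> 'v \<Rightarrow> 'v set" where
  "limit_points C \<alpha> = {\<beta> \<in> elts \<alpha>. limit_ordinal \<beta> \<and> unbounded_in C \<beta>}"

definition club_in :: "'v::zfc_universe set \<Rightarrow> 'v \<Rightarrow> bool" where
  "club_in C \<alpha> \<longleftrightarrow> C \<subseteq> elts \<alpha> \<and> unbounded_in C \<alpha> \<and> limit_points C \<alpha> \<subseteq> C"

text \<open>The (reflexive) order of a set of ordinals; order types are compared by \<open>\<le>o\<close>.\<close>

definition ord_rel :: "'v::zfc_universe set \<Rightarrow> 'v rel" where
  "ord_rel C = {(\<beta>, \<gamma>). \<beta> \<in> C \<and> \<gamma> \<in> C \<and> (\<beta> = \<gamma> \<or> \<beta> \<in> elts \<gamma>)}"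

definition square :: "'v::zfc_universe \<Rightarrow> bool" where
  "square \<kappa> \<longleftrightarrow>
     (\<exists>\<mu> C. successor_cardinal \<kappa> \<mu> \<and>
        (\<forall>\<alpha>\<in>elts \<mu>. limit_ordinal \<alpha> \<longrightarrow>
           club_in (C \<alpha>) \<alpha> \<and>
           ord_rel (C \<alpha>) \<le>o ord_rel (elts \<kappa>) \<and>
           (\<forall>\<beta>\<in>limit_points (C \<alpha>) \<alpha>. C \<beta> = C \<alpha> \<inter> elts \<beta>)))"


section \<open>Forcing\<close>

text \<open>
  A name over a forcing poset is a set of pairs of a name and a condition; here this set is
  presented as the range of a small partial family \<open>F\<close> of such pairs. Different families may
  present the same name, which does not matter for the forcing relation.
\<close>

datatype 'v name = Name "'v \<rightharpoonup> 'v name \<times> 'v"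

definition subname_rel :: "'v name rel" where
  "subname_rel = {(\<sigma>, \<tau>). case \<tau> of Name F \<Rightarrow> \<exists>c. (\<sigma>, c) \<in> ran F}"

lemma wf_subname_rel: "wf subname_rel"
proof (rule wfUNIVI)
  fix Q :: "'a name \<Rightarrow> bool" and \<tau>
  assume step: "\<forall>\<tau>. (\<forall>\<sigma>. (\<sigma>, \<tau>) \<in> subname_rel \<longrightarrow> Q \<sigma>) \<longrightarrow> Q \<tau>"
  show "Q \<tau>"
  proof (induction \<tau>)
    case (Name F)
    have "Q \<sigma>" if "(\<sigma>, Name F) \<in> subname_rel" for \<sigma>
      using that Name
      by (fastforce simp: subname_rel_def ran_def fsts.simps)
    then show ?case
      using step by blast
  qed
qed

text \<open>The canonical name of a ground model set, \<open>p0\<close> being the largest condition of the poset.\<close>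

function check :: "'v::zfc_universe \<Rightarrow> 'v \<Rightarrow> 'v name" where
  "check p0 x = Name (\<lambda>y. if y \<in> elts x then Some (check p0 y, p0) else None)"
  by auto
termination
  by (relation "inv_image {(x, y). x \<in> elts y} snd") (auto intro: wf_inv_image foundation)

declare check.simps [simp del]

definition forcing_poset :: "'v::zfc_universe set \<Rightarrow> 'v rel \<Rightarrow> 'v \<Rightarrow> bool" where
  "forcing_poset P leq p0 \<longleftrightarrow>
     small P \<and> preorder_on P leq \<and> p0 \<in> P \<and> (\<forall>p\<in>P. (p, p0) \<in> leq)"

definition sigma_closed :: "'v::zfc_universe set \<Rightarrow> 'v rel \<Rightarrow> bool" where
  "sigma_closed P leq \<longleftrightarrow>
     (\<forall>p :: nat \<Rightarrow> 'v. (\<forall>n. p n \<in> P) \<and> (\<forall>n. (p (Suc n), p n) \<in> leq) \<longrightarrow>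
        (\<exists>q\<in>P. \<forall>n. (q, p n) \<in> leq))"

text \<open>
  In the following locale a formula \<open>\<phi>(\<tau>\<^sub>1, \<dots>, \<tau>\<^sub>n)\<close> of the forcing language is represented
  by the predicate \<open>\<lambda>p. p \<tturnstile> \<phi>(\<tau>\<^sub>1, \<dots>, \<tau>\<^sub>n)\<close> on conditions. The clauses for equality, membership,
  negation, conjunction and existential quantification are those of the relation
  \<open>\<tturnstile>\<^sup>*\<close> in Kunen's "Set Theory" (1980), Section VII.3; the other connectives are
  derived classically.
\<close>

locale forcing_notion =
  fixes P :: "'v::zfc_universe set" and leq :: "'v rel"
begin

definition dense_below :: "('v \<Rightarrow> bool) \<Rightarrow> 'v \<Rightarrow> bool" where
  "dense_below D p \<longleftrightarrow> (\<forall>q\<in>P. (q, p) \<in> leq \<longrightarrow> (\<exists>r\<in>P. (r, q) \<in> leq \<and> D r))"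

inductive is_name :: "'v name \<Rightarrow> bool" where
  "small (dom F) \<Longrightarrow> (\<And>\<tau> c. (\<tau>, c) \<in> ran F \<Longrightarrow> is_name \<tau> \<and> c \<in> P) \<Longrightarrow> is_name (Name F)"

function feq :: "'v name \<Rightarrow> 'v name \<Rightarrow> 'v \<Rightarrow> bool" where
  "feq (Name F) (Name G) p \<longleftrightarrow>
     (\<forall>(\<sigma>, c)\<in>ran F.
        dense_below (\<lambda>q. (q, c) \<in> leq \<longrightarrow> (\<exists>(\<tau>, d)\<in>ran G. (q, d) \<in> leq \<and> feq \<sigma> \<tau> q)) p) \<and>
     (\<forall>(\<tau>, d)\<in>ran G.
        dense_below (\<lambda>q. (q, d) \<in> leq \<longrightarrow> (\<exists>(\<sigma>, c)\<in>ran F. (q, c) \<in> leq \<and> feq \<sigma> \<tau> q)) p)"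
  by pat_completeness auto
termination
proof (relation "inv_image subname_rel fst")
  show "wf (inv_image subname_rel (fst :: 'v name \<times> 'v name \<times> 'v \<Rightarrow> 'v name))"
    by (rule wf_inv_image[OF wf_subname_rel])
qed (auto simp: subname_rel_def)

notation feq (infix \<open>\<^bold>=\<close> 50)

fun fmem :: "'v name \<Rightarrow> 'v name \<Rightarrow> 'v \<Rightarrow> bool" (infix \<open>\<^bold>\<in>\<close> 50) where
  "fmem x (Name G) p \<longleftrightarrow> dense_below (\<lambda>q. \<exists>(\<tau>, d)\<in>ran G. (q, d) \<in> leq \<and> feq \<tau> x q) p"

definition fnot :: "('v \<Rightarrow> bool) \<Rightarrow> 'v \<Rightarrow> bool" (\<open>\<^bold>\<not> _\<close> [40] 40) where
  "(\<^bold>\<not> \<phi>) = (\<lambda>p. \<not> (\<exists>q\<in>P. (q, p) \<in> leq \<and> \<phi> q))"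

definition fand :: "('v \<Rightarrow> bool) \<Rightarrow> ('v \<Rightarrow> bool) \<Rightarrow> 'v \<Rightarrow> bool" (infixr \<open>\<^bold>\<and>\<close> 35) where
  "(\<phi> \<^bold>\<and> \<psi>) = (\<lambda>p. \<phi> p \<and> \<psi> p)"

definition fex :: "('v name \<Rightarrow> 'v \<Rightarrow> bool) \<Rightarrow> 'v \<Rightarrow> bool" (binder \<open>\<^bold>\<exists>\<close> 10) where
  "(\<^bold>\<exists>x. \<phi> x) = dense_below (\<lambda>q. \<exists>x. is_name x \<and> \<phi> x q)"

definition f_or :: "('v \<Rightarrow> bool) \<Rightarrow> ('v \<Rightarrow> bool) \<Rightarrow> 'v \<Rightarrow> bool" (infixr \<open>\<^bold>\<or>\<close> 30) where
  "(\<phi> \<^bold>\<or> \<psi>) = (\<^bold>\<not> (\<^bold>\<not> \<phi> \<^bold>\<and> \<^bold>\<not> \<psi>))"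

definition fimp :: "('v \<Rightarrow> bool) \<Rightarrow> ('v \<Rightarrow> bool) \<Rightarrow> 'v \<Rightarrow> bool" (infixr \<open>\<^bold>\<longrightarrow>\<close> 25) where
  "(\<phi> \<^bold>\<longrightarrow> \<psi>) = (\<^bold>\<not> (\<phi> \<^bold>\<and> \<^bold>\<not> \<psi>))"

definition fiff :: "('v \<Rightarrow> bool) \<Rightarrow> ('v \<Rightarrow> bool) \<Rightarrow> 'v \<Rightarrow> bool" (infixr \<open>\<^bold>\<longleftrightarrow>\<close> 25) where
  "(\<phi> \<^bold>\<longleftrightarrow> \<psi>) = ((\<phi> \<^bold>\<longrightarrow> \<psi>) \<^bold>\<and> (\<psi> \<^bold>\<longrightarrow> \<phi>))"

definition fall :: "('v name \<Rightarrow> 'v \<Rightarrow> bool) \<Rightarrow> 'v \<Rightarrow> bool" (binder \<open>\<^bold>\<forall>\<close> 10) where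
  "(\<^bold>\<forall>x. \<phi> x) = (\<^bold>\<not> (\<^bold>\<exists>x. \<^bold>\<not> \<phi> x))"

definition forced :: "('v \<Rightarrow> bool) \<Rightarrow> bool" where
  "forced \<phi> \<longleftrightarrow> (\<forall>p\<in>P. \<phi> p)"

text \<open>
  The set-theoretic formula expressing that \<open>(C, m)\<close> is a free abelian group, where \<open>m\<close> is the
  graph of the group operation, i.e. the set of all \<open>\<langle>x, \<langle>y, z\<rangle>\<rangle>\<close> with \<open>x + y = z\<close>. The generated
  subgroup \<open>\<langle>X\<rangle>\<close> is the intersection of all subgroups containing \<open>X\<close>, and the set of positive
  multiples of \<open>b\<close> is the intersection of all sets that contain \<open>b\<close> and are closed under adding
  \<open>b\<close>. A free abelian group is a direct sum of infinite cyclic groups \<open>\<langle>b\<rangle>\<close>, \<open>b \<in> B\<close>: the set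
  \<open>B\<close> generates \<open>C\<close>, and each \<open>b \<in> B\<close> has infinite order and satisfies \<open>\<langle>b\<rangle> \<inter> \<langle>B - {b}\<rangle> = 0\<close>.
\<close>

definition is_upair :: "'v name \<Rightarrow> 'v name \<Rightarrow> 'v name \<Rightarrow> 'v \<Rightarrow> bool" where
  "is_upair z x y = (\<^bold>\<forall>u. u \<^bold>\<in> z \<^bold>\<longleftrightarrow> u \<^bold>= x \<^bold>\<or> u \<^bold>= y)"

definition is_pair :: "'v name \<Rightarrow> 'v name \<Rightarrow> 'v name \<Rightarrow> 'v \<Rightarrow> bool" where
  "is_pair z x y = (\<^bold>\<forall>u. u \<^bold>\<in> z \<^bold>\<longleftrightarrow> is_upair u x x \<^bold>\<or> is_upair u x y)"

definition is_op :: "'v name \<Rightarrow> 'v name \<Rightarrow> 'v name \<Rightarrow> 'v name \<Rightarrow> 'v \<Rightarrow> bool" where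
  "is_op m x y z = (\<^bold>\<exists>t. t \<^bold>\<in> m \<^bold>\<and> (\<^bold>\<exists>s. is_pair s y z \<^bold>\<and> is_pair t x s))"

definition is_zero :: "'v name \<Rightarrow> 'v name \<Rightarrow> 'v name \<Rightarrow> 'v \<Rightarrow> bool" where
  "is_zero C m e = (e \<^bold>\<in> C \<^bold>\<and> (\<^bold>\<forall>x. x \<^bold>\<in> C \<^bold>\<longrightarrow> is_op m e x x \<^bold>\<and> is_op m x e x))"

definition is_binop :: "'v name \<Rightarrow> 'v name \<Rightarrow> 'v \<Rightarrow> bool" where
  "is_binop C m =
     (\<^bold>\<forall>x. \<^bold>\<forall>y. x \<^bold>\<in> C \<^bold>\<and> y \<^bold>\<in> C \<^bold>\<longrightarrow>
        (\<^bold>\<exists>z. z \<^bold>\<in> C \<^bold>\<and> is_op m x y z \<^bold>\<and> (\<^bold>\<forall>z'. is_op m x y z' \<^bold>\<longrightarrow> z' \<^bold>= z)))"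

definition is_assoc :: "'v name \<Rightarrow> 'v name \<Rightarrow> 'v \<Rightarrow> bool" where
  "is_assoc C m =
     (\<^bold>\<forall>x. \<^bold>\<forall>y. \<^bold>\<forall>z. x \<^bold>\<in> C \<^bold>\<and> y \<^bold>\<in> C \<^bold>\<and> z \<^bold>\<in> C \<^bold>\<longrightarrow>
        (\<^bold>\<forall>u. \<^bold>\<forall>v. \<^bold>\<forall>w. is_op m x y u \<^bold>\<and> is_op m y z v \<^bold>\<and> is_op m u z w \<^bold>\<longrightarrow> is_op m x v w))"

definition is_comm :: "'v name \<Rightarrow> 'v name \<Rightarrow> 'v \<Rightarrow> bool" where
  "is_comm C m =
     (\<^bold>\<forall>x. \<^bold>\<forall>y. \<^bold>\<forall>z. x \<^bold>\<in> C \<^bold>\<and> y \<^bold>\<in> C \<^bold>\<and> is_op m x y z \<^bold>\<longrightarrow> is_op m y x z)"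

definition has_inverses :: "'v name \<Rightarrow> 'v name \<Rightarrow> 'v name \<Rightarrow> 'v \<Rightarrow> bool" where
  "has_inverses C m H =
     (\<^bold>\<forall>x. x \<^bold>\<in> H \<^bold>\<longrightarrow> (\<^bold>\<exists>y. y \<^bold>\<in> H \<^bold>\<and> (\<^bold>\<exists>e. is_zero C m e \<^bold>\<and> is_op m x y e)))"

definition is_abelian_group :: "'v name \<Rightarrow> 'v name \<Rightarrow> 'v \<Rightarrow> bool" where
  "is_abelian_group C m =
     (is_binop C m \<^bold>\<and> is_assoc C m \<^bold>\<and> is_comm C m \<^bold>\<and> (\<^bold>\<exists>e. is_zero C m e) \<^bold>\<and> has_inverses C m C)"

definition is_subset :: "'v name \<Rightarrow> 'v name \<Rightarrow> 'v \<Rightarrow> bool" where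
  "is_subset X Y = (\<^bold>\<forall>x. x \<^bold>\<in> X \<^bold>\<longrightarrow> x \<^bold>\<in> Y)"

definition is_subgroup :: "'v name \<Rightarrow> 'v name \<Rightarrow> 'v name \<Rightarrow> 'v \<Rightarrow> bool" where
  "is_subgroup C m H =
     (is_subset H C \<^bold>\<and> (\<^bold>\<exists>e. is_zero C m e \<^bold>\<and> e \<^bold>\<in> H) \<^bold>\<and>
      (\<^bold>\<forall>x. \<^bold>\<forall>y. \<^bold>\<forall>z. x \<^bold>\<in> H \<^bold>\<and> y \<^bold>\<in> H \<^bold>\<and> is_op m x y z \<^bold>\<longrightarrow> z \<^bold>\<in> H) \<^bold>\<and>
      has_inverses C m H)"

definition in_span :: "'v name \<Rightarrow> 'v name \<Rightarrow> ('v name \<Rightarrow> 'v \<Rightarrow> bool) \<Rightarrow> 'v name \<Rightarrow> 'v \<Rightarrow> bool" where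
  "in_span C m X x =
     (\<^bold>\<forall>H. is_subgroup C m H \<^bold>\<and> (\<^bold>\<forall>y. X y \<^bold>\<longrightarrow> y \<^bold>\<in> H) \<^bold>\<longrightarrow> x \<^bold>\<in> H)"

definition is_positive_multiple :: "'v name \<Rightarrow> 'v name \<Rightarrow> 'v name \<Rightarrow> 'v \<Rightarrow> bool" where
  "is_positive_multiple m b x =
     (\<^bold>\<forall>N. b \<^bold>\<in> N \<^bold>\<and> (\<^bold>\<forall>y. \<^bold>\<forall>z. y \<^bold>\<in> N \<^bold>\<and> is_op m y b z \<^bold>\<longrightarrow> z \<^bold>\<in> N) \<^bold>\<longrightarrow> x \<^bold>\<in> N)"

definition has_infinite_order :: "'v name \<Rightarrow> 'v name \<Rightarrow> 'v name \<Rightarrow> 'v \<Rightarrow> bool" where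
  "has_infinite_order C m b = (\<^bold>\<forall>e. is_zero C m e \<^bold>\<longrightarrow> \<^bold>\<not> is_positive_multiple m b e)"

definition is_basis :: "'v name \<Rightarrow> 'v name \<Rightarrow> 'v name \<Rightarrow> 'v \<Rightarrow> bool" where
  "is_basis C m B =
     (is_subset B C \<^bold>\<and>
      (\<^bold>\<forall>x. x \<^bold>\<in> C \<^bold>\<longrightarrow> in_span C m (\<lambda>y. y \<^bold>\<in> B) x) \<^bold>\<and>
      (\<^bold>\<forall>b. b \<^bold>\<in> B \<^bold>\<longrightarrow>
         has_infinite_order C m b \<^bold>\<and>
         (\<^bold>\<forall>x. in_span C m (\<lambda>y. y \<^bold>= b) x \<^bold>\<and>
              in_span C m (\<lambda>y. y \<^bold>\<in> B \<^bold>\<and> \<^bold>\<not> y \<^bold>= b) x \<^bold>\<longrightarrow> is_zero C m x)))"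

definition is_free_abelian_group :: "'v name \<Rightarrow> 'v name \<Rightarrow> 'v \<Rightarrow> bool" where
  "is_free_abelian_group C m = (is_abelian_group C m \<^bold>\<and> (\<^bold>\<exists>B. is_basis C m B))"

end


section \<open>Potentially free abelian groups\<close>

text \<open>
  Groups are the (multiplicatively written) groups of HOL-Algebra whose carrier is a set of the
  universe. Only the carrier and the graph of the operation enter the forcing language.
\<close>

definition carrier_code :: "('v::zfc_universe) monoid \<Rightarrow> 'v" where
  "carrier_code G = vset (carrier G)"

definition mult_code :: "('v::zfc_universe) monoid \<Rightarrow> 'v" where
  "mult_code G = vset {vpair x (vpair y (x \<otimes>\<^bsub>G\<^esub> y)) | x y. x \<in> carrier G \<and> y \<in> carrier G}"

definition forces_free ::
    "'v::zfc_universe set \<Rightarrow> 'v rel \<Rightarrow> 'v \<Rightarrow> 'v monoid \<Rightarrow> bool" where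
  "forces_free P leq p0 G \<longleftrightarrow>
     forcing_notion.forced P
       (forcing_notion.is_free_abelian_group P leq
          (check p0 (carrier_code G)) (check p0 (mult_code G)))"

definition sigma_closed_potentially_free :: "('v::zfc_universe) monoid \<Rightarrow> bool" where
  "sigma_closed_potentially_free G \<longleftrightarrow>
     (\<exists>P leq p0. forcing_poset P leq p0 \<and> sigma_closed P leq \<and> forces_free P leq p0 G)"

definition not_potentially_free_groups :: "('v::zfc_universe) monoid set" where
  "not_potentially_free_groups =
     {G. comm_group G \<and> small (carrier G) \<and> \<not> sigma_closed_potentially_free G}"


section \<open>Abstract elementary classes\<close>

text \<open>
  Structures for the vocabulary \<open>{\<otimes>, \<one>}\<close> are records of type \<open>'v monoid\<close>. Since HOL-Algebra's
  \<^const>\<open>iso\<close> does not speak about \<open>\<one>\<close>, preservation of \<open>\<one>\<close> is added here. Records are not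
  determined by the structure they represent (the operation is arbitrary off the carrier), so the
  union of a chain is any structure on the union of the carriers that extends all its members.
\<close>

definition structure_iso ::
    "('v::zfc_universe \<Rightarrow> 'v) \<Rightarrow> 'v monoid \<Rightarrow> 'v monoid \<Rightarrow> bool" where
  "structure_iso f M N \<longleftrightarrow> f \<in> iso M N \<and> f \<one>\<^bsub>M\<^esub> = \<one>\<^bsub>N\<^esub>"

definition substructure :: "('v::zfc_universe) monoid \<Rightarrow> 'v monoid \<Rightarrow> bool" where
  "substructure M N \<longleftrightarrow>
     carrier M \<subseteq> carrier N \<and> \<one>\<^bsub>M\<^esub> = \<one>\<^bsub>N\<^esub> \<and>
     (\<forall>x\<in>carrier M. \<forall>y\<in>carrier M. x \<otimes>\<^bsub>M\<^esub> y = x \<otimes>\<^bsub>N\<^esub> y)"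

definition union_structure ::
    "('v::zfc_universe) monoid \<Rightarrow> 'v set \<Rightarrow> ('v \<Rightarrow> 'v monoid) \<Rightarrow> bool" where
  "union_structure U I M \<longleftrightarrow>
     carrier U = (\<Union>i\<in>I. carrier (M i)) \<and> (\<forall>i\<in>I. substructure (M i) U)"

definition continuous_chain ::
    "('v::zfc_universe) monoid set \<Rightarrow> ('v monoid \<Rightarrow> 'v monoid \<Rightarrow> bool) \<Rightarrow>
     'v \<Rightarrow> ('v \<Rightarrow> 'v monoid) \<Rightarrow> bool" where
  "continuous_chain K prec \<delta> M \<longleftrightarrow>
     (\<forall>i\<in>elts \<delta>. M i \<in> K) \<and>
     (\<forall>j\<in>elts \<delta>. \<forall>i\<in>elts j. prec (M i) (M j)) \<and>
     (\<forall>j\<in>elts \<delta>. limit_ordinal j \<longrightarrow> union_structure (M j) (elts j) M)"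

definition closed_under_iso :: "('v::zfc_universe) monoid set \<Rightarrow> bool" where
  "closed_under_iso K \<longleftrightarrow>
     (\<forall>M N f. M \<in> K \<and> small (carrier N) \<and> structure_iso f M N \<longrightarrow> N \<in> K)"

definition iso_invariant ::
    "('v::zfc_universe) monoid set \<Rightarrow> ('v monoid \<Rightarrow> 'v monoid \<Rightarrow> bool) \<Rightarrow> bool" where
  "iso_invariant K prec \<longleftrightarrow>
     (\<forall>M\<in>K. \<forall>N\<in>K. \<forall>M'\<in>K. \<forall>N'\<in>K. \<forall>f.
        prec M N \<and> structure_iso f N N' \<and> structure_iso f M M' \<longrightarrow> prec M' N')"

definition refines_substructure ::
    "('v::zfc_universe) monoid set \<Rightarrow> ('v monoid \<Rightarrow> 'v monoid \<Rightarrow> bool) \<Rightarrow> bool" where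
  "refines_substructure K prec \<longleftrightarrow> (\<forall>M\<in>K. \<forall>N\<in>K. prec M N \<longrightarrow> substructure M N)"

definition coherent ::
    "('v::zfc_universe) monoid set \<Rightarrow> ('v monoid \<Rightarrow> 'v monoid \<Rightarrow> bool) \<Rightarrow> bool" where
  "coherent K prec \<longleftrightarrow>
     (\<forall>M0\<in>K. \<forall>M1\<in>K. \<forall>M2\<in>K.
        substructure M0 M1 \<and> prec M0 M2 \<and> prec M1 M2 \<longrightarrow> prec M0 M1)"

definition tarski_vaught_chains ::
    "('v::zfc_universe) monoid set \<Rightarrow> ('v monoid \<Rightarrow> 'v monoid \<Rightarrow> bool) \<Rightarrow> bool" where
  "tarski_vaught_chains K prec \<longleftrightarrow>
     (\<forall>\<delta> M U. limit_ordinal \<delta> \<and> continuous_chain K prec \<delta> M \<and> union_structure U (elts \<delta>) M \<longrightarrow>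
        U \<in> K \<and>
        (\<forall>i\<in>elts \<delta>. prec (M i) U) \<and>
        (\<forall>N\<in>K. (\<forall>i\<in>elts \<delta>. prec (M i) N) \<longrightarrow> prec U N))"

definition loewenheim_skolem ::
    "('v::zfc_universe) monoid set \<Rightarrow> ('v monoid \<Rightarrow> 'v monoid \<Rightarrow> bool) \<Rightarrow> bool" where
  "loewenheim_skolem K prec \<longleftrightarrow>
     (\<exists>\<mu> :: 'v. cardinal \<mu> \<and>
        (\<forall>B\<in>K. \<forall>A\<subseteq>carrier B. \<exists>A'\<in>K.
           A \<subseteq> carrier A' \<and> prec A' B \<and> |carrier A'| \<le>o |A| +c |elts \<mu>| ))"

definition abstract_elementary_class ::
    "('v::zfc_universe) monoid set \<Rightarrow> ('v monoid \<Rightarrow> 'v monoid \<Rightarrow> bool) \<Rightarrow> bool" where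
  "abstract_elementary_class K prec \<longleftrightarrow>
     closed_under_iso K \<and> iso_invariant K prec \<and> refines_substructure K prec \<and>
     coherent K prec \<and> tarski_vaught_chains K prec \<and> loewenheim_skolem K prec"

text \<open>\<open>M\<close> is pure in \<open>N\<close> if every \<open>n x \<in> M\<close> with \<open>x \<in> N\<close> is \<open>n y\<close> for some \<open>y \<in> M\<close>.\<close>

definition pure_substructure :: "('v::zfc_universe) monoid \<Rightarrow> 'v monoid \<Rightarrow> bool" where
  "pure_substructure M N \<longleftrightarrow>
     substructure M N \<and>
     (\<forall>n::nat. \<forall>x\<in>carrier N. x [^]\<^bsub>N\<^esub> n \<in> carrier M \<longrightarrow>
        (\<exists>y\<in>carrier M. y [^]\<^bsub>N\<^esub> n = x [^]\<^bsub>N\<^esub> n))"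

end

theory Submission
  imports
    Complex_Main
    Defs
    "HOL-Library.Function_Algebras"
    "HOL-Algebra.Free_Abelian_Groups"
begin

text \<open>
  The axiom of Loewenheim and Skolem fails. Given a square sequence on \<open>\<mu> = \<kappa>\<^sup>+\<close>, let \<open>S \<theta>\<close>
  consist of the \<open>\<delta> < \<mu>\<close> of cofinality \<open>\<omega>\<close> with \<open>C \<delta>\<close> of order type \<open>\<theta>\<close>; coherence makes it
  non-reflecting. Choose ladders \<open>\<eta> \<delta>\<close> cofinal in \<open>\<delta> \<in> S \<theta>\<close> and let \<open>G \<theta>\<close> be generated by \<open>e \<nu>\<close>
  (\<open>\<nu> < \<mu>\<close>) and \<open>y \<delta> n\<close> with the relations \<open>2 y \<delta> (n + 1) = y \<delta> n - e (\<eta> \<delta> n)\<close>. Below any \<open>\<alpha> < \<mu>\<close>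
  the ladders have disjoint tails, so that all subgroups of \<open>G \<theta>\<close> of size at most \<open>\<kappa>\<close> are free.

  On the other hand, if \<open>\<sigma>\<close>-closed posets forced all \<open>G \<theta>\<close>, \<open>\<theta> \<le> \<kappa>\<close>, to be free, then for every
  \<open>\<theta>\<close> there would be a tree of conditions, indexed by finite sequences of ordinals, deciding
  finite parts of a basis. Some \<open>\<delta> < \<mu>\<close> of cofinality \<open>\<omega>\<close> is closed under all these trees; let \<open>\<theta>\<close>
  be the order type of its \<open>C \<delta>\<close>. Following the ladder \<open>\<eta> \<delta>\<close> and using \<open>\<sigma>\<close>-closure yields a
  condition forcing a direct summand below \<open>\<delta>\<close> modulo which \<open>y \<delta> 0\<close> is divisible by all powers of
  2, although \<open>y \<delta> 0\<close> is not in this summand. Pigeonholing over \<open>\<theta>\<close> in this way replaces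
  stationary sets and their preservation.
\<close>

section \<open>Small classes\<close>

text \<open>A \<sigma>-closed poset may collapse \<mu>, so the argument stays in the ground model;
  of the forcing it uses only that a basis is decided piecewise (\<open>decides_basis\<close>). The
  order type of \<open>C \<delta>\<close> for a closed \<open>\<delta>\<close> cannot be prescribed
  in advance, but it lies in \<open>osucc \<kappa>\<close>, so that only \<kappa> many trees have to
  be closed off, which the regularity of \<mu> permits. For the same reason the proof does not tell
  which \<open>G \<theta>\<close> is the counterexample. The groups live in rational vector spaces,
  where the relations for \<open>y \<delta> n\<close> are solved by division, and are copied into
  the universe along injections. The proper class of cardinals provides a \<kappa> above the
  Loewenheim-Skolem number; the axiom, applied to the empty set, would then give a subgroup of size
  at most \<kappa> that is not potentially free, whereas free groups are potentially free by the
  one-element poset.\<close>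

lemma elts_inject [simp]: "elts x = elts y \<longleftrightarrow> x = y"
  by (auto dest: extensionality)

lemma small_elts [simp, intro]: "small (elts x)"
  by (auto simp: small_def)

lemma elts_vset: "small A \<Longrightarrow> elts (vset A) = A"
  unfolding small_def vset_def by (metis (mono_tags, lifting) elts_inject theI)

lemma small_subset: "small B \<Longrightarrow> A \<subseteq> B \<Longrightarrow> small A"
  unfolding small_def using separation by blast

lemma small_image [simp, intro]: "small A \<Longrightarrow> small (f ` A)" for f :: "'v::zfc_universe \<Rightarrow> 'v"
  unfolding small_def using replacement by metis

lemma small_UN: "small A \<Longrightarrow> (\<And>x. x \<in> A \<Longrightarrow> small (F x)) \<Longrightarrow> small (\<Union>x\<in>A. F x)"
  for F :: "'v::zfc_universe \<Rightarrow> 'v set"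
proof -
  assume A: "small A" and F: "\<And>x. x \<in> A \<Longrightarrow> small (F x)"
  obtain a where a: "elts a = (\<lambda>x. vset (F x)) ` A"
    using small_image[OF A] unfolding small_def by blast
  obtain u where "elts u = \<Union> (elts ` elts a)"
    using union by blast
  moreover have "\<Union> (elts ` elts a) = (\<Union>x\<in>A. F x)"
    using F by (simp add: a elts_vset)
  ultimately show ?thesis
    unfolding small_def by metis
qed

lemma small_empty [simp, intro]: "small ({} :: 'v::zfc_universe set)"
  by (rule small_subset[OF small_elts[of undefined]]) simp

text \<open>The power set of the empty set is inhabited, so replacement along a constant function
  turns it into any given singleton. Pairing is derived from the axioms in this way.\<close>

lemma small_singleton [simp, intro]: "small {x :: 'v::zfc_universe}"
proof -
  obtain u where u: "elts u = {y :: 'v. elts y \<subseteq> elts (vset {})}"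
    using power_set by blast
  then have "vset {} \<in> elts u"
    by simp
  then have "(\<lambda>_. x) ` elts u = {x}"
    by blast
  then show ?thesis
    using small_image[OF small_elts[of u], of "\<lambda>_. x"] by simp
qed

lemma vset_singleton_neq_empty: "vset {vset {}} \<noteq> (vset {} :: 'v::zfc_universe)"
proof
  assume "vset {vset {}} = (vset {} :: 'v)"
  then have "elts (vset {vset {}}) = elts (vset {} :: 'v)"
    by simp
  then show False
    by (simp add: elts_vset)
qed

text \<open>The empty set and its singleton are different subsets of a singleton, so the power set
  contains a two-element subset, which replacement maps onto the pair.\<close>

lemma small_doubleton: "small {x, y :: 'v::zfc_universe}"
proof -
  let ?e = "vset {} :: 'v"
  obtain u where u: "elts u = {z. elts z \<subseteq> elts (vset {?e})}"
    using power_set by blast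
  have "{?e, vset {?e}} \<subseteq> elts u"
    by (auto simp: u elts_vset)
  then have s: "small {?e, vset {?e}}"
    using small_subset by blast
  have "{x, y} = (\<lambda>z. if z = ?e then x else y) ` {?e, vset {?e}}"
    using vset_singleton_neq_empty by auto
  then show ?thesis
    using small_image[OF s] by metis
qed

lemma small_Un: "small A \<Longrightarrow> small B \<Longrightarrow> small (A \<union> B)"
proof -
  assume A: "small A" and B: "small B"
  have "small (\<Union>x\<in>{vset A, vset B}. elts x)"
    by (rule small_UN[OF small_doubleton]) simp
  then show ?thesis
    by (simp add: elts_vset A B)
qed

lemma small_insert: "small A \<Longrightarrow> small (insert x A)"
  using small_Un[of "{x}" A] by simp

lemma elts_upair: "elts (vset {x, y}) = {x, y}"
  by (simp add: elts_vset small_doubleton)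

lemma elts_vpair: "elts (vpair x y) = {vset {x}, vset {x, y}}"
  unfolding vpair_def by (simp add: elts_vset small_doubleton)

lemma vset_inject: "small A \<Longrightarrow> small B \<Longrightarrow> vset A = vset B \<longleftrightarrow> A = B"
  by (metis elts_vset)

lemma vpair_inject [simp]: "vpair x y = vpair x' y' \<longleftrightarrow> x = x' \<and> y = y'"
proof
  assume "vpair x y = vpair x' y'"
  then have "{vset {x}, vset {x, y}} = {vset {x'}, vset {x', y'}}"
    by (metis elts_vpair)
  then show "x = x' \<and> y = y'"
    by (simp add: doubleton_eq_iff vset_inject small_doubleton) 
      (auto simp: doubleton_eq_iff vset_inject small_doubleton)
qed simp

lemma small_vpair_image:
  "small A \<Longrightarrow> (\<And>x. x \<in> A \<Longrightarrow> small (B x)) \<Longrightarrow> small {vpair x y | x y. x \<in> A \<and> y \<in> B x}"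
proof -
  assume A: "small A" and B: "\<And>x. x \<in> A \<Longrightarrow> small (B x)"
  have "{vpair x y | x y. x \<in> A \<and> y \<in> B x} = (\<Union>x\<in>A. vpair x ` B x)"
    by blast
  then show ?thesis
    using small_UN[OF A, of "\<lambda>x. vpair x ` B x"] B by simp
qed

lemma small_if_card_le:
  assumes "|A| \<le>o |elts z|"
  obtains g where "inj_on g A" "g ` A \<subseteq> elts z" "small (g ` A)"
  using assms small_subset[OF small_elts[of z]] unfolding card_of_ordLeq[symmetric] by metis

section \<open>The forcing relation\<close>

locale poset_forcing = forcing_notion P leq
  for P :: "'v::zfc_universe set" and leq :: "'v rel" +
  fixes p0 :: 'v
  assumes poset: "forcing_poset P leq p0"
begin

abbreviation le :: "'v \<Rightarrow> 'v \<Rightarrow> bool" (infix \<open>\<preceq>\<close> 50) where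
  "q \<preceq> p \<equiv> (q, p) \<in> leq"

lemma le_in: "q \<preceq> p \<Longrightarrow> q \<in> P \<and> p \<in> P"
  using poset by (auto simp: forcing_poset_def preorder_on_def)

lemma le_refl [simp, intro]: "p \<in> P \<Longrightarrow> p \<preceq> p"
  using poset by (auto simp: forcing_poset_def preorder_on_def refl_on_def)

lemma le_trans: "r \<preceq> q \<Longrightarrow> q \<preceq> p \<Longrightarrow> r \<preceq> p"
  using poset unfolding forcing_poset_def preorder_on_def by (blast dest: transD)

lemma le_top [simp, intro]: "p \<in> P \<Longrightarrow> p \<preceq> p0"
  using poset by (auto simp: forcing_poset_def)

lemma top_in [simp, intro]: "p0 \<in> P"
  using poset by (auto simp: forcing_poset_def)

lemma dense_below_iff: "dense_below D p \<longleftrightarrow> (\<forall>q. q \<preceq> p \<longrightarrow> (\<exists>r. r \<preceq> q \<and> D r))"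
  unfolding dense_below_def by (meson le_in)

lemma dense_below_mono: "dense_below D p \<Longrightarrow> (\<And>r. r \<preceq> p \<Longrightarrow> D r \<Longrightarrow> D' r) \<Longrightarrow> dense_below D' p"
  unfolding dense_below_iff by (meson le_trans)

lemma dense_below_le: "dense_below D p \<Longrightarrow> q \<preceq> p \<Longrightarrow> dense_below D q"
  unfolding dense_below_iff by (meson le_trans)

text \<open>Truth of a formula at a condition is inherited by stronger conditions and is a local
  property; this is what allows to read the derived connectives as in Beth semantics.\<close>

definition regular :: "('v \<Rightarrow> bool) \<Rightarrow> bool" where
  "regular \<phi> \<longleftrightarrow> (\<forall>p q. q \<preceq> p \<longrightarrow> \<phi> p \<longrightarrow> \<phi> q) \<and> (\<forall>p\<in>P. dense_below \<phi> p \<longrightarrow> \<phi> p)"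

lemma regular_le: "regular \<phi> \<Longrightarrow> \<phi> p \<Longrightarrow> q \<preceq> p \<Longrightarrow> \<phi> q"
  unfolding regular_def by blast

lemma regular_dense: "regular \<phi> \<Longrightarrow> p \<in> P \<Longrightarrow> dense_below \<phi> p \<Longrightarrow> \<phi> p"
  unfolding regular_def by blast

text \<open>The standard move to a stronger condition: for a regular goal it suffices to argue at
  conditions below \<open>p\<close> that satisfy \<open>D\<close>, so names may be assumed decided
  there.\<close>

lemma denseE:
  "dense_below D p \<Longrightarrow> p \<in> P \<Longrightarrow> regular \<psi> \<Longrightarrow> (\<And>r. r \<in> P \<Longrightarrow> r \<preceq> p \<Longrightarrow> D r \<Longrightarrow> \<psi> r) \<Longrightarrow> \<psi> p"
  using regular_dense[of \<psi> p] dense_below_mono[of D p \<psi>] le_in by blast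

lemma denseI: "p \<in> P \<Longrightarrow> (\<And>r. r \<in> P \<Longrightarrow> r \<preceq> p \<Longrightarrow> D r) \<Longrightarrow> dense_below D p"
  unfolding dense_below_iff by (meson le_in le_refl)

lemma regular_dense_below [simp, intro]: "regular (dense_below D)"
  unfolding regular_def dense_below_iff by (meson le_trans)

text \<open>Facts about the ground model count as formulas that do not depend on the condition.
  Hence they can be goals of \<open>denseE\<close>, which is how forced statements are turned into
  true ones.\<close>

lemma regular_const [simp, intro]: "regular (\<lambda>_. Q)"
  unfolding regular_def dense_below_iff by auto

lemma regular_conj [intro]:
  assumes "regular \<phi>" "regular \<psi>"
  shows "regular (\<lambda>p. \<phi> p \<and> \<psi> p)"
  unfolding regular_def
proof (intro conjI allI impI ballI)
  fix p assume p: "p \<in> P" and d: "dense_below (\<lambda>p. \<phi> p \<and> \<psi> p) p"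
  show "\<phi> p" "\<psi> p"
    using assms p by (auto intro!: regular_dense dense_below_mono[OF d])
qed (auto intro: regular_le[OF assms(1)] regular_le[OF assms(2)])

lemma regular_all [intro]:
  assumes "\<And>x. regular (\<phi> x)"
  shows "regular (\<lambda>p. \<forall>x. \<phi> x p)"
  unfolding regular_def
proof (intro conjI allI impI ballI)
  fix p x assume p: "p \<in> P" and d: "dense_below (\<lambda>p. \<forall>x. \<phi> x p) p"
  show "\<phi> x p"
    by (rule regular_dense[OF assms p dense_below_mono[OF d]]) simp
next
  fix p q x assume "q \<preceq> p" "\<forall>x. \<phi> x p"
  then show "\<phi> x q"
    using regular_le[OF assms[of x]] by blast
qed

lemma regular_fand [simp, intro]: "regular \<phi> \<Longrightarrow> regular \<psi> \<Longrightarrow> regular (\<phi> \<^bold>\<and> \<psi>)"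
  unfolding fand_def by (rule regular_conj)

lemma fnot_iff: "(\<^bold>\<not> \<phi>) p \<longleftrightarrow> (\<forall>q. q \<preceq> p \<longrightarrow> \<not> \<phi> q)"
  unfolding fnot_def by (meson le_in)

lemma regular_fnot [simp, intro]: "regular \<phi> \<Longrightarrow> regular (\<^bold>\<not> \<phi>)"
  unfolding regular_def dense_below_iff fnot_iff by (meson le_trans le_in le_refl)

lemma regular_fex [simp, intro]: "regular (\<^bold>\<exists>x. \<phi> x)"
  unfolding fex_def by (rule regular_dense_below)

lemma regular_fall [simp, intro]: "regular (\<^bold>\<forall>x. \<phi> x)"
  unfolding fall_def by (intro regular_fnot regular_fex)

lemma regular_f_or [simp, intro]: "regular \<phi> \<Longrightarrow> regular \<psi> \<Longrightarrow> regular (\<phi> \<^bold>\<or> \<psi>)"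
  unfolding f_or_def by (intro regular_fnot regular_fand)

lemma regular_fimp [simp, intro]: "regular \<phi> \<Longrightarrow> regular \<psi> \<Longrightarrow> regular (\<phi> \<^bold>\<longrightarrow> \<psi>)"
  unfolding fimp_def by (intro regular_fnot regular_fand)

lemma regular_fiff [simp, intro]: "regular \<phi> \<Longrightarrow> regular \<psi> \<Longrightarrow> regular (\<phi> \<^bold>\<longleftrightarrow> \<psi>)"
  unfolding fiff_def by (intro regular_fimp regular_fand)

text \<open>The definition by negation and conjunction only says that \<open>\<psi>\<close> holds
  densely below every \<open>q\<close> forcing \<open>\<phi>\<close>; regularity of
  \<open>\<psi>\<close> removes the density.\<close>

lemma fimp_iff:
  assumes "regular \<phi>" "regular \<psi>"
  shows "(\<phi> \<^bold>\<longrightarrow> \<psi>) p \<longleftrightarrow> (\<forall>q. q \<preceq> p \<longrightarrow> \<phi> q \<longrightarrow> \<psi> q)"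
proof
  assume L: "(\<phi> \<^bold>\<longrightarrow> \<psi>) p"
  show "\<forall>q. q \<preceq> p \<longrightarrow> \<phi> q \<longrightarrow> \<psi> q"
  proof (intro allI impI)
    fix q assume q: "q \<preceq> p" "\<phi> q"
    then have "dense_below \<psi> q"
      unfolding dense_below_iff
      using L regular_le[OF assms(1)] le_trans unfolding fimp_def fand_def fnot_iff by meson
    then show "\<psi> q"
      using assms(2) q(1) le_in by (meson regular_dense)
  qed
next
  assume "\<forall>q. q \<preceq> p \<longrightarrow> \<phi> q \<longrightarrow> \<psi> q"
  then show "(\<phi> \<^bold>\<longrightarrow> \<psi>) p"
    unfolding fimp_def fand_def fnot_iff by (meson le_in le_refl)
qed

lemma fiff_iff:
  "regular \<phi> \<Longrightarrow> regular \<psi> \<Longrightarrow> (\<phi> \<^bold>\<longleftrightarrow> \<psi>) p \<longleftrightarrow> (\<forall>q. q \<preceq> p \<longrightarrow> \<phi> q \<longleftrightarrow> \<psi> q)"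
  unfolding fiff_def fand_def by (auto simp: fimp_iff)

lemma f_or_iff:
  "regular \<phi> \<Longrightarrow> regular \<psi> \<Longrightarrow> (\<phi> \<^bold>\<or> \<psi>) p \<longleftrightarrow> dense_below (\<lambda>q. \<phi> q \<or> \<psi> q) p"
  unfolding f_or_def fand_def fnot_iff dense_below_iff by (meson regular_le le_trans le_in le_refl)

text \<open>Unfolding not-exists-not gives density of \<open>\<phi> x\<close> below \<open>p\<close>
  for each name \<open>x\<close>; regularity again yields the pointwise clause, and with it
  introduction and elimination as in ordinary logic.\<close>

lemma fall_iff:
  assumes "\<And>x. regular (\<phi> x)" "p \<in> P"
  shows "(\<^bold>\<forall>x. \<phi> x) p \<longleftrightarrow> (\<forall>x. is_name x \<longrightarrow> \<phi> x p)"
proof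
  assume L: "(\<^bold>\<forall>x. \<phi> x) p"
  show "\<forall>x. is_name x \<longrightarrow> \<phi> x p"
  proof (intro allI impI)
    fix x assume x: "is_name x"
    have "dense_below (\<phi> x) p"
      unfolding dense_below_iff
    proof (intro allI impI)
      fix q assume q: "q \<preceq> p"
      show "\<exists>r. r \<preceq> q \<and> \<phi> x r"
      proof (rule ccontr)
        assume n: "\<nexists>r. r \<preceq> q \<and> \<phi> x r"
        have "(\<^bold>\<exists>x. \<^bold>\<not> \<phi> x) q"
          unfolding fex_def dense_below_iff fnot_iff using x n by (meson le_in le_refl le_trans)
        then show False
          using L q unfolding fall_def fnot_iff by blast
      qed
    qed
    then show "\<phi> x p"
      using assms regular_dense by blast
  qed
next
  assume "\<forall>x. is_name x \<longrightarrow> \<phi> x p"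
  then show "(\<^bold>\<forall>x. \<phi> x) p"
    unfolding fall_def fnot_iff fex_def dense_below_iff
    by (meson regular_le[OF assms(1)] le_in le_refl le_trans)
qed

lemma fallI: "p \<in> P \<Longrightarrow> (\<And>x. regular (\<phi> x)) \<Longrightarrow> (\<And>x. is_name x \<Longrightarrow> \<phi> x p) \<Longrightarrow> (\<^bold>\<forall>x. \<phi> x) p"
  by (simp add: fall_iff)

lemma fallD: "(\<^bold>\<forall>x. \<phi> x) p \<Longrightarrow> (\<And>x. regular (\<phi> x)) \<Longrightarrow> p \<in> P \<Longrightarrow> is_name x \<Longrightarrow> \<phi> x p"
  by (simp add: fall_iff)

lemma fimpI:
  "p \<in> P \<Longrightarrow> regular \<phi> \<Longrightarrow> regular \<psi> \<Longrightarrow> (\<And>q. q \<in> P \<Longrightarrow> q \<preceq> p \<Longrightarrow> \<phi> q \<Longrightarrow> \<psi> q) \<Longrightarrow> (\<phi> \<^bold>\<longrightarrow> \<psi>) p"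
  using le_in by (simp add: fimp_iff)

lemma fimpD: "(\<phi> \<^bold>\<longrightarrow> \<psi>) p \<Longrightarrow> regular \<phi> \<Longrightarrow> regular \<psi> \<Longrightarrow> p \<in> P \<Longrightarrow> \<phi> p \<Longrightarrow> \<psi> p"
  by (simp add: fimp_iff)

lemma fexI: "p \<in> P \<Longrightarrow> is_name x \<Longrightarrow> regular (\<phi> x) \<Longrightarrow> \<phi> x p \<Longrightarrow> (\<^bold>\<exists>x. \<phi> x) p"
  unfolding fex_def by (rule denseI) (auto dest: regular_le)

lemma fexE:
  "(\<^bold>\<exists>x. \<phi> x) p \<Longrightarrow> p \<in> P \<Longrightarrow> regular \<psi> \<Longrightarrow>
    (\<And>r x. r \<in> P \<Longrightarrow> r \<preceq> p \<Longrightarrow> is_name x \<Longrightarrow> \<phi> x r \<Longrightarrow> \<psi> r) \<Longrightarrow> \<psi> p"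
  unfolding fex_def by (erule denseE) auto

lemma fandI: "\<phi> p \<Longrightarrow> \<psi> p \<Longrightarrow> (\<phi> \<^bold>\<and> \<psi>) p"
  by (simp add: fand_def)

lemma fandE: "(\<phi> \<^bold>\<and> \<psi>) p \<Longrightarrow> (\<phi> p \<Longrightarrow> \<psi> p \<Longrightarrow> R) \<Longrightarrow> R"
  by (simp add: fand_def)

section \<open>Forced equality and membership of names\<close>

fun members :: "'v name \<Rightarrow> ('v name \<times> 'v) set" where
  "members (Name F) = ran F"

lemma members_induct [case_names Name]:
  assumes "\<And>x. (\<And>\<sigma> c. (\<sigma>, c) \<in> members x \<Longrightarrow> Q \<sigma>) \<Longrightarrow> Q x"
  shows "Q x"
proof (induction x rule: wf_induct_rule[OF wf_subname_rel])
  case (1 x)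
  then show ?case
    by (cases x) (rule assms, auto simp: subname_rel_def)
qed

lemma is_name_member: "is_name x \<Longrightarrow> (\<sigma>, c) \<in> members x \<Longrightarrow> is_name \<sigma> \<and> c \<in> P"
  by (erule is_name.cases) auto

lemma feq_iff:
  "feq x y p \<longleftrightarrow>
     (\<forall>\<sigma> c. (\<sigma>, c) \<in> members x \<longrightarrow>
        dense_below (\<lambda>q. q \<preceq> c \<longrightarrow> (\<exists>\<tau> d. (\<tau>, d) \<in> members y \<and> q \<preceq> d \<and> feq \<sigma> \<tau> q)) p) \<and>
     (\<forall>\<tau> d. (\<tau>, d) \<in> members y \<longrightarrow>
        dense_below (\<lambda>q. q \<preceq> d \<longrightarrow> (\<exists>\<sigma> c. (\<sigma>, c) \<in> members x \<and> q \<preceq> c \<and> feq \<sigma> \<tau> q)) p)"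
  by (cases x; cases y) (simp add: split_def Ball_def Bex_def)

lemma fmem_iff: "fmem x y p \<longleftrightarrow> dense_below (\<lambda>q. \<exists>\<tau> d. (\<tau>, d) \<in> members y \<and> q \<preceq> d \<and> feq \<tau> x q) p"
  by (cases y) (simp add: split_def Bex_def)

declare feq.simps [simp del] fmem.simps [simp del]

lemma regular_feq [simp, intro]: "regular (feq x y)"
proof -
  have "feq x y = (\<lambda>p. (\<forall>\<sigma> c. (\<sigma>, c) \<in> members x \<longrightarrow>
        dense_below (\<lambda>q. q \<preceq> c \<longrightarrow> (\<exists>\<tau> d. (\<tau>, d) \<in> members y \<and> q \<preceq> d \<and> feq \<sigma> \<tau> q)) p) \<and>
     (\<forall>\<tau> d. (\<tau>, d) \<in> members y \<longrightarrow>
        dense_below (\<lambda>q. q \<preceq> d \<longrightarrow> (\<exists>\<sigma> c. (\<sigma>, c) \<in> members x \<and> q \<preceq> c \<and> feq \<sigma> \<tau> q)) p))"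
    by (rule ext) (rule feq_iff)
  moreover have imp: "regular (\<lambda>p. Q \<longrightarrow> dense_below D p)" for Q D
    by (cases Q) auto
  ultimately show ?thesis
    by (auto intro!: regular_conj regular_all imp)
qed

lemma regular_fmem [simp, intro]: "regular (fmem x y)"
proof -
  have "fmem x y = dense_below (\<lambda>q. \<exists>\<tau> d. (\<tau>, d) \<in> members y \<and> q \<preceq> d \<and> feq \<tau> x q)"
    by (rule ext) (rule fmem_iff)
  then show ?thesis
    by simp
qed

lemma feq_refl [simp, intro]: "p \<in> P \<Longrightarrow> feq x x p"
proof (induction x arbitrary: p rule: members_induct)
  case (Name x)
  then show ?case
    unfolding feq_iff[of x x] by (intro conjI allI impI denseI) blast+
qed

lemma feq_sym: "feq x y p \<longleftrightarrow> feq y x p"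
proof (induction x arbitrary: y p rule: members_induct)
  case (Name x)
  have "(\<exists>\<sigma> c. (\<sigma>, c) \<in> members x \<and> q \<preceq> c \<and> feq \<sigma> \<tau> q) \<longleftrightarrow>
        (\<exists>\<sigma> c. (\<sigma>, c) \<in> members x \<and> q \<preceq> c \<and> feq \<tau> \<sigma> q)" for q \<tau>
    using Name by blast
  moreover have "(\<exists>\<tau> d. (\<tau>, d) \<in> members y \<and> q \<preceq> d \<and> feq \<sigma> \<tau> q) \<longleftrightarrow>
        (\<exists>\<tau> d. (\<tau>, d) \<in> members y \<and> q \<preceq> d \<and> feq \<tau> \<sigma> q)" if "(\<sigma>, c) \<in> members x" for q \<sigma> c
    using Name that by blast
  ultimately show ?case
    unfolding feq_iff[of x y] feq_iff[of y x] by (subst conj_commute) simp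
qed

text \<open>One half of the clause for equality. By symmetry of \<open>feq\<close> both halves take
  this form, so that one lemma on transitivity serves both.\<close>

definition covered :: "'v name \<Rightarrow> 'v \<Rightarrow> 'v name \<Rightarrow> 'v \<Rightarrow> bool" where
  "covered \<sigma> c y =
     dense_below (\<lambda>q. q \<preceq> c \<longrightarrow> (\<exists>\<tau> d. (\<tau>, d) \<in> members y \<and> q \<preceq> d \<and> feq \<sigma> \<tau> q))"

lemma feq_covered:
  "feq x y p \<longleftrightarrow> (\<forall>\<sigma> c. (\<sigma>, c) \<in> members x \<longrightarrow> covered \<sigma> c y p) \<and>
     (\<forall>\<tau> d. (\<tau>, d) \<in> members y \<longrightarrow> covered \<tau> d x p)"
  unfolding feq_iff[of x y] covered_def by (simp add: feq_sym)

text \<open>Going from \<open>\<sigma>\<close> through a member of \<open>y\<close> to a member of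
  \<open>z\<close> costs two passages to a stronger condition; the last assumption is what the
  induction in \<open>feq_trans\<close> supplies.\<close>

lemma covered_trans:
  assumes c: "covered \<sigma> c y p" and y: "\<And>\<tau> d. (\<tau>, d) \<in> members y \<Longrightarrow> covered \<tau> d z p"
    and trans: "\<And>\<tau> \<rho> e q. (\<rho>, e) \<in> members z \<Longrightarrow> feq \<sigma> \<tau> q \<Longrightarrow> feq \<tau> \<rho> q \<Longrightarrow> q \<in> P \<Longrightarrow> feq \<sigma> \<rho> q"
  shows "covered \<sigma> c z p"
  unfolding covered_def dense_below_iff
proof (intro allI impI)
  fix q assume q: "q \<preceq> p"
  show "\<exists>r. r \<preceq> q \<and> (r \<preceq> c \<longrightarrow> (\<exists>\<rho> e. (\<rho>, e) \<in> members z \<and> r \<preceq> e \<and> feq \<sigma> \<rho> r))"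
  proof (cases "\<exists>s. s \<preceq> q \<and> s \<preceq> c")
    case True
    then obtain s where sq: "s \<preceq> q" "s \<preceq> c"
      by blast
    then obtain u \<tau> d where u: "u \<preceq> s" "(\<tau>, d) \<in> members y" "u \<preceq> d" "feq \<sigma> \<tau> u"
      using c q le_trans unfolding covered_def dense_below_iff by meson
    have "u \<preceq> p"
      using u sq q le_trans by blast
    then have "covered \<tau> d z u"
      using y[OF u(2)] dense_below_le unfolding covered_def by blast
    then obtain v \<rho> e where v: "v \<preceq> u" "(\<rho>, e) \<in> members z" "v \<preceq> e" "feq \<tau> \<rho> v"
      unfolding covered_def dense_below_iff using u le_in le_refl le_trans by metis
    then have "feq \<sigma> \<rho> v"
      using trans[OF v(2)] u le_in regular_le[OF regular_feq] by meson
    then show ?thesis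
      using v u sq le_trans by meson
  next
    \<comment> \<open>No condition lies below both \<open>q\<close> and \<open>c\<close>, so
      \<open>q\<close> itself satisfies the implication vacuously.\<close>
    case False
    then show ?thesis
      using q le_in le_refl by meson
  qed
qed

lemma feq_trans: "feq x y p \<Longrightarrow> feq y z p \<Longrightarrow> p \<in> P \<Longrightarrow> feq x z p"
proof (induction x arbitrary: y z p rule: members_induct)
  case (Name x)
  note xy = Name.prems(1)[unfolded feq_covered[of x y]] and yz = Name.prems(2)[unfolded feq_covered[of y z]]
  have "covered \<sigma> c z p" if s: "(\<sigma>, c) \<in> members x" for \<sigma> c
    by (rule covered_trans[of _ _ y]) (use xy yz s Name.IH[OF s] in blast)+
  \<comment> \<open>The induction hypothesis covers only members of \<open>x\<close>; for the
    reverse inclusion it is applied to equations turned round by symmetry.\<close>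
  moreover have "covered \<rho> e x p" if r: "(\<rho>, e) \<in> members z" for \<rho> e
  proof (rule covered_trans[of _ _ y])
    fix \<tau> \<sigma> c q assume "(\<sigma>, c) \<in> members x" "feq \<rho> \<tau> q" "feq \<tau> \<sigma> q" "q \<in> P"
    then show "feq \<rho> \<sigma> q"
      using Name.IH[of \<sigma> c \<tau> q \<rho>] feq_sym[of \<rho>] feq_sym[of \<tau> \<sigma>] by simp
  qed (use xy yz r in blast)+
  ultimately show ?case
    unfolding feq_covered[of x z] by blast
qed

lemma feq_sym': "feq x y p \<Longrightarrow> feq y x p"
  by (rule feq_sym[THEN iffD1])

lemma fmem_cong_left: "fmem x y p \<Longrightarrow> feq x x' p \<Longrightarrow> p \<in> P \<Longrightarrow> fmem x' y p"
  unfolding fmem_iff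
proof (erule dense_below_mono, elim exE conjE)
  fix q \<tau> d assume "q \<preceq> p" "(\<tau>, d) \<in> members y" "q \<preceq> d" "feq \<tau> x q" "feq x x' p"
  then show "\<exists>\<tau> d. (\<tau>, d) \<in> members y \<and> q \<preceq> d \<and> feq \<tau> x' q"
    using feq_trans[of \<tau> x q x'] regular_le[OF regular_feq, of x x' p q] le_in by blast
qed

lemma fmem_cong_right:
  assumes "fmem x y p" "feq y y' p" "p \<in> P"
  shows "fmem x y' p"
proof -
  have "dense_below (\<lambda>q. \<exists>\<tau> d. (\<tau>, d) \<in> members y \<and> q \<preceq> d \<and> feq \<tau> x q) p"
    using assms(1) by (simp add: fmem_iff)
  then show ?thesis
  proof (rule denseE[OF _ \<open>p \<in> P\<close> regular_fmem], elim exE conjE)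
    fix q \<tau> d assume q: "q \<in> P" "q \<preceq> p" and t: "(\<tau>, d) \<in> members y" "q \<preceq> d" "feq \<tau> x q"
    have "covered \<tau> d y' p"
      using assms(2) t(1) unfolding feq_covered[of y y'] by blast
    then have "covered \<tau> d y' q"
      using q(2) unfolding covered_def by (rule dense_below_le)
    then show "fmem x y' q"
      unfolding fmem_iff covered_def
    proof (rule dense_below_mono)
      fix r assume r: "r \<preceq> q" "r \<preceq> d \<longrightarrow> (\<exists>\<rho> e. (\<rho>, e) \<in> members y' \<and> r \<preceq> e \<and> feq \<tau> \<rho> r)"
      then obtain \<rho> e where e: "(\<rho>, e) \<in> members y'" "r \<preceq> e" "feq \<tau> \<rho> r"
        using t le_trans by blast
      moreover have "feq \<tau> x r"
        using t r regular_le[OF regular_feq] by blast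
      ultimately show "\<exists>\<tau> d. (\<tau>, d) \<in> members y' \<and> r \<preceq> d \<and> feq \<tau> x r"
        using feq_trans[of \<rho> \<tau> r x] feq_sym' le_in by blast
    qed
  qed
qed

lemma fmem_member: "(\<sigma>, c) \<in> members x \<Longrightarrow> q \<preceq> c \<Longrightarrow> fmem \<sigma> x q"
  unfolding fmem_iff by (rule denseI) (auto dest: le_in intro: le_trans)

lemma feq_extensionality:
  assumes "is_name x" "is_name y" "p \<in> P"
    and "\<And>u q. is_name u \<Longrightarrow> q \<in> P \<Longrightarrow> q \<preceq> p \<Longrightarrow> fmem u x q \<longleftrightarrow> fmem u y q"
  shows "feq x y p"
proof -
  have "covered \<sigma> c y p"
    if n: "is_name x" and s: "(\<sigma>, c) \<in> members x"
      and e: "\<And>u q. is_name u \<Longrightarrow> q \<in> P \<Longrightarrow> q \<preceq> p \<Longrightarrow> fmem u x q \<Longrightarrow> fmem u y q" for x y \<sigma> c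
    unfolding covered_def dense_below_iff
  proof (intro allI impI)
    fix q assume q: "q \<preceq> p"
    show "\<exists>r. r \<preceq> q \<and> (r \<preceq> c \<longrightarrow> (\<exists>\<tau> d. (\<tau>, d) \<in> members y \<and> r \<preceq> d \<and> feq \<sigma> \<tau> r))"
    proof (cases "q \<preceq> c")
      case True
      then have "fmem \<sigma> y q"
        using e is_name_member[OF n s] q fmem_member[OF s] le_in by blast
      then show ?thesis
        unfolding fmem_iff dense_below_iff feq_sym[of \<sigma>] using q le_in le_refl by meson
    next
      case False
      then show ?thesis
        using q le_in le_refl by blast
    qed
  qed
  then show ?thesis
    unfolding feq_covered[of x y] using assms by blast
qed

end

section \<open>Check names and ordered pairs\<close>

context poset_forcing
begin

abbreviation ck :: "'v \<Rightarrow> 'v name" where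
  "ck \<equiv> check p0"

lemma members_check: "members (ck x) = {(ck y, p0) | y. y \<in> elts x}"
  by (subst check.simps) (auto simp: ran_def)

lemma is_name_check [simp, intro]: "is_name (ck x)"
proof (induction x rule: wf_induct_rule[OF foundation])
  case (1 x)
  show ?case
    by (subst check.simps, rule is_name.intros)
      (use 1 in \<open>auto simp: ran_def dom_def split: if_splits\<close>)
qed

lemma fmem_check_iff: "fmem u (ck x) p \<longleftrightarrow> dense_below (\<lambda>q. \<exists>a\<in>elts x. feq (ck a) u q) p"
proof -
  have "(\<exists>\<tau> d. (\<tau>, d) \<in> members (ck x) \<and> q \<preceq> d \<and> feq \<tau> u q) \<longleftrightarrow> (\<exists>a\<in>elts x. feq (ck a) u q)"
    if "q \<in> P" for q
    using that by (auto simp: members_check)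
  then show ?thesis
    unfolding fmem_iff dense_below_iff using le_in by meson
qed

lemma fmem_check [simp]: "a \<in> elts x \<Longrightarrow> p \<in> P \<Longrightarrow> fmem (ck a) (ck x) p"
  unfolding fmem_check_iff by (rule denseI) auto

lemma fmem_checkI: "a \<in> elts x \<Longrightarrow> feq (ck a) u p \<Longrightarrow> p \<in> P \<Longrightarrow> fmem u (ck x) p"
  by (rule fmem_cong_left[OF fmem_check])

lemma fmem_checkE:
  assumes "fmem u (ck x) p" "p \<in> P" "regular \<psi>"
    and "\<And>r a. r \<in> P \<Longrightarrow> r \<preceq> p \<Longrightarrow> a \<in> elts x \<Longrightarrow> feq (ck a) u r \<Longrightarrow> \<psi> r"
  shows "\<psi> p"
  using assms(1) unfolding fmem_check_iff by (rule denseE) (use assms in blast)+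

text \<open>Equality of ground model sets is absolute: by induction, a member of one set that is
  identified below \<open>p\<close> with a member of the other is that very member.\<close>

lemma feq_check_iff: "p \<in> P \<Longrightarrow> feq (ck a) (ck b) p \<longleftrightarrow> a = b"
proof
  show "feq (ck a) (ck b) p \<Longrightarrow> p \<in> P \<Longrightarrow> a = b"
  proof (induction a arbitrary: b p rule: wf_induct_rule[OF foundation])
    case (1 a)
    have IH: "c = d" if "c \<in> elts a" "feq (ck c) (ck d) q" "q \<in> P" for c d q
      using 1(1) that by blast
    have "c \<in> elts b" if c: "c \<in> elts a" for c
    proof -
      have "fmem (ck c) (ck b) p"
        using fmem_cong_right[OF fmem_check[OF c]] 1 by blast
      then show ?thesis
        by (rule fmem_checkE[where \<psi> = "\<lambda>_. c \<in> elts b"])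
          (use 1 in \<open>auto, metis IH[OF c] feq_sym'\<close>)
    qed
    moreover have "d \<in> elts a" if d: "d \<in> elts b" for d
    proof -
      have "fmem (ck d) (ck a) p"
        using fmem_cong_right[OF fmem_check[OF d]] 1 feq_sym' by blast
      then show ?thesis
        by (rule fmem_checkE[where \<psi> = "\<lambda>_. d \<in> elts a"]) (use IH 1 in auto)
    qed
    ultimately show ?case
      by (intro extensionality) blast
  qed
qed auto

lemma feq_check_unique: "feq (ck a) x p \<Longrightarrow> feq (ck b) x p \<Longrightarrow> p \<in> P \<Longrightarrow> a = b"
  by (metis feq_check_iff feq_sym' feq_trans)

text \<open>A name is a family indexed by the universe, so two distinct sets are needed as indices;
  the empty set and its singleton serve. The name is a witness in
  \<open>is_pair_check_inject\<close>.\<close>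

definition upair_name :: "'v name \<Rightarrow> 'v name \<Rightarrow> 'v name" where
  "upair_name x y = Name (\<lambda>i. if i = vset {} then Some (x, p0)
     else if i = vset {vset {}} then Some (y, p0) else None)"

lemma members_upair_name: "members (upair_name x y) = {(x, p0), (y, p0)}"
  using vset_singleton_neq_empty
  by (auto simp: upair_name_def ran_def split: if_splits) metis+

lemma is_name_upair_name: "is_name x \<Longrightarrow> is_name y \<Longrightarrow> is_name (upair_name x y)"
  unfolding upair_name_def
proof (rule is_name.intros)
  show "small (dom (\<lambda>i. if i = vset {} then Some (x, p0)
     else if i = vset {vset {}} then Some (y, p0) else None))"
    by (rule small_subset[OF small_doubleton[of "vset {}" "vset {vset {}}"]]) (auto split: if_splits)
qed (auto simp: ran_def split: if_splits)

lemma regular_is_pair [simp, intro]: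
  "regular (is_upair x y z)" "regular (is_pair x y z)" "regular (is_op x y z w)"
  by (simp_all add: is_upair_def is_pair_def is_op_def)

lemma is_upair_iff:
  "p \<in> P \<Longrightarrow> is_upair z x y p \<longleftrightarrow> (\<forall>u. is_name u \<longrightarrow> (\<forall>q. q \<preceq> p \<longrightarrow>
     fmem u z q \<longleftrightarrow> dense_below (\<lambda>r. feq u x r \<or> feq u y r) q))"
  by (simp add: is_upair_def fall_iff fiff_iff f_or_iff)

lemma is_pair_iff:
  "p \<in> P \<Longrightarrow> is_pair z x y p \<longleftrightarrow> (\<forall>u. is_name u \<longrightarrow> (\<forall>q. q \<preceq> p \<longrightarrow>
     fmem u z q \<longleftrightarrow> dense_below (\<lambda>r. is_upair u x x r \<or> is_upair u x y r) q))"
  by (simp add: is_pair_def fall_iff fiff_iff f_or_iff)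

lemma dense_below_cong: "(\<And>r. r \<preceq> p \<Longrightarrow> D r \<longleftrightarrow> D' r) \<Longrightarrow> dense_below D p \<longleftrightarrow> dense_below D' p"
  by (auto elim: dense_below_mono)

lemma feq_cong_right: "feq x x' p \<Longrightarrow> p \<in> P \<Longrightarrow> feq u x p \<longleftrightarrow> feq u x' p"
  using feq_trans feq_sym' by blast

lemma feq_le: "feq x y p \<Longrightarrow> q \<preceq> p \<Longrightarrow> feq x y q"
  by (rule regular_le[OF regular_feq])

lemma is_upair_cong:
  assumes "feq x x' p" "feq y y' p" "p \<in> P"
  shows "is_upair z x y p \<longleftrightarrow> is_upair z x' y' p"
proof -
  have "dense_below (\<lambda>r. feq u x r \<or> feq u y r) q \<longleftrightarrow> dense_below (\<lambda>r. feq u x' r \<or> feq u y' r) q"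
    if "q \<preceq> p" for u q
    by (rule dense_below_cong)
      (use feq_cong_right feq_le[OF assms(1)] feq_le[OF assms(2)] that le_trans le_in in metis)
  then show ?thesis
    by (simp add: is_upair_iff assms)
qed

lemma is_pair_cong_right:
  assumes "feq x x' p" "feq y y' p" "p \<in> P"
  shows "is_pair z x y p \<longleftrightarrow> is_pair z x' y' p"
proof -
  have "dense_below (\<lambda>r. is_upair u x x r \<or> is_upair u x y r) q \<longleftrightarrow>
      dense_below (\<lambda>r. is_upair u x' x' r \<or> is_upair u x' y' r) q"
    if "q \<preceq> p" for u q
    by (rule dense_below_cong)
      (use is_upair_cong feq_le[OF assms(1)] feq_le[OF assms(2)] that le_trans le_in in metis)
  then show ?thesis
    by (simp add: is_pair_iff assms)
qed

lemma is_pair_cong_left: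
  assumes "feq z z' p" "p \<in> P"
  shows "is_pair z x y p \<longleftrightarrow> is_pair z' x y p"
proof -
  have "fmem u z q \<longleftrightarrow> fmem u z' q" if "q \<preceq> p" for u q
    using fmem_cong_right feq_le[OF assms(1) that] feq_sym' le_in that by blast
  then show ?thesis
    by (simp add: is_pair_iff assms)
qed

lemma is_upair_unique:
  "is_upair z x y p \<Longrightarrow> is_upair z' x y p \<Longrightarrow> is_name z \<Longrightarrow> is_name z' \<Longrightarrow> p \<in> P \<Longrightarrow> feq z z' p"
  by (rule feq_extensionality) (simp_all add: is_upair_iff)

lemma is_upair_left: "is_upair z x y p \<Longrightarrow> is_name x \<Longrightarrow> p \<in> P \<Longrightarrow> fmem x z p"
  using denseI le_in le_refl feq_refl by (simp add: is_upair_iff)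

lemma is_upair_right: "is_upair z x y p \<Longrightarrow> is_name y \<Longrightarrow> p \<in> P \<Longrightarrow> fmem y z p"
  using denseI le_in le_refl feq_refl by (simp add: is_upair_iff)

lemma is_upair_upair_name:
  assumes "p \<in> P"
  shows "is_upair (upair_name x y) x y p"
proof -
  have "(\<exists>\<tau> d. (\<tau>, d) \<in> members (upair_name x y) \<and> q \<preceq> d \<and> feq \<tau> u q) \<longleftrightarrow> feq u x q \<or> feq u y q"
    if "q \<in> P" for u q
    using that le_top[of q] by (auto simp: members_upair_name feq_sym[of u])
  then show ?thesis
    unfolding is_upair_iff[OF assms] fmem_iff
    by (intro allI impI dense_below_cong) (simp add: le_in)
qed

lemma is_upair_check: "p \<in> P \<Longrightarrow> is_upair (ck (vset {a, b})) (ck a) (ck b) p"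
  by (auto simp: is_upair_iff fmem_check_iff elts_upair feq_sym intro!: dense_below_cong)

lemma is_upair_check_iff:
  assumes "p \<in> P" "is_name u"
  shows "is_upair u (ck a) (ck b) p \<longleftrightarrow> feq (ck (vset {a, b})) u p"
proof
  show "feq (ck (vset {a, b})) u p \<Longrightarrow> is_upair u (ck a) (ck b) p"
    unfolding is_upair_iff[OF assms(1)]
    using is_upair_check[OF assms(1), of a b, unfolded is_upair_iff[OF assms(1)]]
    by (meson assms(2) feq_le feq_sym' fmem_cong_right le_in)
qed (use assms is_upair_check is_upair_unique in blast)

lemma is_pair_check: "p \<in> P \<Longrightarrow> is_pair (ck (vpair a b)) (ck a) (ck b) p"
  by (auto simp: is_pair_iff fmem_check_iff elts_vpair is_upair_check_iff[of _ _ a a, simplified]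
      is_upair_check_iff dest: le_in intro!: dense_below_cong)

text \<open>A forced decoding of Kuratowski pairs: \<open>x\<close> is read off the singleton of
  \<open>a\<close>, and \<open>y\<close> off the unordered pair of \<open>x\<close> and
  \<open>y\<close>, where the case that \<open>y\<close> equals \<open>a\<close> is treated
  separately.\<close>

lemma is_pair_check_inject:
  assumes pr: "is_pair (ck (vpair a b)) x y p" and p: "p \<in> P" and x: "is_name x" and y: "is_name y"
  shows "feq (ck a) x p \<and> feq (ck b) y p"
proof -
  have D: "fmem u (ck (vpair a b)) q \<longleftrightarrow> dense_below (\<lambda>r. is_upair u x x r \<or> is_upair u x y r) q"
    if "is_name u" "q \<preceq> p" for u q
    using pr that by (simp add: is_pair_iff[OF p])
  have single: "feq (ck c) v r" if "fmem v (ck (vset {c})) r" "r \<in> P" for c v r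
    using that(1) by (rule fmem_checkE) (use that in \<open>auto simp: elts_vset\<close>)
  have X: "feq (ck a) x p"
  proof -
    have "dense_below (\<lambda>r. is_upair (ck (vset {a})) x x r \<or> is_upair (ck (vset {a})) x y r) p"
      by (subst D[symmetric]) (simp_all add: elts_vpair p)
    then show ?thesis
      by (rule denseE) (use single is_upair_left x p in auto)
  qed
  \<comment> \<open>If \<open>y\<close> is \<open>a\<close> as well, both possible values of
    \<open>{a, b}\<close> are the singleton of \<open>a\<close>, whence
    \<open>a = b\<close>.\<close>
  have Y: "feq (ck b) y q" if q: "q \<preceq> p" and ya: "feq (ck a) y q" for q
  proof -
    have qP: "q \<in> P"
      using q le_in by blast
    have "dense_below (\<lambda>r. is_upair (ck (vset {a, b})) x x r \<or> is_upair (ck (vset {a, b})) x y r) q"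
      by (subst D[symmetric]) (simp_all add: elts_vpair qP q)
    then show ?thesis
    proof (rule denseE[OF _ qP])
      fix r assume r: "r \<in> P" "r \<preceq> q"
        "is_upair (ck (vset {a, b})) x x r \<or> is_upair (ck (vset {a, b})) x y r"
      have xr: "feq x (ck a) r" and yr: "feq y (ck a) r"
        using X ya r q feq_le le_trans feq_sym' by blast+
      then have "is_upair (ck (vset {a, b})) (ck a) (ck a) r"
        using r is_upair_cong by meson
      then have "vset {a, a} = vset {a, b}"
        using r by (simp only: is_upair_check_iff[OF r(1) is_name_check] feq_check_iff)
      then have "elts (vset {a, a}) = elts (vset {a, b})"
        by simp
      then have "a = b"
        unfolding elts_upair by (simp add: doubleton_eq_iff)
      then show "feq (ck b) y r"
        using yr feq_sym' by blast
    qed simp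
  qed
  \<comment> \<open>The name of the pair of \<open>x\<close> and \<open>y\<close> belongs to
    \<open>vpair a b\<close>, so it is \<open>{a}\<close> or \<open>{a, b}\<close>, and
    \<open>y\<close> lies in one of them.\<close>
  have "dense_below (\<lambda>r. is_upair (upair_name x y) x x r \<or> is_upair (upair_name x y) x y r) p"
    by (rule denseI) (simp_all add: is_upair_upair_name p)
  then have "fmem (upair_name x y) (ck (vpair a b)) p"
    using D[of "upair_name x y" p] is_name_upair_name x y p by simp
  then have "feq (ck b) y p"
  proof (rule fmem_checkE[OF _ p])
    fix r e assume r: "r \<in> P" "r \<preceq> p" and e: "e \<in> elts (vpair a b)" "feq (ck e) (upair_name x y) r"
    have ye: "fmem y (ck e) r"
      using is_upair_right[OF is_upair_upair_name[OF r(1), of x y]] y r e feq_sym' fmem_cong_right by blast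
    consider "e = vset {a}" | "e = vset {a, b}"
      using e by (auto simp: elts_vpair)
    then show "feq (ck b) y r"
    proof cases
      case 1
      then show ?thesis
        using ye single Y r by blast
    next
      case 2
      from ye show ?thesis
      proof (rule fmem_checkE[OF _ r(1)])
        fix s c assume s: "s \<in> P" "s \<preceq> r" and c: "c \<in> elts e" "feq (ck c) y s"
        then consider "c = a" | "c = b"
          using 2 by (auto simp: elts_upair)
        then show "feq (ck b) y s"
          using Y[of s] c le_trans[OF s(2) r(2)] by cases auto
      qed simp
    qed
  qed simp
  with X show ?thesis
    by blast
qed

end

section \<open>Forcing over a ground model group\<close>

locale group_forcing = poset_forcing P leq p0 + comm_group G
  for P :: "'v::zfc_universe set" and leq p0 and G :: "'v monoid" (structure) +
  assumes small_carrier: "small (carrier G)"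
begin

abbreviation C :: "'v name" where "C \<equiv> ck (carrier_code G)"
abbreviation m :: "'v name" where "m \<equiv> ck (mult_code G)"

lemma elts_carrier_code: "elts (carrier_code G) = carrier G"
  by (simp add: carrier_code_def elts_vset small_carrier)

lemma elts_mult_code:
  "elts (mult_code G) = {vpair x (vpair y (x \<otimes> y)) | x y. x \<in> carrier G \<and> y \<in> carrier G}"
proof -
  have "{vpair x (vpair y (x \<otimes> y)) | x y. x \<in> carrier G \<and> y \<in> carrier G} =
      (\<Union>x\<in>carrier G. (\<lambda>y. vpair x (vpair y (x \<otimes> y))) ` carrier G)"
    by blast
  moreover have "small \<dots>"
    by (rule small_UN) (auto simp: small_carrier)
  ultimately show ?thesis
    unfolding mult_code_def by (simp add: elts_vset)
qed

lemma regular_is_zero [simp, intro]: "regular (is_zero C' m' e)"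
  by (simp add: is_zero_def)

lemma regular_has_inverses [simp, intro]: "regular (has_inverses C' m' H)"
  by (simp add: has_inverses_def)

lemma regular_is_subset [simp, intro]: "regular (is_subset X Y)"
  by (simp add: is_subset_def)

lemma regular_is_subgroup [simp, intro]: "regular (is_subgroup C' m' H)"
  by (simp add: is_subgroup_def)

lemma regular_in_span [simp, intro]: "regular (in_span C' m' X x)"
  by (simp add: in_span_def)

lemma regular_is_positive_multiple [simp, intro]: "regular (is_positive_multiple m' b x)"
  by (simp add: is_positive_multiple_def)

lemma regular_has_infinite_order [simp, intro]: "regular (has_infinite_order C' m' b)"
  by (simp add: has_infinite_order_def)

lemma regular_is_basis [simp, intro]: "regular (is_basis C' m' B)"
  by (simp add: is_basis_def)

lemma is_opI:
  assumes "a \<in> carrier G" "b \<in> carrier G" "feq (ck a) x p" "feq (ck b) y p" "feq (ck (a \<otimes> b)) z p"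
    and p: "p \<in> P"
  shows "is_op m x y z p"
proof -
  let ?t = "ck (vpair a (vpair b (a \<otimes> b)))" and ?s = "ck (vpair b (a \<otimes> b))"
  have "is_pair ?s y z p"
    using is_pair_check[OF p, of b "a \<otimes> b"] is_pair_cong_right[OF assms(4,5) p] by simp
  moreover have "is_pair ?t x ?s p"
    using is_pair_check[OF p, of a "vpair b (a \<otimes> b)"] is_pair_cong_right[OF assms(3) feq_refl[OF p] p]
    by simp
  ultimately have "(\<^bold>\<exists>s. is_pair s y z \<^bold>\<and> is_pair ?t x s) p"
    by (intro fexI[OF p is_name_check[of "vpair b (a \<otimes> b)"]]) (auto intro: fandI)
  moreover have "fmem ?t m p"
    using assms by (auto simp: elts_mult_code)
  ultimately show ?thesis
    unfolding is_op_def by (intro fexI[OF p is_name_check[of "vpair a (vpair b (a \<otimes> b))"]]) (auto intro: fandI)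
qed

text \<open>The graph is a check name, so a dense set of conditions picks an entry of the ground
  model operation; decoding its pairs decides all three arguments. This reduces the forced group
  laws to the laws of \<open>G\<close>.\<close>

lemma is_opE:
  assumes op: "is_op m x y z p" and p: "p \<in> P" and n: "is_name x" "is_name y" "is_name z"
    and \<psi>: "regular \<psi>"
    and step: "\<And>r a b. r \<in> P \<Longrightarrow> r \<preceq> p \<Longrightarrow> a \<in> carrier G \<Longrightarrow> b \<in> carrier G \<Longrightarrow>
      feq (ck a) x r \<Longrightarrow> feq (ck b) y r \<Longrightarrow> feq (ck (a \<otimes> b)) z r \<Longrightarrow> \<psi> r"
  shows "\<psi> p"
  using op unfolding is_op_def
proof (rule fexE[OF _ p \<psi>])
  fix q t assume q: "q \<in> P" "q \<preceq> p" and t: "is_name t"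
    "(t \<^bold>\<in> m \<^bold>\<and> (\<^bold>\<exists>s. is_pair s y z \<^bold>\<and> is_pair t x s)) q"
  then have "fmem t m q" and s: "(\<^bold>\<exists>s. is_pair s y z \<^bold>\<and> is_pair t x s) q"
    by (auto elim: fandE)
  from this(1) show "\<psi> q"
  proof (rule fmem_checkE[OF _ q(1) \<psi>])
    fix r e assume r: "r \<in> P" "r \<preceq> q" and e: "e \<in> elts (mult_code G)" "feq (ck e) t r"
    then obtain a b where ab: "a \<in> carrier G" "b \<in> carrier G" "e = vpair a (vpair b (a \<otimes> b))"
      by (auto simp: elts_mult_code)
    have "(\<^bold>\<exists>s. is_pair s y z \<^bold>\<and> is_pair t x s) r"
      using s r regular_le regular_fex by blast
    then show "\<psi> r"
    proof (rule fexE[OF _ r(1) \<psi>])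
      fix u s assume u: "u \<in> P" "u \<preceq> r" and s: "is_name s" "(is_pair s y z \<^bold>\<and> is_pair t x s) u"
      have "feq (ck e) t u"
        using e u feq_le by blast
      then have "is_pair (ck e) x s u"
        using s u by (auto elim: fandE simp: is_pair_cong_left)
      then have 1: "feq (ck a) x u" "feq (ck (vpair b (a \<otimes> b))) s u"
        using is_pair_check_inject u n s ab by blast+
      then have "is_pair (ck (vpair b (a \<otimes> b))) y z u"
        using s u by (auto elim: fandE simp: is_pair_cong_left)
      then have "feq (ck b) y u" "feq (ck (a \<otimes> b)) z u"
        using is_pair_check_inject u n by blast+
      then show "\<psi> u"
        using step[of u a b] 1 ab u r q le_trans by blast
    qed
  qed
qed

lemma fmem_carrierE:
  assumes "fmem x C p" "p \<in> P" "regular \<psi>"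
    and "\<And>r a. r \<in> P \<Longrightarrow> r \<preceq> p \<Longrightarrow> a \<in> carrier G \<Longrightarrow> feq (ck a) x r \<Longrightarrow> \<psi> r"
  shows "\<psi> p"
  using assms(1,2,3) by (rule fmem_checkE) (use assms in \<open>auto simp: elts_carrier_code\<close>)

lemma fmem_carrierI: "a \<in> carrier G \<Longrightarrow> feq (ck a) x p \<Longrightarrow> p \<in> P \<Longrightarrow> fmem x C p"
  by (rule fmem_checkI) (auto simp: elts_carrier_code)

lemma is_op_check:
  assumes op: "is_op m x y z p" and "p \<in> P" "is_name x" "is_name y" "is_name z"
    and "feq (ck a) x p" "feq (ck b) y p"
  shows "a \<in> carrier G \<and> b \<in> carrier G \<and> feq (ck (a \<otimes> b)) z p"
  using assms(1-5)
proof (rule is_opE)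
  show "regular (\<lambda>p. a \<in> carrier G \<and> b \<in> carrier G \<and> feq (ck (a \<otimes> b)) z p)"
    by (intro regular_conj regular_const regular_feq)
next
  fix r a' b' assume r: "r \<in> P" "r \<preceq> p"
    and *: "a' \<in> carrier G" "b' \<in> carrier G" "feq (ck a') x r" "feq (ck b') y r" "feq (ck (a' \<otimes> b')) z r"
  have "a' = a" "b' = b"
    using * r assms(6,7) feq_le feq_check_unique by blast+
  then show "a \<in> carrier G \<and> b \<in> carrier G \<and> feq (ck (a \<otimes> b)) z r"
    using * by simp
qed

lemma is_zero_iff:
  assumes p: "p \<in> P" and e: "is_name e"
  shows "is_zero C m e p \<longleftrightarrow> feq (ck \<one>) e p"
proof
  assume z: "feq (ck \<one>) e p"
  have *: "is_op m e x x q \<and> is_op m x e x q"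
    if q: "q \<in> P" "q \<preceq> p" and x: "fmem x C q" for x q
    using x
  proof (rule fmem_carrierE)
    show "regular (\<lambda>q. is_op m e x x q \<and> is_op m x e x q)"
      by (intro regular_conj regular_is_pair)
  next
    fix r a assume r: "r \<in> P" "r \<preceq> q" and a: "a \<in> carrier G" "feq (ck a) x r"
    have "feq (ck \<one>) e r"
      using z q r feq_le by blast
    then show "is_op m e x x r \<and> is_op m x e x r"
      using a r by (auto intro: is_opI[of \<one> a] is_opI[of a \<one>])
  qed (rule q)
  show "is_zero C m e p"
    unfolding is_zero_def
    by (intro fandI fallI fimpI fmem_carrierI[of \<one>]) (use p z * in auto)
next
  assume "is_zero C m e p"
  then have "fmem e C p" and "(\<^bold>\<forall>x. x \<^bold>\<in> C \<^bold>\<longrightarrow> is_op m e x x \<^bold>\<and> is_op m x e x) p"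
    by (auto simp: is_zero_def elim: fandE)
  \<comment> \<open>Neutrality is tested on \<open>ck \<one>\<close>: if \<open>e\<close> is decided
    to be \<open>a\<close>, then \<open>a \<otimes> \<one> = \<one>\<close>.\<close>
  moreover from this(2) have "(ck \<one> \<^bold>\<in> C \<^bold>\<longrightarrow> is_op m e (ck \<one>) (ck \<one>) \<^bold>\<and> is_op m (ck \<one>) e (ck \<one>)) p"
    by (rule fallD) (auto simp: p)
  then have "(is_op m e (ck \<one>) (ck \<one>) \<^bold>\<and> is_op m (ck \<one>) e (ck \<one>)) p"
    by (rule fimpD) (auto simp: p elts_carrier_code)
  ultimately have op: "is_op m e (ck \<one>) (ck \<one>) p"
    by (auto elim: fandE)
  from \<open>fmem e C p\<close> show "feq (ck \<one>) e p"
  proof (rule fmem_carrierE[OF _ p regular_feq])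
    fix r a assume r: "r \<in> P" "r \<preceq> p" and a: "a \<in> carrier G" "feq (ck a) e r"
    have "is_op m e (ck \<one>) (ck \<one>) r"
      using op r regular_le regular_is_pair by blast
    then have "feq (ck (a \<otimes> \<one>)) (ck \<one>) r"
      using is_op_check[of e "ck \<one>" "ck \<one>" r a \<one>] r a e by auto
    then show "feq (ck \<one>) e r"
      using a r by (simp add: feq_check_iff)
  qed
qed

section \<open>Subgroups and spans in the extension, studied through their ground model
  traces\<close>

definition trace :: "'v name \<Rightarrow> 'v \<Rightarrow> 'v set" where
  "trace H q = {a \<in> carrier G. fmem (ck a) H q}"

lemma is_zero_one: "p \<in> P \<Longrightarrow> is_zero C m (ck \<one>) p"
  by (simp add: is_zero_iff)

lemma is_op_checkI: "a \<in> carrier G \<Longrightarrow> b \<in> carrier G \<Longrightarrow> p \<in> P \<Longrightarrow> is_op m (ck a) (ck b) (ck (a \<otimes> b)) p"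
  by (rule is_opI[of a b]) auto

lemma is_subsetD:
  assumes "is_subset X Y p" "p \<in> P" "is_name x" "q \<preceq> p" "fmem x X q"
  shows "fmem x Y q"
proof -
  have q: "q \<in> P"
    using assms le_in by blast
  have "(\<^bold>\<forall>x. x \<^bold>\<in> X \<^bold>\<longrightarrow> x \<^bold>\<in> Y) q"
    using regular_le[OF regular_is_subset assms(1,4)] by (simp add: is_subset_def)
  then have "(x \<^bold>\<in> X \<^bold>\<longrightarrow> x \<^bold>\<in> Y) q"
    by (rule fallD) (use assms q in auto)
  then show ?thesis
    by (rule fimpD) (use assms q in auto)
qed

text \<open>Instantiating the closure conditions at check names makes the decided part of
  \<open>H\<close> an honest subgroup. The name of an inverse must first be decided; uniqueness of
  inverses then identifies it.\<close>

lemma is_subgroupD: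
  assumes H: "is_subgroup C m H p" and p: "p \<in> P" and n: "is_name H"
  shows "subgroup (trace H p) G" "is_subset H C p"
proof -
  have ss: "is_subset H C p" and ex: "(\<^bold>\<exists>e. is_zero C m e \<^bold>\<and> e \<^bold>\<in> H) p"
    and mult: "(\<^bold>\<forall>x. \<^bold>\<forall>y. \<^bold>\<forall>z. x \<^bold>\<in> H \<^bold>\<and> y \<^bold>\<in> H \<^bold>\<and> is_op m x y z \<^bold>\<longrightarrow> z \<^bold>\<in> H) p"
    and inv: "has_inverses C m H p"
    using H by (auto simp: is_subgroup_def elim!: fandE)
  show "is_subset H C p"
    by (rule ss)
  have one: "fmem (ck \<one>) H p"
    using ex
  proof (rule fexE[OF _ p regular_fmem])
    fix r e assume "r \<in> P" "r \<preceq> p" "is_name e" "(is_zero C m e \<^bold>\<and> e \<^bold>\<in> H) r"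
    then show "fmem (ck \<one>) H r"
      by (auto elim!: fandE simp: is_zero_iff intro: fmem_cong_left[OF _ feq_sym'])
  qed
  show "subgroup (trace H p) G"
  proof
    show "trace H p \<subseteq> carrier G" "\<one> \<in> trace H p"
      using one by (auto simp: trace_def)
  next
    fix a b assume ab: "a \<in> trace H p" "b \<in> trace H p"
    have "(\<^bold>\<forall>y. \<^bold>\<forall>z. ck a \<^bold>\<in> H \<^bold>\<and> y \<^bold>\<in> H \<^bold>\<and> is_op m (ck a) y z \<^bold>\<longrightarrow> z \<^bold>\<in> H) p"
      by (rule fallD[OF mult]) (auto simp: p)
    then have "(\<^bold>\<forall>z. ck a \<^bold>\<in> H \<^bold>\<and> ck b \<^bold>\<in> H \<^bold>\<and> is_op m (ck a) (ck b) z \<^bold>\<longrightarrow> z \<^bold>\<in> H) p"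
      by (rule fallD) (auto simp: p)
    then have "(ck a \<^bold>\<in> H \<^bold>\<and> ck b \<^bold>\<in> H \<^bold>\<and> is_op m (ck a) (ck b) (ck (a \<otimes> b)) \<^bold>\<longrightarrow> ck (a \<otimes> b) \<^bold>\<in> H) p"
      by (rule fallD) (auto simp: p)
    then have "fmem (ck (a \<otimes> b)) H p"
      by (rule fimpD) (use ab in \<open>auto simp: p trace_def intro!: fandI is_op_checkI\<close>)
    then show "a \<otimes> b \<in> trace H p"
      using ab by (simp add: trace_def)
  next
    fix a assume a: "a \<in> trace H p"
    have "(ck a \<^bold>\<in> H \<^bold>\<longrightarrow> (\<^bold>\<exists>y. y \<^bold>\<in> H \<^bold>\<and> (\<^bold>\<exists>e. is_zero C m e \<^bold>\<and> is_op m (ck a) y e))) p"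
      using inv unfolding has_inverses_def by (rule fallD) (auto simp: p)
    then have "(\<^bold>\<exists>y. y \<^bold>\<in> H \<^bold>\<and> (\<^bold>\<exists>e. is_zero C m e \<^bold>\<and> is_op m (ck a) y e)) p"
      by (rule fimpD) (use a in \<open>auto simp: p trace_def\<close>)
    then have "fmem (ck (inv a)) H p"
    proof (rule fexE[OF _ p regular_fmem], elim fandE)
      fix r y assume r: "r \<in> P" "r \<preceq> p" and y: "is_name y" "fmem y H r"
        and "(\<^bold>\<exists>e. is_zero C m e \<^bold>\<and> is_op m (ck a) y e) r"
      from this(5) show "fmem (ck (inv a)) H r"
      proof (rule fexE[OF _ r(1) regular_fmem], elim fandE)
        fix s e assume s: "s \<in> P" "s \<preceq> r" and e: "is_name e" "is_zero C m e s" "is_op m (ck a) y e s"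
        from e(3) show "fmem (ck (inv a)) H s"
        proof (rule is_opE[OF _ s(1) is_name_check y(1) e(1) regular_fmem])
          fix t a' b assume t: "t \<in> P" "t \<preceq> s"
            and ab: "a' \<in> carrier G" "b \<in> carrier G" "feq (ck a') (ck a) t" "feq (ck b) y t" "feq (ck (a' \<otimes> b)) e t"
          have "feq (ck \<one>) e t"
            using e is_zero_iff[OF s(1)] t feq_le by blast
          then have "a \<otimes> b = \<one>"
            using ab t feq_check_unique feq_check_iff by blast
          moreover have "a \<in> carrier G"
            using a by (simp add: trace_def)
          ultimately have "b = inv a"
            using ab inv_equality m_comm by metis
          moreover have "fmem y H t"
            using y t s r regular_le[OF regular_fmem] by blast
          ultimately show "fmem (ck (inv a)) H t"
            using fmem_cong_left feq_sym' ab t by blast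
        qed
      qed
    qed
    then show "inv a \<in> trace H p"
      using a by (simp add: trace_def)
  qed
qed

lemma trace_le: "q \<preceq> p \<Longrightarrow> trace H p \<subseteq> trace H q"
  unfolding trace_def using regular_le[OF regular_fmem] by blast

lemma fmem_subsetE:
  assumes "fmem x H p" "is_subset H C p" "p \<in> P" "is_name x" "regular \<psi>"
    and "\<And>r a. r \<in> P \<Longrightarrow> r \<preceq> p \<Longrightarrow> a \<in> trace H r \<Longrightarrow> feq (ck a) x r \<Longrightarrow> \<psi> r"
  shows "\<psi> p"
proof -
  have "fmem x C p"
    using is_subsetD assms by blast
  then show ?thesis
  proof (rule fmem_carrierE[OF _ assms(3,5)])
    fix r a assume r: "r \<in> P" "r \<preceq> p" "a \<in> carrier G" "feq (ck a) x r"
    then have "fmem (ck a) H r"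
      using fmem_cong_left[of x H r "ck a"] regular_le[OF regular_fmem assms(1)] feq_sym' by blast
    then show "\<psi> r"
      using r assms(6) by (auto simp: trace_def)
  qed
qed

text \<open>Members of \<open>H\<close> are decided on a dense set, where the closure conditions
  become those of the traces. Traces at all stronger conditions are assumed because deciding a
  member changes the condition.\<close>

lemma is_subgroupI:
  assumes p: "p \<in> P" and ss: "is_subset H C p"
    and sub: "\<And>q. q \<in> P \<Longrightarrow> q \<preceq> p \<Longrightarrow> subgroup (trace H q) G"
  shows "is_subgroup C m H p"
proof -
  have ss': "is_subset H C q" if "q \<preceq> p" for q
    using regular_le[OF regular_is_subset ss that] .
  have mult: "fmem z H q" if q: "q \<in> P" "q \<preceq> p" and n: "is_name x" "is_name y" "is_name z"
    and "fmem x H q" "fmem y H q" "is_op m x y z q" for x y z q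
    using that(6) ss'[OF q(2)] q(1) n(1) regular_fmem
  proof (rule fmem_subsetE)
    fix r a assume r: "r \<in> P" "r \<preceq> q" and a: "a \<in> trace H r" "feq (ck a) x r"
    have rp: "r \<preceq> p"
      using r q le_trans by blast
    have "fmem y H r"
      using that(7) r regular_le[OF regular_fmem] by blast
    then show "fmem z H r"
      using ss'[OF rp] r(1) n(2) regular_fmem
    proof (rule fmem_subsetE)
      fix s b assume s: "s \<in> P" "s \<preceq> r" and b: "b \<in> trace H s" "feq (ck b) y s"
      have "is_op m x y z s"
        by (rule regular_le[OF regular_is_pair(3) that(8) le_trans[OF s(2) r(2)]])
      moreover have "feq (ck a) x s"
        by (rule feq_le[OF a(2) s(2)])
      ultimately have "feq (ck (a \<otimes> b)) z s"
        using is_op_check[OF _ s(1) n, of a b] b(2) by simp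
      moreover have "a \<in> trace H s"
        using a(1) trace_le[OF s(2)] by blast
      then have "a \<otimes> b \<in> trace H s"
        using b(1) subgroup.m_closed[OF sub[OF s(1) le_trans[OF s(2) rp]]] by simp
      ultimately have "feq (ck (a \<otimes> b)) z s" "a \<otimes> b \<in> trace H s"
        by simp_all
      then show "fmem z H s"
        using s fmem_cong_left unfolding trace_def by blast
    qed
  qed
  have inv: "(\<^bold>\<exists>y. y \<^bold>\<in> H \<^bold>\<and> (\<^bold>\<exists>e. is_zero C m e \<^bold>\<and> is_op m x y e)) q"
    if q: "q \<in> P" "q \<preceq> p" and n: "is_name x" and x: "fmem x H q" for x q
    using x ss'[OF q(2)] q(1) n(1) regular_fex
  proof (rule fmem_subsetE)
    fix r a assume r: "r \<in> P" "r \<preceq> q" and a: "a \<in> trace H r" "feq (ck a) x r"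
    have rp: "r \<preceq> p"
      using r q le_trans by blast
    then have "inv a \<in> trace H r"
      using subgroup.m_inv_closed[OF sub] a r by blast
    then have "fmem (ck (inv a)) H r" "is_op m x (ck (inv a)) (ck \<one>) r"
      using a r by (auto simp: trace_def intro!: is_opI[of a "inv a"])
    then show "(\<^bold>\<exists>y. y \<^bold>\<in> H \<^bold>\<and> (\<^bold>\<exists>e. is_zero C m e \<^bold>\<and> is_op m x y e)) r"
      using r
      by (intro fexI[where x = "ck (inv a)"] fandI fexI[where x = "ck \<one>"]) (auto simp: is_zero_one)
  qed
  have one: "(\<^bold>\<exists>e. is_zero C m e \<^bold>\<and> e \<^bold>\<in> H) p"
    using subgroup.one_closed[OF sub[OF p]] p
    by (intro fexI[where x = "ck \<one>"] fandI) (auto simp: is_zero_one trace_def)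
  have "(\<^bold>\<forall>x. \<^bold>\<forall>y. \<^bold>\<forall>z. x \<^bold>\<in> H \<^bold>\<and> y \<^bold>\<in> H \<^bold>\<and> is_op m x y z \<^bold>\<longrightarrow> z \<^bold>\<in> H) p"
    by (intro fallI fimpI) (auto simp: p elim!: fandE intro: mult)
  moreover have "has_inverses C m H p"
    unfolding has_inverses_def by (intro fallI fimpI inv) (auto simp: p)
  ultimately show ?thesis
    unfolding is_subgroup_def using ss one by (intro fandI)
qed

text \<open>Lower bound for a span in the extension: the trace of any competing subgroup contains
  what \<open>X\<close> decides at \<open>p\<close>, hence also the ground model subgroup generated
  by it.\<close>

lemma in_span_checkI:
  assumes a: "a \<in> generate G {b \<in> carrier G. X (ck b) p}" and X: "\<And>y. regular (X y)" and p: "p \<in> P"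
  shows "in_span C m X (ck a) p"
  unfolding in_span_def
proof (intro fallI fimpI)
  fix H q assume H: "is_name H" and q: "q \<in> P" "q \<preceq> p"
    and "(is_subgroup C m H \<^bold>\<and> (\<^bold>\<forall>y. X y \<^bold>\<longrightarrow> y \<^bold>\<in> H)) q"
  then have sub: "is_subgroup C m H q" and XH: "(\<^bold>\<forall>y. X y \<^bold>\<longrightarrow> y \<^bold>\<in> H) q"
    by (simp_all add: fand_def)
  have "fmem (ck b) H q" if "b \<in> carrier G" "X (ck b) p" for b
  proof -
    have "(X (ck b) \<^bold>\<longrightarrow> ck b \<^bold>\<in> H) q"
      by (rule fallD[OF XH]) (auto simp: X q)
    then show ?thesis
      by (rule fimpD) (use X q that regular_le in auto)
  qed
  then have "{b \<in> carrier G. X (ck b) p} \<subseteq> trace H q"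
    by (auto simp: trace_def)
  then have "generate G {b \<in> carrier G. X (ck b) p} \<subseteq> trace H q"
    using is_subgroupD(1)[OF sub q(1) H] generate_subgroup_incl by blast
  then show "fmem (ck a) H q"
    using a by (auto simp: trace_def)
qed (auto simp: p X)

text \<open>Upper bound for a span in the extension: the quantifier over all subgroups is
  instantiated at one well-chosen name \<open>H\<close>.\<close>

lemma in_spanD:
  assumes s: "in_span C m X x p" and X: "\<And>y. regular (X y)" and p: "p \<in> P"
    and H: "is_name H" "is_subgroup C m H p"
    and XH: "\<And>y q. q \<in> P \<Longrightarrow> q \<preceq> p \<Longrightarrow> is_name y \<Longrightarrow> X y q \<Longrightarrow> fmem y H q"
  shows "fmem x H p"
proof -
  have "(is_subgroup C m H \<^bold>\<and> (\<^bold>\<forall>y. X y \<^bold>\<longrightarrow> y \<^bold>\<in> H) \<^bold>\<longrightarrow> x \<^bold>\<in> H) p"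
    using s unfolding in_span_def by (rule fallD) (use p H X in auto)
  then show ?thesis
  proof (rule fimpD)
    show "(is_subgroup C m H \<^bold>\<and> (\<^bold>\<forall>y. X y \<^bold>\<longrightarrow> y \<^bold>\<in> H)) p"
      by (intro fandI fallI fimpI) (use p H XH X in auto)
  qed (auto simp: p X)
qed

lemma in_span_cong:
  assumes s: "in_span C m X x p" and e: "feq x x' p" and X: "\<And>y. regular (X y)" and p: "p \<in> P"
  shows "in_span C m X x' p"
  unfolding in_span_def
proof (intro fallI fimpI)
  fix H q assume H: "is_name H" and q: "q \<in> P" "q \<preceq> p"
    and "(is_subgroup C m H \<^bold>\<and> (\<^bold>\<forall>y. X y \<^bold>\<longrightarrow> y \<^bold>\<in> H)) q"
  then have sub: "is_subgroup C m H q" and XH: "(\<^bold>\<forall>y. X y \<^bold>\<longrightarrow> y \<^bold>\<in> H) q"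
    by (simp_all add: fand_def)
  have "(is_subgroup C m H \<^bold>\<and> (\<^bold>\<forall>y. X y \<^bold>\<longrightarrow> y \<^bold>\<in> H) \<^bold>\<longrightarrow> x \<^bold>\<in> H) q"
    using regular_le[OF regular_in_span s q(2)] unfolding in_span_def
    by (rule fallD) (use q H X in auto)
  then have "fmem x H q"
    by (rule fimpD) (use q sub XH X in \<open>auto intro: fandI\<close>)
  then show "fmem x' H q"
    using fmem_cong_left e q feq_le by blast
qed (auto simp: p X)

lemma is_positive_multiple_check:
  assumes a: "a \<in> carrier G" and p: "p \<in> P"
  shows "is_positive_multiple m (ck a) (ck (a [^] Suc n)) p"
  unfolding is_positive_multiple_def
proof (intro fallI fimpI)
  fix N q assume N: "is_name N" and q: "q \<in> P" "q \<preceq> p"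
    and "(ck a \<^bold>\<in> N \<^bold>\<and> (\<^bold>\<forall>y. \<^bold>\<forall>z. y \<^bold>\<in> N \<^bold>\<and> is_op m y (ck a) z \<^bold>\<longrightarrow> z \<^bold>\<in> N)) q"
  then have aN: "fmem (ck a) N q"
    and step: "(\<^bold>\<forall>y. \<^bold>\<forall>z. y \<^bold>\<in> N \<^bold>\<and> is_op m y (ck a) z \<^bold>\<longrightarrow> z \<^bold>\<in> N) q"
    by (auto elim!: fandE)
  show "fmem (ck (a [^] Suc n)) N q"
  proof (induction n)
    case 0
    then show ?case
      using aN a by simp
  next
    case (Suc n)
    let ?c = "a [^] Suc n"
    have "(\<^bold>\<forall>z. ck ?c \<^bold>\<in> N \<^bold>\<and> is_op m (ck ?c) (ck a) z \<^bold>\<longrightarrow> z \<^bold>\<in> N) q"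
      by (rule fallD[OF step]) (auto simp: q)
    then have "(ck ?c \<^bold>\<in> N \<^bold>\<and> is_op m (ck ?c) (ck a) (ck (?c \<otimes> a)) \<^bold>\<longrightarrow> ck (?c \<otimes> a) \<^bold>\<in> N) q"
      by (rule fallD) (auto simp: q)
    then have "fmem (ck (?c \<otimes> a)) N q"
      by (rule fimpD) (use Suc.IH q a in \<open>auto intro!: fandI is_op_checkI simp del: nat_pow_Suc\<close>)
    then show ?case
      by simp
  qed
qed (auto simp: p)

definition positive_powers :: "'v \<Rightarrow> 'v set" where
  "positive_powers a = range (\<lambda>n. a [^] Suc n)"

lemma elts_positive_powers: "a \<in> carrier G \<Longrightarrow> elts (vset (positive_powers a)) = positive_powers a"
  by (rule elts_vset, rule small_subset[OF small_carrier]) (auto simp: positive_powers_def)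

text \<open>The set quantifier is instantiated at the check name of the true positive powers, so the
  extension has no further positive multiples.\<close>

lemma is_positive_multipleD:
  assumes pm: "is_positive_multiple m b x p" and a: "a \<in> carrier G" "feq (ck a) b p"
    and p: "p \<in> P" and n: "is_name b"
  shows "fmem x (ck (vset (positive_powers a))) p" (is "fmem x ?N p")
proof -
  note N = elts_positive_powers[OF a(1)]
  have step: "fmem z ?N q" if q: "q \<in> P" "q \<preceq> p" and n': "is_name y" "is_name z"
    and y: "fmem y ?N q" and op: "is_op m y b z q" for y z q
    using y
  proof (rule fmem_checkE[OF _ q(1) regular_fmem])
    fix r c assume r: "r \<in> P" "r \<preceq> q" "c \<in> elts (vset (positive_powers a))" "feq (ck c) y r"
    then obtain k where k: "c = a [^] Suc k"
      using N by (auto simp: positive_powers_def)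
    have "is_op m y b z r" "feq (ck a) b r"
      using op r q a feq_le le_trans regular_le[OF regular_is_pair(3)] by blast+
    then have "feq (ck (c \<otimes> a)) z r"
      using is_op_check[of y b z r c a] r n n' by blast
    moreover have "c \<otimes> a = a [^] Suc (Suc k)"
      using k by simp
    then have "c \<otimes> a \<in> elts (vset (positive_powers a))"
      unfolding N unfolding positive_powers_def
      by (rule range_eqI[where x = "Suc k" and f = "\<lambda>n. a [^] Suc n"])
    ultimately show "fmem z ?N r"
      using r by (intro fmem_checkI[of "c \<otimes> a"])
  qed
  have "(b \<^bold>\<in> ?N \<^bold>\<and> (\<^bold>\<forall>y. \<^bold>\<forall>z. y \<^bold>\<in> ?N \<^bold>\<and> is_op m y b z \<^bold>\<longrightarrow> z \<^bold>\<in> ?N) \<^bold>\<longrightarrow> x \<^bold>\<in> ?N) p"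
    using pm unfolding is_positive_multiple_def by (rule fallD) (auto simp: p)
  then show ?thesis
  proof (rule fimpD)
    have "a \<in> positive_powers a"
      unfolding positive_powers_def by (rule range_eqI[where x = 0]) (use a in simp)
    then have "fmem b ?N p"
      by (intro fmem_checkI[of a]) (simp_all only: N a p)
    moreover have "(\<^bold>\<forall>y. \<^bold>\<forall>z. y \<^bold>\<in> ?N \<^bold>\<and> is_op m y b z \<^bold>\<longrightarrow> z \<^bold>\<in> ?N) p"
      by (intro fallI fimpI) (auto simp: p elim!: fandE intro: step)
    ultimately show "(b \<^bold>\<in> ?N \<^bold>\<and> (\<^bold>\<forall>y. \<^bold>\<forall>z. y \<^bold>\<in> ?N \<^bold>\<and> is_op m y b z \<^bold>\<longrightarrow> z \<^bold>\<in> ?N)) p"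
      by (intro fandI)
  qed (auto simp: p)
qed

lemma trace_check: "p \<in> P \<Longrightarrow> trace (ck x) p = carrier G \<inter> elts x"
  by (auto simp: trace_def feq_check_iff elim!: fmem_checkE[where \<psi> = "\<lambda>_. _ \<in> elts x"])

lemma is_subset_check:
  assumes "elts x \<subseteq> carrier G" "p \<in> P"
  shows "is_subset (ck x) C p"
  unfolding is_subset_def
proof (intro fallI fimpI)
  fix u q assume q: "q \<in> P" and u: "fmem u (ck x) q"
  from u q regular_fmem show "fmem u C q"
    by (rule fmem_checkE) (use assms fmem_carrierI in blast)
qed (auto simp: assms)

lemma is_subgroup_check:
  assumes K: "subgroup K G" and p: "p \<in> P"
  shows "elts (vset K) = K" "is_subgroup C m (ck (vset K)) p"
proof -
  have sub: "K \<subseteq> carrier G"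
    using K subgroup.subset by blast
  show e: "elts (vset K) = K"
    by (rule elts_vset[OF small_subset[OF small_carrier sub]])
  show "is_subgroup C m (ck (vset K)) p"
  proof (rule is_subgroupI[OF p])
    show "subgroup (trace (ck (vset K)) q) G" if "q \<in> P" for q
      using sub K that by (simp add: trace_check e Int_absorb1)
    show "is_subset (ck (vset K)) C p"
      by (rule is_subset_check) (simp_all add: e sub p)
  qed
qed

end

section \<open>Bases in the ground model and in the extension\<close>

definition (in group) free_basis :: "'a set \<Rightarrow> bool" where
  "free_basis B \<longleftrightarrow> B \<subseteq> carrier G \<and> generate G B = carrier G \<and>
     (\<forall>b\<in>B. (\<forall>n. b [^] Suc n \<noteq> \<one>) \<and> generate G {b} \<inter> generate G (B - {b}) \<subseteq> {\<one>})"

context group_forcing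
begin

abbreviation basis_element :: "'v name \<Rightarrow> 'v name \<Rightarrow> 'v \<Rightarrow> bool" where
  "basis_element B b \<equiv> has_infinite_order C m b \<^bold>\<and>
     (\<^bold>\<forall>x. in_span C m (\<lambda>y. y \<^bold>= b) x \<^bold>\<and>
          in_span C m (\<lambda>y. y \<^bold>\<in> B \<^bold>\<and> \<^bold>\<not> y \<^bold>= b) x \<^bold>\<longrightarrow> is_zero C m x)"

lemma forced_abelian_group: "p \<in> P \<Longrightarrow> is_abelian_group C m p"
proof -
  assume p: "p \<in> P"
  have "is_binop C m p"
    unfolding is_binop_def
  proof (intro fallI fimpI)
    fix x y q assume n: "is_name x" "is_name y" and q: "q \<in> P" "q \<preceq> p" and "(x \<^bold>\<in> C \<^bold>\<and> y \<^bold>\<in> C) q"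
    then have x: "fmem x C q" and y: "fmem y C q"
      by (auto elim: fandE)
    from x show "(\<^bold>\<exists>z. z \<^bold>\<in> C \<^bold>\<and> is_op m x y z \<^bold>\<and> (\<^bold>\<forall>z'. is_op m x y z' \<^bold>\<longrightarrow> z' \<^bold>= z)) q"
    proof (rule fmem_carrierE[OF _ q(1) regular_fex])
      fix r a assume r: "r \<in> P" "r \<preceq> q" and a: "a \<in> carrier G" "feq (ck a) x r"
      have "fmem y C r"
        using y r regular_le[OF regular_fmem] by blast
      then show "(\<^bold>\<exists>z. z \<^bold>\<in> C \<^bold>\<and> is_op m x y z \<^bold>\<and> (\<^bold>\<forall>z'. is_op m x y z' \<^bold>\<longrightarrow> z' \<^bold>= z)) r"
      proof (rule fmem_carrierE[OF _ r(1) regular_fex])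
        fix s b assume s: "s \<in> P" "s \<preceq> r" and b: "b \<in> carrier G" "feq (ck b) y s"
        have as: "feq (ck a) x s"
          using feq_le[OF a(2) s(2)] .
        have "feq z (ck (a \<otimes> b)) t" if "t \<in> P" "t \<preceq> s" "is_name z" "is_op m x y z t" for z t
          using is_op_check[OF that(4,1) n that(3), of a b] feq_le[OF as that(2)] feq_le[OF b(2) that(2)]
            feq_sym' by simp
        then have "(\<^bold>\<forall>z'. is_op m x y z' \<^bold>\<longrightarrow> z' \<^bold>= ck (a \<otimes> b)) s"
          by (intro fallI fimpI) (auto simp: s)
        moreover have "is_op m x y (ck (a \<otimes> b)) s"
          using is_opI as a b s by simp
        moreover have "fmem (ck (a \<otimes> b)) C s"
          using a b s by (simp add: elts_carrier_code)
        ultimately show "(\<^bold>\<exists>z. z \<^bold>\<in> C \<^bold>\<and> is_op m x y z \<^bold>\<and> (\<^bold>\<forall>z'. is_op m x y z' \<^bold>\<longrightarrow> z' \<^bold>= z)) s"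
          by (intro fexI[OF s(1) is_name_check[of "a \<otimes> b"]] fandI) auto
      qed
    qed
  qed (auto simp: p)
  moreover have "is_assoc C m p"
    unfolding is_assoc_def
  proof (intro fallI fimpI)
    fix x y z u v w q r assume n: "is_name x" "is_name y" "is_name z" "is_name u" "is_name v" "is_name w"
      and q: "q \<in> P" "q \<preceq> p" and r: "r \<in> P" "r \<preceq> q"
      and "(is_op m x y u \<^bold>\<and> is_op m y z v \<^bold>\<and> is_op m u z w) r"
    then have o1: "is_op m x y u r" and o2: "is_op m y z v r" and o3: "is_op m u z w r"
      by (auto elim!: fandE)
    from o1 show "is_op m x v w r"
    proof (rule is_opE[OF _ r(1) n(1,2,4) regular_is_pair(3)])
      fix s a b assume s: "s \<in> P" "s \<preceq> r" and ab: "a \<in> carrier G" "b \<in> carrier G"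
        "feq (ck a) x s" "feq (ck b) y s" "feq (ck (a \<otimes> b)) u s"
      have "is_op m y z v s"
        by (rule regular_le[OF regular_is_pair(3) o2 s(2)])
      then show "is_op m x v w s"
      proof (rule is_opE[OF _ s(1) n(2,3,5) regular_is_pair(3)])
        fix t b' c assume t: "t \<in> P" "t \<preceq> s" and bc: "b' \<in> carrier G" "c \<in> carrier G"
          "feq (ck b') y t" "feq (ck c) z t" "feq (ck (b' \<otimes> c)) v t"
        have "b' = b"
          by (rule feq_check_unique[OF bc(3) feq_le[OF ab(4) t(2)] t(1)])
        moreover have "is_op m u z w t"
          by (rule regular_le[OF regular_is_pair(3) o3 le_trans[OF t(2) s(2)]])
        then have "feq (ck (a \<otimes> b \<otimes> c)) w t"
          using is_op_check[OF _ t(1) n(4,3,6) feq_le[OF ab(5) t(2)] bc(4)] by blast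
        ultimately show "is_op m x v w t"
          using ab bc t feq_le[OF ab(3) t(2)] by (intro is_opI[of a "b \<otimes> c"]) (auto simp: m_assoc)
      qed
    qed
  qed (auto simp: p)
  moreover have "is_comm C m p"
    unfolding is_comm_def
  proof (intro fallI fimpI)
    fix x y z q assume n: "is_name x" "is_name y" "is_name z" and q: "q \<in> P" "q \<preceq> p"
      and "(x \<^bold>\<in> C \<^bold>\<and> y \<^bold>\<in> C \<^bold>\<and> is_op m x y z) q"
    then have "is_op m x y z q"
      by (auto elim!: fandE)
    then show "is_op m y x z q"
    proof (rule is_opE[OF _ q(1) n regular_is_pair(3)])
      fix r a b assume "r \<in> P" "a \<in> carrier G" "b \<in> carrier G"
        "feq (ck a) x r" "feq (ck b) y r" "feq (ck (a \<otimes> b)) z r"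
      then show "is_op m y x z r"
        by (intro is_opI[of b a]) (auto simp: m_comm)
    qed
  qed (auto simp: p)
  moreover have "(\<^bold>\<exists>e. is_zero C m e) p"
    by (rule fexI[OF p is_name_check[of \<one>]]) (auto simp: is_zero_one p)
  moreover have "has_inverses C m C p"
    unfolding has_inverses_def
  proof (intro fallI fimpI)
    fix x q assume n: "is_name x" and q: "q \<in> P" "q \<preceq> p" and x: "fmem x C q"
    from x show "(\<^bold>\<exists>y. y \<^bold>\<in> C \<^bold>\<and> (\<^bold>\<exists>e. is_zero C m e \<^bold>\<and> is_op m x y e)) q"
    proof (rule fmem_carrierE[OF _ q(1) regular_fex])
      fix r a assume r: "r \<in> P" "r \<preceq> q" and a: "a \<in> carrier G" "feq (ck a) x r"
      have "is_op m x (ck (inv a)) (ck \<one>) r"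
        using a r by (intro is_opI[of a "inv a"]) auto
      then have "(\<^bold>\<exists>e. is_zero C m e \<^bold>\<and> is_op m x (ck (inv a)) e) r"
        using r by (intro fexI[OF r(1) is_name_check[of \<one>]] fandI) (auto simp: is_zero_one)
      then show "(\<^bold>\<exists>y. y \<^bold>\<in> C \<^bold>\<and> (\<^bold>\<exists>e. is_zero C m e \<^bold>\<and> is_op m x y e)) r"
        using r a
        by (intro fexI[OF r(1) is_name_check[of "inv a"]]) (auto simp: elts_carrier_code intro: fandI)
    qed
  qed (auto simp: p)
  ultimately show ?thesis
    unfolding is_abelian_group_def by (intro fandI)
qed

text \<open>\<open>ck (vset B)\<close> remains a basis in every extension because spans, positive
  multiples and equality of ground model elements are computed there as in the ground model.\<close>

lemma forced_free_if_free_basis: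
  assumes B: "free_basis B"
  shows "forced (is_free_abelian_group C m)"
proof -
  have Bc: "B \<subseteq> carrier G" and gB: "generate G B = carrier G"
    and inf: "\<And>b n. b \<in> B \<Longrightarrow> b [^] Suc n \<noteq> \<one>"
    and ind: "\<And>b. b \<in> B \<Longrightarrow> generate G {b} \<inter> generate G (B - {b}) \<subseteq> {\<one>}"
    using B by (auto simp: free_basis_def simp del: nat_pow_Suc)
  let ?B = "ck (vset B)"
  have eB: "elts (vset B) = B"
    by (rule elts_vset[OF small_subset[OF small_carrier Bc]])
  have tr: "{b \<in> carrier G. fmem (ck b) ?B q} = B" if "q \<in> P" for q
    using trace_check[OF that, of "vset B"] Bc unfolding trace_def eB by blast
  have basis: "is_basis C m ?B p" if p: "p \<in> P" for p
    unfolding is_basis_def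
  proof (intro fandI)
    show "is_subset ?B C p"
      by (rule is_subset_check) (simp_all add: eB Bc p)
    show "(\<^bold>\<forall>x. x \<^bold>\<in> C \<^bold>\<longrightarrow> in_span C m (\<lambda>y. y \<^bold>\<in> ?B) x) p"
    proof (intro fallI fimpI)
      fix x q assume q: "q \<in> P" "q \<preceq> p" and x: "fmem x C q"
      from x show "in_span C m (\<lambda>y. y \<^bold>\<in> ?B) x q"
      proof (rule fmem_carrierE[OF _ q(1) regular_in_span])
        fix r a assume r: "r \<in> P" "r \<preceq> q" and a: "a \<in> carrier G" "feq (ck a) x r"
        have "in_span C m (\<lambda>y. y \<^bold>\<in> ?B) (ck a) r"
          by (rule in_span_checkI) (use a r tr gB in auto)
        then show "in_span C m (\<lambda>y. y \<^bold>\<in> ?B) x r"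
          by (rule in_span_cong) (use a r in auto)
      qed
    qed (auto simp: p)
    show "(\<^bold>\<forall>b. b \<^bold>\<in> ?B \<^bold>\<longrightarrow>
         basis_element ?B b) p"
    proof (intro fallI fimpI)
      fix b q assume n: "is_name b" and q: "q \<in> P" "q \<preceq> p" and b: "fmem b ?B q"
      have reg: "regular (basis_element ?B b)"
        by simp
      from b show "basis_element ?B b q"
      proof (rule fmem_checkE[OF _ q(1) reg], intro fandI)
        fix r b0 assume r: "r \<in> P" "r \<preceq> q" and b0': "b0 \<in> elts (vset B)" and fb: "feq (ck b0) b r"
        have b0: "b0 \<in> B" "b0 \<in> carrier G"
          using b0' eB Bc by auto
        let ?N = "positive_powers b0"
        note N = elts_positive_powers[OF b0(2)]
        show "has_infinite_order C m b r"
          unfolding has_infinite_order_def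
        proof (intro fallI fimpI)
          fix e s assume e: "is_name e" and s: "s \<in> P" "s \<preceq> r" and z: "is_zero C m e s"
          have "\<not> is_positive_multiple m b e t" if t: "t \<preceq> s" for t
          proof
            assume pm: "is_positive_multiple m b e t"
            have tP: "t \<in> P"
              using t le_in by blast
            have "feq (ck b0) b t"
              using fb s t le_trans feq_le by blast
            then have "fmem e (ck (vset ?N)) t"
              using is_positive_multipleD[OF pm b0(2) _ tP n] by simp
            moreover have "feq e (ck \<one>) t"
              using z is_zero_iff[OF s(1) e] feq_le[OF _ t] feq_sym' by blast
            ultimately have "fmem (ck \<one>) (ck (vset ?N)) t"
              using fmem_cong_left tP by blast
            then have "\<one> \<in> ?N"
              by (rule fmem_checkE[where \<psi> = "\<lambda>_. \<one> \<in> ?N"])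
                (use tP N in \<open>auto simp: feq_check_iff\<close>)
            then show False
              using inf[OF b0(1)] unfolding positive_powers_def by (metis rangeE)
          qed
          then show "(\<^bold>\<not> is_positive_multiple m b e) s"
            by (simp add: fnot_iff)
        qed (auto simp: r)
        show "(\<^bold>\<forall>x. in_span C m (\<lambda>y. y \<^bold>= b) x \<^bold>\<and>
              in_span C m (\<lambda>y. y \<^bold>\<in> ?B \<^bold>\<and> \<^bold>\<not> y \<^bold>= b) x \<^bold>\<longrightarrow> is_zero C m x) r"
        proof (intro fallI fimpI)
          fix x s assume x: "is_name x" and s: "s \<in> P" "s \<preceq> r"
            and "(in_span C m (\<lambda>y. y \<^bold>= b) x \<^bold>\<and> in_span C m (\<lambda>y. y \<^bold>\<in> ?B \<^bold>\<and> \<^bold>\<not> y \<^bold>= b) x) s"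
          then have s1: "in_span C m (\<lambda>y. y \<^bold>= b) x s"
            and s2: "in_span C m (\<lambda>y. y \<^bold>\<in> ?B \<^bold>\<and> \<^bold>\<not> y \<^bold>= b) x s"
            by (auto elim: fandE)
          \<comment> \<open>The two forced spans are bounded by these ground model subgroups, so a
            common member is decided to be \<open>\<one>\<close>.\<close>
          let ?H1 = "generate G {b0}" and ?H2 = "generate G (B - {b0})"
          have g1: "subgroup ?H1 G" and g2: "subgroup ?H2 G"
            using b0 Bc by (auto intro!: generate_is_subgroup)
          have in1: "b0 \<in> ?H1" and in2: "B - {b0} \<subseteq> ?H2"
            by (auto intro: generate.incl)
          have "fmem x (ck (vset ?H1)) s"
            using s1
          proof (rule in_spanD)
            fix y t assume t: "t \<in> P" "t \<preceq> s" and y: "feq y b t"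
            have "feq (ck b0) b t"
              using fb s t le_trans feq_le by blast
            then have "feq (ck b0) y t"
              using y t feq_sym' feq_trans by blast
            then show "fmem y (ck (vset ?H1)) t"
              using t in1 is_subgroup_check(1)[OF g1] by (intro fmem_checkI[of b0]) auto
          qed (use s is_subgroup_check[OF g1] in auto)
          moreover have "fmem x (ck (vset ?H2)) s"
            using s2
          proof (rule in_spanD)
            fix y t assume t: "t \<in> P" "t \<preceq> s" and "(y \<^bold>\<in> ?B \<^bold>\<and> \<^bold>\<not> y \<^bold>= b) t"
            then have y: "fmem y ?B t" and nb: "(\<^bold>\<not> y \<^bold>= b) t"
              by (auto elim: fandE)
            from y show "fmem y (ck (vset ?H2)) t"
            proof (rule fmem_checkE[OF _ t(1) regular_fmem])
              fix u c assume u: "u \<in> P" "u \<preceq> t" and c: "c \<in> elts (vset B)" "feq (ck c) y u"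
              have "feq (ck b0) b u"
                using fb s t u le_trans feq_le by blast
              then have "c \<noteq> b0"
                using c(2) nb u feq_sym' feq_trans unfolding fnot_iff by blast
              then have "c \<in> ?H2"
                using c eB in2 by auto
              then show "fmem y (ck (vset ?H2)) u"
                using u c is_subgroup_check(1)[OF g2] by (intro fmem_checkI[of c]) auto
            qed
          qed (use s is_subgroup_check[OF g2] in auto)
          ultimately have "fmem x (ck (vset ?H1)) s" and x2: "fmem x (ck (vset ?H2)) s"
            by auto
          from this(1) show "is_zero C m x s"
          proof (rule fmem_checkE[OF _ s(1) regular_is_zero])
            fix t a assume t: "t \<in> P" "t \<preceq> s" and a: "a \<in> elts (vset ?H1)" "feq (ck a) x t"
            have "fmem (ck a) (ck (vset ?H2)) t"
              using fmem_cong_left[OF regular_le[OF regular_fmem x2 t(2)]] a t feq_sym' by blast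
            then have "a \<in> ?H2"
              by (rule fmem_checkE[where \<psi> = "\<lambda>_. a \<in> ?H2"])
                (use t is_subgroup_check(1)[OF g2] in \<open>auto simp: feq_check_iff\<close>)
            then have "a = \<one>"
              using a is_subgroup_check(1)[OF g1] ind[OF b0(1)] t by auto
            then show "is_zero C m x t"
              using a t x by (simp add: is_zero_iff)
          qed
        qed (auto simp: r)
      qed
    qed (auto simp: p)
  qed
  show ?thesis
    unfolding forced_def is_free_abelian_group_def
  proof (intro ballI fandI)
    fix p assume p: "p \<in> P"
    show "is_abelian_group C m p"
      by (rule forced_abelian_group[OF p])
    show "(\<^bold>\<exists>B. is_basis C m B) p"
      by (rule fexI[OF p is_name_check[of "vset B"]]) (simp_all add: basis p)
  qed
qed

text \<open>All that is used of a poset forcing freeness. \<open>D q\<close> is the part of a fixed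
  basis name that \<open>q\<close> decides: it grows along the forcing and is independent, but it
  spans a given element only after passing to some stronger \<open>r\<close>.\<close>

theorem forced_free_decides_basis:
  assumes "forced (is_free_abelian_group C m)"
  obtains p1 D where "p1 \<in> P"
    and "\<And>q r. r \<preceq> q \<Longrightarrow> D q \<subseteq> D r"
    and "\<And>q. q \<preceq> p1 \<Longrightarrow> D q \<subseteq> carrier G"
    and "\<And>q b n. q \<preceq> p1 \<Longrightarrow> b \<in> D q \<Longrightarrow> b [^] Suc n \<noteq> \<one>"
    and "\<And>q b. q \<preceq> p1 \<Longrightarrow> b \<in> D q \<Longrightarrow> generate G {b} \<inter> generate G (D q - {b}) \<subseteq> {\<one>}"
    and "\<And>q a. q \<preceq> p1 \<Longrightarrow> a \<in> carrier G \<Longrightarrow> \<exists>r. r \<preceq> q \<and> a \<in> generate G (D r)"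
proof -
  have "is_free_abelian_group C m p0"
    using assms by (auto simp: forced_def)
  then have "(\<^bold>\<exists>B. is_basis C m B) p0"
    by (auto simp: is_free_abelian_group_def elim: fandE)
  then obtain p1 B where p1: "p1 \<in> P" and B: "is_name B" "is_basis C m B p1"
    unfolding fex_def dense_below_iff by (meson le_in le_refl top_in)
  define D where "D = trace B"
  have mono: "D q \<subseteq> D r" if "r \<preceq> q" for q r
    unfolding D_def by (rule trace_le[OF that])
  have Dc: "D q \<subseteq> carrier G" for q
    by (auto simp: D_def trace_def)
  \<comment> \<open>A name \<open>H\<close> for the subgroup generated by the basis:
    \<open>a\<close> enters with condition \<open>q\<close> once it is generated by
    \<open>D q\<close>. Indexing by pairs of element and condition keeps the family small.\<close>
  define F where "F = (\<lambda>i. if \<exists>a q. i = vpair a q \<and> q \<in> P \<and> a \<in> generate G (D q)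
     then Some (ck (THE a. \<exists>q. i = vpair a q), THE q. \<exists>a. i = vpair a q) else None)"
  define H where "H = Name F"
  have ranF: "ran F = {(ck a, q) | a q. q \<in> P \<and> a \<in> generate G (D q)}"
  proof (intro equalityI subsetI)
    fix z assume "z \<in> {(ck a, q) | a q. q \<in> P \<and> a \<in> generate G (D q)}"
    then obtain a q where "z = (ck a, q)" "q \<in> P" "a \<in> generate G (D q)"
      by blast
    then have "F (vpair a q) = Some z"
      by (auto simp: F_def)
    then show "z \<in> ran F"
      by (rule ranI)
  qed (auto simp: F_def ran_def split: if_splits)
  have nH: "is_name H"
    unfolding H_def
  proof (rule is_name.intros)
    have "small P"
      using poset by (simp add: forcing_poset_def)
    then have "small {vpair a q | a q. a \<in> carrier G \<and> q \<in> P}"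
      using small_vpair_image[OF small_carrier, of "\<lambda>_. P"] by simp
    then show "small (dom F)"
      by (rule small_subset) (use generate_in_carrier[OF Dc] in \<open>auto simp: F_def split: if_splits\<close>)
  qed (auto simp: ranF)
  have gmono: "generate G (D q) \<subseteq> generate G (D r)" if "r \<preceq> q" for q r
    by (rule mono_generate[OF mono[OF that]])
  have memH: "fmem u H q \<longleftrightarrow> dense_below (\<lambda>r. \<exists>a\<in>generate G (D r). feq (ck a) u r) q" for u q
  proof -
    have "(\<exists>\<tau> d. (\<tau>, d) \<in> members H \<and> r \<preceq> d \<and> feq \<tau> u r) \<longleftrightarrow> (\<exists>a\<in>generate G (D r). feq (ck a) u r)"
      (is "?L \<longleftrightarrow> ?R") if r: "r \<in> P" for r
    proof
      assume ?L
      then obtain a d where "a \<in> generate G (D d)" "r \<preceq> d" "feq (ck a) u r"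
        by (auto simp: H_def ranF)
      then show ?R
        using gmono by blast
    next
      assume ?R
      then obtain a where a: "a \<in> generate G (D r)" "feq (ck a) u r"
        by blast
      then have "(ck a, r) \<in> members H"
        using r by (auto simp: H_def ranF)
      then show ?L
        using a r by blast
    qed
    then show ?thesis
      unfolding fmem_iff by (intro dense_below_cong) (simp add: le_in)
  qed
  have traceH: "trace H q = {a \<in> carrier G. dense_below (\<lambda>r. a \<in> generate G (D r)) q}" if "q \<in> P" for q
  proof -
    have "(\<exists>b\<in>generate G (D r). feq (ck b) (ck a) r) \<longleftrightarrow> a \<in> generate G (D r)" if "r \<in> P" for a r
      using that by (auto simp: feq_check_iff)
    then have "dense_below (\<lambda>r. \<exists>b\<in>generate G (D r). feq (ck b) (ck a) r) q \<longleftrightarrow>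
        dense_below (\<lambda>r. a \<in> generate G (D r)) q" for a
      by (intro dense_below_cong) (simp add: le_in)
    then show ?thesis
      unfolding trace_def memH by simp
  qed
  have gsub: "subgroup (generate G (D q)) G" for q
    by (rule generate_is_subgroup[OF Dc])
  have subH: "subgroup (trace H q) G" if q: "q \<in> P" for q
  proof
    show "trace H q \<subseteq> carrier G"
      by (auto simp: trace_def)
    show "\<one> \<in> trace H q"
      using subgroup.one_closed[OF gsub] q by (auto simp: traceH intro: denseI)
  next
    fix a assume "a \<in> trace H q"
    then show "inv a \<in> trace H q"
      using subgroup.m_inv_closed[OF gsub] by (auto simp: traceH[OF q] elim!: dense_below_mono)
  next
    fix a b assume a: "a \<in> trace H q" and b: "b \<in> trace H q"
    have "dense_below (\<lambda>r. a \<in> generate G (D r)) q"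
      using a by (simp add: traceH[OF q])
    then have "dense_below (\<lambda>r. a \<otimes> b \<in> generate G (D r)) q"
    proof (rule denseE[OF _ q regular_dense_below])
      fix r assume r: "r \<in> P" "r \<preceq> q" and ar: "a \<in> generate G (D r)"
      have "dense_below (\<lambda>r. b \<in> generate G (D r)) r"
        using b dense_below_le[OF _ r(2)] by (simp add: traceH[OF q])
      then show "dense_below (\<lambda>r. a \<otimes> b \<in> generate G (D r)) r"
        by (rule dense_below_mono) (use ar gmono subgroup.m_closed[OF gsub] in blast)
    qed
    then show "a \<otimes> b \<in> trace H q"
      using a b by (simp add: traceH[OF q])
  qed
  have ssB: "is_subset B C q" and span: "(\<^bold>\<forall>x. x \<^bold>\<in> C \<^bold>\<longrightarrow> in_span C m (\<lambda>y. y \<^bold>\<in> B) x) q"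
    and ind: "(\<^bold>\<forall>b. b \<^bold>\<in> B \<^bold>\<longrightarrow>
         basis_element B b) q"
    if q: "q \<preceq> p1" for q
    using regular_le[OF regular_is_basis B(2) q] unfolding is_basis_def by (auto elim!: fandE)
  have ssH: "is_subset H C q" if q: "q \<in> P" for q
    unfolding is_subset_def
  proof (intro fallI fimpI)
    fix x r assume r: "r \<in> P" "r \<preceq> q" and x: "fmem x H r"
    from x[unfolded memH] show "fmem x C r"
      by (rule denseE[OF _ r(1) regular_fmem]) (use generate_in_carrier[OF Dc] fmem_carrierI in blast)
  qed (auto simp: q)
  \<comment> \<open>\<open>H\<close> is forced to be a subgroup containing \<open>B\<close>, so it
    contains all that \<open>B\<close> spans; membership of \<open>ck a\<close> in \<open>H\<close>
    means that \<open>a\<close> is densely generated by some \<open>D r\<close>.\<close>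
  have spanD: "\<exists>r. r \<preceq> q \<and> a \<in> generate G (D r)" if q: "q \<preceq> p1" and a: "a \<in> carrier G" for q a
  proof -
    have qP: "q \<in> P"
      using q le_in by blast
    have "(ck a \<^bold>\<in> C \<^bold>\<longrightarrow> in_span C m (\<lambda>y. y \<^bold>\<in> B) (ck a)) q"
      using span[OF q] by (rule fallD) (auto simp: qP)
    then have "in_span C m (\<lambda>y. y \<^bold>\<in> B) (ck a) q"
      by (rule fimpD) (use a in \<open>auto simp: qP elts_carrier_code\<close>)
    then have "fmem (ck a) H q"
    proof (rule in_spanD)
      show "is_subgroup C m H q"
        by (rule is_subgroupI[OF qP ssH[OF qP] subH])
      fix y r assume r: "r \<in> P" "r \<preceq> q" and y: "is_name y" "fmem y B r"
      have "is_subset B C r"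
        using ssB q r le_trans by blast
      from y(2) this r(1) y(1) regular_fmem show "fmem y H r"
      proof (rule fmem_subsetE)
        fix s b assume s: "s \<in> P" "b \<in> trace B s" "feq (ck b) y s"
        have "b \<in> generate G (D t)" if "t \<preceq> s" for t
          using s(2) mono[OF that] by (auto simp: D_def intro: generate.incl)
        then show "fmem y H s"
          unfolding memH using s feq_le by (intro denseI) blast+
      qed
    qed (auto simp: qP nH)
    then show ?thesis
      using traceH[OF qP] a qP by (auto simp: trace_def dense_below_iff)
  qed
  \<comment> \<open>An element common to the two ground model spans is forced into both spans of the
    formula, hence forced to be zero, and so it equals \<open>\<one>\<close>.\<close>
  have bas: "(\<forall>n. b [^] Suc n \<noteq> \<one>) \<and> generate G {b} \<inter> generate G (D q - {b}) \<subseteq> {\<one>}"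
    if q: "q \<preceq> p1" and b: "b \<in> D q" for q b
  proof -
    have qP: "q \<in> P"
      using q le_in by blast
    have bc: "b \<in> carrier G" and bB: "fmem (ck b) B q"
      using b by (auto simp: D_def trace_def)
    have "(ck b \<^bold>\<in> B \<^bold>\<longrightarrow>
         basis_element B (ck b)) q"
      using ind[OF q] by (rule fallD) (auto simp: qP)
    then have "(basis_element B (ck b)) q"
      by (rule fimpD) (use bB in \<open>auto simp: qP\<close>)
    then have io: "has_infinite_order C m (ck b) q"
      and is0: "(\<^bold>\<forall>x. in_span C m (\<lambda>y. y \<^bold>= ck b) x \<^bold>\<and>
              in_span C m (\<lambda>y. y \<^bold>\<in> B \<^bold>\<and> \<^bold>\<not> y \<^bold>= ck b) x \<^bold>\<longrightarrow> is_zero C m x) q"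
      by (auto elim: fandE)
    have "(is_zero C m (ck \<one>) \<^bold>\<longrightarrow> \<^bold>\<not> is_positive_multiple m (ck b) (ck \<one>)) q"
      using io unfolding has_infinite_order_def by (rule fallD) (auto simp: qP)
    then have "(\<^bold>\<not> is_positive_multiple m (ck b) (ck \<one>)) q"
      by (rule fimpD) (auto simp: qP is_zero_one)
    then have "\<not> is_positive_multiple m (ck b) (ck \<one>) q"
      using qP by (simp add: fnot_iff)
    then have 1: "\<forall>n. b [^] Suc n \<noteq> \<one>"
      using is_positive_multiple_check[OF bc qP] by metis
    have 2: "x = \<one>" if x: "x \<in> generate G {b}" "x \<in> generate G (D q - {b})" for x
    proof -
      have "{c \<in> carrier G. feq (ck c) (ck b) q} = {b}"
        using bc qP by (auto simp: feq_check_iff)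
      then have "in_span C m (\<lambda>y. y \<^bold>= ck b) (ck x) q"
        using x by (intro in_span_checkI) (auto simp: qP)
      moreover have "(\<^bold>\<not> ck c \<^bold>= ck b) q \<longleftrightarrow> c \<noteq> b" for c
        using qP by (auto simp: fnot_iff dest: le_in simp: feq_check_iff)
      then have "{c \<in> carrier G. (ck c \<^bold>\<in> B \<^bold>\<and> \<^bold>\<not> ck c \<^bold>= ck b) q} = D q - {b}"
        by (auto simp: fand_def D_def trace_def)
      then have "in_span C m (\<lambda>y. y \<^bold>\<in> B \<^bold>\<and> \<^bold>\<not> y \<^bold>= ck b) (ck x) q"
        using x by (intro in_span_checkI) (auto simp: qP)
      moreover have "(in_span C m (\<lambda>y. y \<^bold>= ck b) (ck x) \<^bold>\<and>
              in_span C m (\<lambda>y. y \<^bold>\<in> B \<^bold>\<and> \<^bold>\<not> y \<^bold>= ck b) (ck x) \<^bold>\<longrightarrow> is_zero C m (ck x)) q"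
        using is0 by (rule fallD) (auto simp: qP)
      ultimately have "is_zero C m (ck x) q"
        using qP by (simp add: fimp_iff) (blast intro: fandI)
      then show ?thesis
        using qP by (simp add: is_zero_iff feq_check_iff)
    qed
    show ?thesis
      using 1 2 by blast
  qed
  show ?thesis
    by (rule that[of p1 D]) (use p1 mono Dc bas spanD in blast)+
qed

end

section \<open>Free abelian groups\<close>

text \<open>Abelian groups are treated as modules over the integers, so that subgroups are subspaces
  and freeness means being spanned by an independent set.\<close>

locale int_module = module scale
  for scale :: "int \<Rightarrow> 'b::ab_group_add \<Rightarrow> 'b" (infixr \<open>*z\<close> 75)
begin

lemma subspace_if_diff_closed:
  assumes "0 \<in> S" and diff: "\<And>x y. x \<in> S \<Longrightarrow> y \<in> S \<Longrightarrow> x - y \<in> S"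
  shows "subspace S"
proof (rule subspaceI)
  have neg: "- x \<in> S" if "x \<in> S" for x
    using diff[OF assms(1) that] by simp
  show add: "x + y \<in> S" if "x \<in> S" "y \<in> S" for x y
    using diff[OF that(1) neg[OF that(2)]] by simp
  have nat: "int n *z x \<in> S" if "x \<in> S" for x n
    by (induction n) (use assms(1) that in \<open>auto simp: scale_left_distrib intro: add\<close>)
  show "k *z x \<in> S" if "x \<in> S" for k x
  proof (cases k rule: int_cases)
    case (neg n)
    then show ?thesis
      using nat[OF that, of "Suc n"] \<open>\<And>x. x \<in> S \<Longrightarrow> - x \<in> S\<close> by (simp only: scale_minus_left)
  qed (use nat that in auto)
qed (rule assms(1))

text \<open>The basis element \<open>g b\<close> of the subgroup has the least possible leading coefficient among the
  elements of the subgroup with leading term \<open>b\<close>, with respect to a well-order of the basis.\<close>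

theorem subgroup_of_free:
  assumes Z: "independent Z" and H: "subspace H" "H \<subseteq> span Z"
  obtains B where "independent B" "span B = H"
proof -
  obtain r where r: "well_order_on Z r"
    using well_order_on by blast
  define lt where "lt x y \<longleftrightarrow> (x, y) \<in> r \<and> x \<noteq> y" for x y
  have wf: "wf {(x, y). lt x y}"
    using r unfolding well_order_on_def by (auto simp: lt_def elim!: wf_subset)
  have lt_trans: "lt x z" if "lt x y" "lt y z" for x y z
    using r that unfolding well_order_on_def linear_order_on_def partial_order_on_def preorder_on_def
      lt_def by (metis antisymD transD)
  have lt_total: "x = y \<or> lt x y \<or> lt y x" if "x \<in> Z" "y \<in> Z" for x y
    using r that unfolding well_order_on_def linear_order_on_def total_on_def lt_def by blast
  have irrefl: "\<not> lt x x" for x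
    by (simp add: lt_def)
  define c where "c = representation Z"
  have c_in: "b \<in> Z" if "c h b \<noteq> 0" for h b
    using representation_ne_zero that unfolding c_def by blast
  have c_fin: "finite {b. c h b \<noteq> 0}" for h
    unfolding c_def by (rule finite_representation)
  have c_zero: "h = 0" if "h \<in> H" "\<And>b. c h b = 0" for h
    using sum_nonzero_representation_eq[OF Z, of h] that H(2) unfolding c_def by auto
  have c_diff: "c (h - k *z g) b = c h b - k * c g b" if "h \<in> H" "g \<in> H" for h g k b
  proof -
    have "h \<in> span Z" "g \<in> span Z"
      using that H(2) by auto
    then show ?thesis
      unfolding c_def by (simp add: representation_diff[OF Z] representation_scale[OF Z] span_scale)
  qed
  have max: "\<exists>b\<in>S. \<forall>b'\<in>S. b' = b \<or> lt b' b" if "finite S" "S \<noteq> {}" "S \<subseteq> Z" for S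
    using that
  proof (induction S rule: finite_ne_induct)
    case (insert x F)
    then obtain b where b: "b \<in> F" "\<forall>b'\<in>F. b' = b \<or> lt b' b"
      by auto
    then consider "x = b" | "lt x b" | "lt b x"
      using lt_total insert.prems by blast
    then show ?case
    proof cases
      case 3
      then show ?thesis
        using b lt_trans[of _ b x] by (intro bexI[of _ x]) auto
    qed (use b in \<open>auto intro!: bexI[of _ b]\<close>)
  qed auto
  \<comment> \<open>\<open>L b h\<close> says that \<open>b\<close> is the leading term of
    \<open>h\<close>; \<open>S\<close> collects the leading terms that occur in
    \<open>H\<close>.\<close>
  define L where "L b h \<longleftrightarrow> h \<in> H \<and> c h b \<noteq> 0 \<and> (\<forall>b'. c h b' \<noteq> 0 \<longrightarrow> b' = b \<or> lt b' b)" for b h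
  define S where "S = {b. \<exists>h. L b h}"
  define g where "g b = (ARG_MIN (\<lambda>h. nat \<bar>c h b\<bar>) h. L b h)" for b
  have g: "L b (g b)" "\<And>h. L b h \<Longrightarrow> \<bar>c (g b) b\<bar> \<le> \<bar>c h b\<bar>" if b: "b \<in> S" for b
  proof -
    obtain h where "L b h"
      using b by (auto simp: S_def)
    then show "L b (g b)"
      unfolding g_def by (rule arg_min_natI)
    show "\<bar>c (g b) b\<bar> \<le> \<bar>c h b\<bar>" if "L b h" for h
      using arg_min_nat_le[of "L b" h "\<lambda>h. nat \<bar>c h b\<bar>", OF that] unfolding g_def by simp
  qed
  have gH: "g b \<in> H" if "b \<in> S" for b
    using g(1)[OF that] by (simp add: L_def)
  have inj: "inj_on g S"
  proof
    fix x y assume xy: "x \<in> S" "y \<in> S" "g x = g y"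
    then have "L x (g x)" "L y (g x)"
      using g(1) by metis+
    then show "x = y"
      unfolding L_def using lt_trans irrefl by metis
  qed
  \<comment> \<open>Division with remainder by the leading coefficient of \<open>g b\<close>:
    minimality forces the remainder to vanish, so the leading term drops.\<close>
  have reduce: "\<exists>k. \<forall>b'. c (h - k *z g b) b' \<noteq> 0 \<longrightarrow> lt b' b" if h: "L b h" for b h
  proof -
    have b: "b \<in> S"
      using h by (auto simp: S_def)
    let ?k = "c h b div c (g b) b"
    let ?h = "h - ?k *z g b"
    have hH: "h \<in> H" "?h \<in> H"
      using h gH[OF b] H(1) by (auto simp: L_def subspace_diff subspace_scale)
    have c': "c ?h b' = c h b' - ?k * c (g b) b'" for b'
      by (rule c_diff[OF hH(1) gH[OF b]])
    have le: "b' = b \<or> lt b' b" if "c ?h b' \<noteq> 0" for b'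
      using that h g(1)[OF b] unfolding c' L_def
      by (cases "c h b' = 0"; cases "c (g b) b' = 0") auto
    have "c ?h b = c h b mod c (g b) b"
      unfolding c' by (simp add: minus_div_mult_eq_mod)
    moreover have "c (g b) b \<noteq> 0"
      using g(1)[OF b] by (simp add: L_def)
    ultimately have "\<bar>c ?h b\<bar> < \<bar>c (g b) b\<bar>"
      by (simp add: abs_mod_less)
    then have "\<not> L b ?h"
      using g(2)[OF b] by fastforce
    then have "c ?h b = 0"
      using hH(2) le by (auto simp: L_def)
    then show ?thesis
      using le by metis
  qed
  have step: "h \<in> span (g ` S)"
    if h: "h \<in> H" and lower: "\<And>b1 h'. c h b1 \<noteq> 0 \<Longrightarrow> h' \<in> H \<Longrightarrow> (\<And>b'. c h' b' \<noteq> 0 \<Longrightarrow> lt b' b1) \<Longrightarrow>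
      h' \<in> span (g ` S)" for h
  proof (cases "{b. c h b \<noteq> 0} = {}")
    case True
    then show ?thesis
      using c_zero[OF h] span_zero by auto
  next
    case False
    then obtain b1 where b1: "c h b1 \<noteq> 0" "\<forall>b'. c h b' \<noteq> 0 \<longrightarrow> b' = b1 \<or> lt b' b1"
      using max[OF c_fin False] c_in by auto
    then have L: "L b1 h"
      using h by (simp add: L_def)
    then have b1S: "b1 \<in> S"
      by (auto simp: S_def)
    obtain k where k: "\<forall>b'. c (h - k *z g b1) b' \<noteq> 0 \<longrightarrow> lt b' b1"
      using reduce[OF L] by blast
    have "h - k *z g b1 \<in> H"
      using h gH[OF b1S] H(1) by (auto simp: subspace_diff subspace_scale)
    then have "h - k *z g b1 \<in> span (g ` S)"
      using lower[OF b1(1)] k by blast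
    moreover have "k *z g b1 \<in> span (g ` S)"
      using b1S by (intro span_scale span_base) auto
    ultimately show ?thesis
      using span_add by fastforce
  qed
  \<comment> \<open>The bound \<open>b\<close> on the terms of \<open>h\<close> makes the successive
    elimination of leading terms a well-founded induction.\<close>
  have below: "h \<in> span (g ` S)" if "h \<in> H" "\<And>b'. c h b' \<noteq> 0 \<Longrightarrow> lt b' b" for b h
    using that
  proof (induction b arbitrary: h rule: wf_induct_rule[OF wf])
    case (1 b)
    show ?case
      by (rule step[OF "1.prems"(1)]) (use "1.IH" "1.prems"(2) in blast)
  qed
  have "H \<subseteq> span (g ` S)"
    using step below by blast
  moreover have "span (g ` S) \<subseteq> H"
    using gH H(1) by (intro span_minimal) auto
  moreover have "independent (g ` S)"
    unfolding independent_explicit_module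
  proof (intro allI impI)
    fix t u v assume t: "finite t" "t \<subseteq> g ` S" and s: "(\<Sum>v\<in>t. u v *z v) = 0" and v: "v \<in> t"
    show "u v = 0"
    proof (rule ccontr)
      assume nz: "u v \<noteq> 0"
      \<comment> \<open>Distinct \<open>g b\<close> have distinct leading terms, so in a vanishing
        combination the coordinate at the greatest leading term in use comes from a single
        summand.\<close>
      define R where "R = {b \<in> S. g b \<in> t \<and> u (g b) \<noteq> 0}"
      have "g ` R \<subseteq> t" "inj_on g R"
        using inj by (auto simp: R_def inj_on_def)
      then have "finite R"
        using t(1) by (meson finite_imageD finite_subset)
      moreover have "R \<noteq> {}"
        using nz v t(2) by (auto simp: R_def)
      moreover have "R \<subseteq> Z"
        using g(1) c_in by (auto simp: R_def L_def)
      ultimately obtain b where b: "b \<in> R" "\<forall>b'\<in>R. b' = b \<or> lt b' b"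
        using max by blast
      have zero: "u (g b') * c (g b') b = 0" if "b' \<in> S" "g b' \<in> t" "b' \<noteq> b" for b'
      proof (cases "u (g b') = 0")
        case False
        then have "lt b' b"
          using b that by (auto simp: R_def)
        then have "c (g b') b = 0"
          using g(1)[OF that(1)] lt_trans irrefl unfolding L_def by metis
        then show ?thesis
          by simp
      qed simp
      have "c (\<Sum>v\<in>t. u v *z v) b = (\<Sum>v\<in>t. c (u v *z v) b)"
        unfolding c_def
        by (subst representation_sum[OF Z]) (use t(2) gH H(2) in \<open>auto intro!: span_scale\<close>)
      also have "\<dots> = (\<Sum>v\<in>t. u v * c v b)"
        unfolding c_def by (intro sum.cong refl, subst representation_scale[OF Z]) (use t(2) gH H(2) in auto)
      also have "\<dots> = (\<Sum>v\<in>{g b}. u v * c v b)"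
        by (rule sum.mono_neutral_right) (use t b zero in \<open>auto simp: R_def\<close>)
      finally have "u (g b) * c (g b) b = 0"
        using s by (simp add: c_def representation_zero)
      then show False
        using b(1) g(1) by (auto simp: R_def L_def)
    qed
  qed
  ultimately show ?thesis
    using that by blast
qed

lemma independent_Int_span:
  assumes B: "independent B" and b: "b \<in> B" and x: "x \<in> span {b}" "x \<in> span (B - {b})"
  shows "x = 0"
proof -
  have "representation B x = representation {b} x" "representation B x = representation (B - {b}) x"
    using representation_extend[OF B] x b by blast+
  then have "representation B x v = 0" for v
    using representation_ne_zero[of "{b}" x v] representation_ne_zero[of "B - {b}" x v] by force
  moreover have "x \<in> span B"
    using x(2) span_mono[of "B - {b}" B] by auto
  ultimately show ?thesis
    using sum_nonzero_representation_eq[OF B, of x] by simp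
qed

text \<open>Translates the notion of basis in the forced formula into independence: a relation puts
  \<open>u v *z v\<close> into both \<open>span {v}\<close> and the span of the other elements, and
  infinite order of \<open>v\<close> then gives \<open>u v = 0\<close>.\<close>

lemma independentI_Int_span:
  assumes tf: "\<And>b n. b \<in> B \<Longrightarrow> int (Suc n) *z b \<noteq> 0"
    and Int: "\<And>b x. b \<in> B \<Longrightarrow> x \<in> span {b} \<Longrightarrow> x \<in> span (B - {b}) \<Longrightarrow> x = 0"
  shows "independent B"
  unfolding independent_explicit_module
proof (intro allI impI)
  fix t u v assume t: "finite t" "t \<subseteq> B" and s: "(\<Sum>v\<in>t. u v *z v) = 0" and v: "v \<in> t"
  have "u v *z v = - (\<Sum>w\<in>t - {v}. u w *z w)"
    using s t(1) v by (simp add: sum.remove eq_neg_iff_add_eq_0)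
  moreover have "(\<Sum>w\<in>t - {v}. u w *z w) \<in> span (B - {v})"
    using t by (intro span_sum span_scale span_base) auto
  ultimately have "u v *z v \<in> span (B - {v})"
    by (simp add: span_neg)
  moreover have "u v *z v \<in> span {v}"
    by (intro span_scale span_base) simp
  ultimately have z: "u v *z v = 0"
    using Int v t by blast
  show "u v = 0"
  proof (rule ccontr)
    assume "u v \<noteq> 0"
    then have "\<bar>u v\<bar> = int (Suc (nat \<bar>u v\<bar> - 1))"
      by simp
    moreover have "\<bar>u v\<bar> *z v = 0"
      using z by (cases "u v \<ge> 0") auto
    ultimately show False
      using tf[of v "nat \<bar>u v\<bar> - 1"] v t by auto
  qed
qed

text \<open>A coefficient of \<open>y\<close> outside \<open>F\<close> would be divisible by all powers of 2.\<close>

lemma divisible_mod_span: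
  assumes F: "F \<subseteq> D" and y: "y \<in> span D"
    and div: "\<And>k. \<exists>D' z. D \<subseteq> D' \<and> independent D' \<and> z \<in> span D' \<and> y - 2 ^ k *z z \<in> span F"
  shows "y \<in> span F"
proof -
  have indD: "independent D"
    using div[of 0] independent_mono by blast
  let ?c = "representation D y"
  have "?c b = 0" if b: "b \<notin> F" for b
  proof -
    \<comment> \<open>With this exponent \<open>2 ^ k\<close> exceeds the absolute value of the
      coefficient, which is a multiple of \<open>2 ^ k\<close> and hence 0.\<close>
    define k where "k = nat \<bar>?c b\<bar>"
    obtain D' z where D': "D \<subseteq> D'" "independent D'" "z \<in> span D'" "y - 2 ^ k *z z \<in> span F"
      using div by blast
    have yD': "y \<in> span D'"
      using y span_mono[OF D'(1)] by blast
    \<comment> \<open>\<open>F\<close> lies in the independent set \<open>D'\<close>, so an element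
      of \<open>span F\<close> has no coordinate at \<open>b\<close> with respect to
      \<open>D'\<close>.\<close>
    have "representation D' (y - 2 ^ k *z z) = representation F (y - 2 ^ k *z z)"
      by (rule representation_extend[OF D'(2,4)]) (use F D'(1) in blast)
    then have "representation D' (y - 2 ^ k *z z) b = 0"
      using representation_ne_zero[of F "y - 2 ^ k *z z" b] b by metis
    then have "representation D' y b = 2 ^ k * representation D' z b"
      using representation_diff[OF D'(2) span_scale[OF D'(3)] yD'] representation_scale[OF D'(2,3)]
      by simp
    moreover have "representation D' y = ?c"
      by (rule representation_extend[OF D'(2) y D'(1)])
    ultimately have "2 ^ k dvd ?c b"
      by (metis dvd_triv_left)
    moreover have "\<bar>?c b\<bar> < 2 ^ k"
    proof -
      have "int k < 2 ^ k"
        by (simp flip: of_nat_less_iff add: of_nat_less_two_power)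
      then show ?thesis
        by (simp add: k_def)
    qed
    ultimately show ?thesis
      using dvd_imp_le_int[of "?c b" "2 ^ k"] by (cases "?c b = 0") auto
  qed
  then have "{b. ?c b \<noteq> 0} \<subseteq> F"
    by blast
  then have "(\<Sum>b | ?c b \<noteq> 0. ?c b *z b) \<in> span F"
    by (intro span_sum span_scale span_base) auto
  then show ?thesis
    using sum_nonzero_representation_eq[OF indD y] by simp
qed

text \<open>Every element of the span is the value of a finite list of coefficients and generators,
  and there are at most \<open>|K|\<close> such lists.\<close>

lemma card_of_span_le:
  fixes K :: "'c set"
  assumes K: "infinite K" and X: "|X| \<le>o |K|"
  shows "|span X| \<le>o |K|"
proof -
  let ?f = "\<lambda>l. \<Sum>(k, x)\<leftarrow>l. k *z x"
  have "span X \<subseteq> ?f ` lists (UNIV \<times> X)"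
  proof
    fix v assume "v \<in> span X"
    then show "v \<in> ?f ` lists (UNIV \<times> X)"
    proof (induction rule: span_induct_alt)
      case base
      show ?case
        by (rule image_eqI[of _ _ "[]"]) auto
    next
      case (step k x v)
      then obtain l where l: "l \<in> lists (UNIV \<times> X)" "v = ?f l"
        by blast
      show ?case
        by (rule image_eqI[of _ _ "(k, x) # l"]) (use l step in auto)
    qed
  qed
  then have "|span X| \<le>o |?f ` lists (UNIV \<times> X)|"
    by (rule card_of_mono1)
  also have "|?f ` lists (UNIV \<times> X)| \<le>o |lists ((UNIV :: int set) \<times> X)|"
    by (rule card_of_image)
  finally have "|span X| \<le>o |lists ((UNIV :: int set) \<times> X)|" .
  moreover have "|(UNIV :: int set)| \<le>o |K|"
  proof -
    obtain f :: "nat \<Rightarrow> 'c" where "inj f" "range f \<subseteq> K"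
      using infinite_countable_subset[OF K] by blast
    then have "inj_on (f \<circ> int_encode) UNIV" "(f \<circ> int_encode) ` UNIV \<subseteq> K"
      using inj_compose[OF _ inj_int_encode] by auto
    then show ?thesis
      using card_of_ordLeq by blast
  qed
  then have "|(UNIV :: int set) \<times> X| \<le>o |K|"
    by (rule card_of_Times_ordLeq_infinite[OF K _ X])
  then have "|lists ((UNIV :: int set) \<times> X)| \<le>o |K|"
    using ordLeq_ordIso_trans[OF card_of_lists_mono card_of_lists_infinite[OF K]] by blast
  ultimately show ?thesis
    by (rule ordLeq_transitive)
qed

end

section \<open>Groups attached to ladder systems\<close>

definition unit_vec :: "'i \<Rightarrow> 'i \<Rightarrow> rat" where
  "unit_vec i = (\<lambda>j. if j = i then 1 else 0)"

text \<open>The groups are additive subgroups of a rational vector space: \<open>qscale\<close>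
  provides the divisions that solve the ladder equations, \<open>zscale\<close> is the action of the
  integers whose spans are the subgroups.\<close>

definition zscale :: "int \<Rightarrow> ('i \<Rightarrow> rat) \<Rightarrow> 'i \<Rightarrow> rat" where
  "zscale k f = (\<lambda>j. of_int k * f j)"

definition qscale :: "rat \<Rightarrow> ('i \<Rightarrow> rat) \<Rightarrow> 'i \<Rightarrow> rat" where
  "qscale k f = (\<lambda>j. k * f j)"

interpretation Z: int_module "zscale :: int \<Rightarrow> ('i \<Rightarrow> rat) \<Rightarrow> 'i \<Rightarrow> rat"
  by unfold_locales (auto simp: zscale_def algebra_simps)

interpretation Q: vector_space "qscale :: rat \<Rightarrow> ('i \<Rightarrow> rat) \<Rightarrow> 'i \<Rightarrow> rat"
  by unfold_locales (auto simp: qscale_def algebra_simps)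

interpretation QQ: vector_space_pair
  "qscale :: rat \<Rightarrow> ('i \<Rightarrow> rat) \<Rightarrow> 'i \<Rightarrow> rat" "qscale :: rat \<Rightarrow> ('i \<Rightarrow> rat) \<Rightarrow> 'i \<Rightarrow> rat"
  by unfold_locales

lemma zscale_eq_qscale: "zscale k = qscale (of_int k)"
  by (simp add: zscale_def qscale_def fun_eq_iff)

lemma zscale_cancel: "k \<noteq> 0 \<Longrightarrow> zscale k f = zscale k g \<longleftrightarrow> f = g"
  by (auto simp: zscale_def fun_eq_iff)

lemma sum_apply: "(\<Sum>x\<in>A. F x) j = (\<Sum>x\<in>A. F x j)" for F :: "'a \<Rightarrow> 'i \<Rightarrow> rat"
  by (induction A rule: infinite_finite_induct) auto

lemma unit_vec_inject [simp]: "unit_vec i = unit_vec j \<longleftrightarrow> i = j"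
  by (auto simp: unit_vec_def fun_eq_iff split: if_splits)

lemma sum_unit_vec_apply:
  assumes "finite t" "v \<in> t" "\<And>w. w \<in> t \<Longrightarrow> w \<noteq> v \<Longrightarrow> F w j = 0"
  shows "(\<Sum>w\<in>t. qscale (u w) (F w)) j = u v * F v j"
  using assms by (simp add: sum_apply qscale_def sum.remove sum.neutral)

lemma independent_unit_vec: "Q.independent (range unit_vec)"
  unfolding Q.independent_explicit_module
proof (intro allI impI)
  fix t u v assume t: "finite t" "t \<subseteq> range unit_vec" and s: "(\<Sum>v\<in>t. qscale (u v) v) = 0" and v: "v \<in> t"
  obtain i where i: "v = unit_vec i"
    using t v by auto
  have "w i = 0" if w: "w \<in> t" "w \<noteq> v" for w
  proof -
    obtain j where "w = unit_vec j"
      using t w by auto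
    then show ?thesis
      using w i by (auto simp: unit_vec_def)
  qed
  then have "(\<Sum>v\<in>t. qscale (u v) v) i = u v * v i"
    by (rule sum_unit_vec_apply[OF t(1) v])
  then show "u v = 0"
    using s i by (simp add: unit_vec_def)
qed

text \<open>With \<open>e i = unit_vec (Inl i)\<close> this is the solution of \<open>y\<^sub>0 = unit_vec (Inr \<delta>)\<close> and
  \<open>2 y\<^sub>n\<^sub>+\<^sub>1 = y\<^sub>n - e (\<eta> \<delta> n)\<close>.\<close>

definition ladder_elt :: "('a \<Rightarrow> nat \<Rightarrow> 'a) \<Rightarrow> 'a \<Rightarrow> nat \<Rightarrow> 'a + 'a \<Rightarrow> rat" where
  "ladder_elt \<eta> \<delta> n =
     qscale (1 / 2 ^ n) (unit_vec (Inr \<delta>) - (\<Sum>i<n. zscale (2 ^ i) (unit_vec (Inl (\<eta> \<delta> i)))))"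

definition ladder_group :: "'a set \<Rightarrow> ('a \<Rightarrow> nat \<Rightarrow> 'a) \<Rightarrow> 'a set \<Rightarrow> ('a + 'a \<Rightarrow> rat) set" where
  "ladder_group A \<eta> S = Z.span (unit_vec ` Inl ` A \<union> {ladder_elt \<eta> \<delta> n | \<delta> n. \<delta> \<in> S})"

lemma ladder_elt_0: "ladder_elt \<eta> \<delta> 0 = unit_vec (Inr \<delta>)"
  by (simp add: ladder_elt_def)

lemma zscale_ladder_elt:
  "zscale (2 ^ n) (ladder_elt \<eta> \<delta> n) = unit_vec (Inr \<delta>) - (\<Sum>i<n. zscale (2 ^ i) (unit_vec (Inl (\<eta> \<delta> i))))"
  by (simp add: ladder_elt_def zscale_eq_qscale)

lemma zscale_ladder_elt_Suc:
  "zscale 2 (ladder_elt \<eta> \<delta> (Suc n)) = ladder_elt \<eta> \<delta> n - unit_vec (Inl (\<eta> \<delta> n))"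
proof -
  have "zscale (2 ^ n) (zscale 2 (ladder_elt \<eta> \<delta> (Suc n))) = zscale (2 ^ Suc n) (ladder_elt \<eta> \<delta> (Suc n))"
    by (simp add: mult.commute)
  also have "\<dots> = zscale (2 ^ n) (ladder_elt \<eta> \<delta> n - unit_vec (Inl (\<eta> \<delta> n)))"
    by (simp add: zscale_ladder_elt Z.scale_right_diff_distrib algebra_simps del: power_Suc)
  finally show ?thesis
    by (rule zscale_cancel[THEN iffD1, rotated]) simp
qed

text \<open>A basis is indexed by all \<open>Inl \<nu>\<close> and all \<open>Inr \<delta>\<close>: the index \<open>Inl (\<eta> \<delta> n)\<close> of a tail element
  stands for \<open>y\<^sub>n\<^sub>+\<^sub>1\<close>, the index \<open>Inr \<delta>\<close> for the first element \<open>y\<^sub>f\<^sub>\<delta>\<close> of the tail.\<close>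

lemma ladder_group_subset_free:
  fixes \<eta> :: "'a \<Rightarrow> nat \<Rightarrow> 'a"
  assumes disj: "\<And>\<delta> \<delta>' m n. \<delta> \<in> S \<Longrightarrow> \<delta>' \<in> S \<Longrightarrow> f \<delta> \<le> m \<Longrightarrow> f \<delta>' \<le> n \<Longrightarrow> \<eta> \<delta> m = \<eta> \<delta>' n \<Longrightarrow> \<delta> = \<delta>' \<and> m = n"
  obtains B where "Z.independent B" "ladder_group A \<eta> S \<subseteq> Z.span B"
proof -
  let ?y = "ladder_elt \<eta>"
  \<comment> \<open>Disjointness of the tails makes ladder and position of a tail element
    \<open>\<nu>\<close> unique, so both can be recovered from it.\<close>
  define pos where "pos \<nu> = (SOME p. fst p \<in> S \<and> f (fst p) \<le> snd p \<and> \<nu> = \<eta> (fst p) (snd p))" for \<nu>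
  define tail where "tail \<nu> \<longleftrightarrow> (\<exists>\<delta> n. \<delta> \<in> S \<and> f \<delta> \<le> n \<and> \<nu> = \<eta> \<delta> n)" for \<nu>
  have pos: "pos (\<eta> \<delta> n) = (\<delta>, n)" if "\<delta> \<in> S" "f \<delta> \<le> n" for \<delta> n
  proof -
    have "fst (pos (\<eta> \<delta> n)) \<in> S \<and> f (fst (pos (\<eta> \<delta> n))) \<le> snd (pos (\<eta> \<delta> n)) \<and>
        \<eta> \<delta> n = \<eta> (fst (pos (\<eta> \<delta> n))) (snd (pos (\<eta> \<delta> n)))"
      unfolding pos_def by (rule someI[of _ "(\<delta>, n)"]) (simp add: that)
    then show ?thesis
      using disj[of \<delta> "fst (pos (\<eta> \<delta> n))" n "snd (pos (\<eta> \<delta> n))"] that by (simp add: prod_eq_iff)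
  qed
  \<comment> \<open>The place of \<open>y\<^sub>n\<close> in the basis, for \<open>n\<close> from
    \<open>f \<delta>\<close> on; the shift by one arises since the basis element at
    \<open>Inl (\<eta> \<delta> n)\<close> is \<open>y\<^sub>n\<^sub>+\<^sub>1\<close>.\<close>
  define idx where "idx \<delta> n = (if n = f \<delta> then Inr \<delta> else Inl (\<eta> \<delta> (n - 1)))" for \<delta> n
  \<comment> \<open>The value imposed on \<open>e \<nu>\<close> by \<open>e (\<eta> \<delta> n) =
    y\<^sub>n - 2 y\<^sub>n\<^sub>+\<^sub>1\<close> if each element of a tail is to be sent to its
    own unit vector.\<close>
  define te where "te \<nu> = (if tail \<nu> then unit_vec (idx (fst (pos \<nu>)) (snd (pos \<nu>))) -
      zscale 2 (unit_vec (idx (fst (pos \<nu>)) (Suc (snd (pos \<nu>))))) else unit_vec (Inl \<nu>))" for \<nu>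
  have te_tail: "te (\<eta> \<delta> n) = unit_vec (idx \<delta> n) - zscale 2 (unit_vec (idx \<delta> (Suc n)))"
    if "\<delta> \<in> S" "f \<delta> \<le> n" for \<delta> n
    using that pos[OF that] by (auto simp: te_def tail_def)
  \<comment> \<open>On \<open>Inr \<delta>\<close> the value comes from solving the ladder equations
    for \<open>y\<^sub>0\<close> in terms of \<open>y\<^sub>f\<^sub>\<delta>\<close> and the
    \<open>e (\<eta> \<delta> i)\<close> with \<open>i < f \<delta>\<close>.\<close>
  define t where "t = case_sum te
    (\<lambda>\<delta>. zscale (2 ^ f \<delta>) (unit_vec (idx \<delta> (f \<delta>))) + (\<Sum>i<f \<delta>. zscale (2 ^ i) (te (\<eta> \<delta> i))))"
  \<comment> \<open>The rational linear map \<open>T\<close> is to carry the intended basis to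
    distinct unit vectors, which proves its independence; values on the unit vectors may be
    prescribed freely.\<close>
  obtain T where T: "Vector_Spaces.linear qscale qscale T" "\<And>i. T (unit_vec i) = t i"
  proof -
    obtain T where "Vector_Spaces.linear qscale qscale T"
      "\<forall>v\<in>range unit_vec. T v = t (inv_into UNIV unit_vec v)"
      using QQ.linear_independent_extend[OF independent_unit_vec, of "\<lambda>v. t (inv_into UNIV unit_vec v)"]
      by blast
    moreover have "inj (unit_vec :: 'a + 'a \<Rightarrow> _)"
      by (rule injI) simp
    ultimately show ?thesis
      using that[of T] by auto
  qed
  interpret T: Vector_Spaces.linear qscale qscale T
    by (rule T(1))
  have Tz: "T (zscale k x) = zscale k (T x)" for k x
    unfolding zscale_eq_qscale by (rule T.scale)
  have T_ladder: "T (?y \<delta> n) = unit_vec (idx \<delta> n)" if \<delta>: "\<delta> \<in> S" and n: "f \<delta> \<le> n" for \<delta> n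
    using n
  proof (induction n rule: dec_induct)
    case base
    have "zscale (2 ^ f \<delta>) (T (?y \<delta> (f \<delta>))) = zscale (2 ^ f \<delta>) (unit_vec (idx \<delta> (f \<delta>)))"
      unfolding Tz[symmetric] zscale_ladder_elt by (simp add: T.diff T.sum Tz T(2) t_def)
    then show ?case
      by (simp add: zscale_cancel)
  next
    case (step n)
    have "zscale 2 (T (?y \<delta> (Suc n))) = zscale 2 (unit_vec (idx \<delta> (Suc n)))"
      unfolding Tz[symmetric] zscale_ladder_elt_Suc
      using step te_tail[OF \<delta>] by (simp add: T.diff T(2) t_def)
    then show ?case
      by (simp add: zscale_cancel)
  qed
  define J :: "('a + 'a) set" where "J = range Inl \<union> Inr ` S"
  define b where "b = case_sum
    (\<lambda>\<nu>. if tail \<nu> then ?y (fst (pos \<nu>)) (Suc (snd (pos \<nu>))) else unit_vec (Inl \<nu>)) (\<lambda>\<delta>. ?y \<delta> (f \<delta>))"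
  have b_tail: "b (Inl (\<eta> \<delta> n)) = ?y \<delta> (Suc n)" if "\<delta> \<in> S" "f \<delta> \<le> n" for \<delta> n
    using that pos[OF that] by (auto simp: b_def tail_def)
  have Tb: "T (b j) = unit_vec j" if j: "j \<in> J" for j
  proof (cases j)
    case (Inl \<nu>)
    show ?thesis
    proof (cases "tail \<nu>")
      case True
      then obtain \<delta> n where d: "\<delta> \<in> S" "f \<delta> \<le> n" "\<nu> = \<eta> \<delta> n"
        by (auto simp: tail_def)
      then show ?thesis
        using T_ladder[of \<delta> "Suc n"] by (simp add: Inl b_tail idx_def)
    next
      case False
      then show ?thesis
        by (simp add: Inl b_def T(2) t_def te_def)
    qed
  next
    case (Inr \<delta>)
    then show ?thesis
      using j T_ladder[of \<delta> "f \<delta>"] by (auto simp: b_def idx_def J_def)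
  qed
  have indep: "Z.independent (b ` J)"
    unfolding Z.independent_explicit_module
  proof (intro allI impI)
    fix s u v assume s: "finite s" "s \<subseteq> b ` J" and eq: "(\<Sum>v\<in>s. zscale (u v) v) = 0" and v: "v \<in> s"
    obtain j where j: "j \<in> J" "v = b j"
      using s v by auto
    have "T w j = 0" if w: "w \<in> s" "w \<noteq> v" for w
    proof -
      obtain i where "i \<in> J" "w = b i"
        using s w by auto
      then show ?thesis
        using w j Tb by (auto simp: unit_vec_def)
    qed
    then have "(\<Sum>v\<in>s. qscale (of_int (u v)) (T v)) j = of_int (u v) * T v j"
      by (rule sum_unit_vec_apply[OF s(1) v])
    moreover have "(\<Sum>v\<in>s. qscale (of_int (u v)) (T v)) = T (\<Sum>v\<in>s. zscale (u v) v)"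
      by (simp add: T.sum T.scale zscale_eq_qscale)
    moreover have "T 0 = 0"
      by (rule T.zero)
    ultimately show "u v = 0"
      using eq Tb[OF j(1)] j by (simp add: unit_vec_def)
  qed
  have y_ge: "?y \<delta> n \<in> Z.span (b ` J)" if \<delta>: "\<delta> \<in> S" "f \<delta> \<le> n" for \<delta> n
  proof (cases "n = f \<delta>")
    case True
    then have "?y \<delta> n = b (Inr \<delta>)"
      by (simp add: b_def)
    then show ?thesis
      using \<delta> by (auto simp: J_def intro: Z.span_base)
  next
    case False
    then obtain k where "n = Suc k" "f \<delta> \<le> k"
      using \<delta> by (cases n) auto
    then have "?y \<delta> n = b (Inl (\<eta> \<delta> k))"
      using b_tail \<delta> by simp
    then show ?thesis
      by (auto simp: J_def intro: Z.span_base)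
  qed
  have e: "unit_vec (Inl \<nu>) \<in> Z.span (b ` J)" for \<nu>
  proof (cases "tail \<nu>")
    case True
    then obtain \<delta> n where d: "\<delta> \<in> S" "f \<delta> \<le> n" "\<nu> = \<eta> \<delta> n"
      by (auto simp: tail_def)
    have "unit_vec (Inl \<nu>) = ?y \<delta> n - zscale 2 (?y \<delta> (Suc n))"
      by (simp add: zscale_ladder_elt_Suc d)
    then show ?thesis
      using y_ge[of \<delta> n] y_ge[of \<delta> "Suc n"] d by (auto intro: Z.span_diff Z.span_scale)
  next
    case False
    then have "unit_vec (Inl \<nu>) = b (Inl \<nu>)"
      by (simp add: b_def)
    then show ?thesis
      by (auto simp: J_def intro: Z.span_base)
  qed
  \<comment> \<open>Elements before the tail are recovered downwards from
    \<open>y\<^sub>f\<^sub>\<delta>\<close>, since \<open>y\<^sub>n = 2 y\<^sub>n\<^sub>+\<^sub>1 +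
    e (\<eta> \<delta> n)\<close>.\<close>
  have y: "?y \<delta> n \<in> Z.span (b ` J)" if \<delta>: "\<delta> \<in> S" for \<delta> n
  proof (cases "f \<delta> \<le> n")
    case False
    then have "n \<le> f \<delta>"
      by simp
    then show ?thesis
    proof (induction n rule: inc_induct)
      case (step n)
      have *: "?y \<delta> n = zscale 2 (?y \<delta> (Suc n)) + unit_vec (Inl (\<eta> \<delta> n))"
        by (simp add: zscale_ladder_elt_Suc)
      show ?case
        unfolding * by (intro Z.span_add Z.span_scale step.IH e)
    qed (use y_ge \<delta> in auto)
  qed (use y_ge \<delta> in auto)
  \<comment> \<open>The span may be larger than the group, as \<open>J\<close> contains every
    \<open>Inl \<nu>\<close>; \<open>subgroup_of_free\<close> later passes to the subgroup actually
    wanted.\<close>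
  have "ladder_group A \<eta> S \<subseteq> Z.span (b ` J)"
    unfolding ladder_group_def by (intro Z.span_minimal) (use e y in auto)
  then show ?thesis
    using that indep by blast
qed

section \<open>Copies of abelian groups inside the universe of sets\<close>

definition coded_group :: "'b::ab_group_add set \<Rightarrow> ('b \<Rightarrow> 'v) \<Rightarrow> 'v monoid" where
  "coded_group A g =
     \<lparr>carrier = g ` A, mult = (\<lambda>x y. g (inv_into A g x + inv_into A g y)), one = g 0\<rparr>"

text \<open>The groups of the theorem have their carriers in the universe, so a module
  \<open>A\<close> is transported along an injection \<open>g\<close>; powers and generated
  subgroups are then translated into module language.\<close>

locale coded_subgroup = int_module scale
  for scale :: "int \<Rightarrow> 'b::ab_group_add \<Rightarrow> 'b" (infixr \<open>*z\<close> 75) +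
  fixes A :: "'b set" and g :: "'b \<Rightarrow> 'v"
  assumes subspace: "subspace A" and inj: "inj_on g A"
begin

abbreviation "G \<equiv> coded_group A g"

lemma coded_carrier [simp]: "carrier G = g ` A"
  by (simp add: coded_group_def)

lemma coded_one [simp]: "\<one>\<^bsub>G\<^esub> = g 0"
  by (simp add: coded_group_def)

lemma coded_mult [simp]: "x \<in> A \<Longrightarrow> y \<in> A \<Longrightarrow> g x \<otimes>\<^bsub>G\<^esub> g y = g (x + y)"
  using inj by (simp add: coded_group_def)

lemma closed: "0 \<in> A" "x \<in> A \<Longrightarrow> y \<in> A \<Longrightarrow> x + y \<in> A" "x \<in> A \<Longrightarrow> - x \<in> A" "x \<in> A \<Longrightarrow> k *z x \<in> A"
  using subspace by (auto simp: subspace_0 subspace_add subspace_neg subspace_scale)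

sublocale coded: comm_group G
proof (rule comm_groupI)
  fix x assume "x \<in> carrier G"
  then obtain a where "a \<in> A" "x = g a"
    by auto
  then show "\<exists>y\<in>carrier G. y \<otimes>\<^bsub>G\<^esub> x = \<one>\<^bsub>G\<^esub>"
    using closed by (intro bexI[of _ "g (- a)"]) auto
qed (use closed in \<open>auto simp: ac_simps\<close>)

lemma coded_eq_iff: "x \<in> A \<Longrightarrow> y \<in> A \<Longrightarrow> g x = g y \<longleftrightarrow> x = y"
  using inj by (auto dest: inj_onD)

lemma coded_inv: "x \<in> A \<Longrightarrow> inv\<^bsub>G\<^esub> g x = g (- x)"
  by (rule coded.inv_equality) (use closed in auto)

lemma coded_pow: "x \<in> A \<Longrightarrow> g x [^]\<^bsub>G\<^esub> (n :: nat) = g (int n *z x)"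
  by (induction n) (use closed in \<open>auto simp: scale_left_distrib ac_simps\<close>)

lemma span_subset: "X \<subseteq> A \<Longrightarrow> span X \<subseteq> A"
  by (rule span_minimal[OF _ subspace])

lemma coded_generate:
  assumes X: "X \<subseteq> A"
  shows "generate G (g ` X) = g ` span X"
proof (intro equalityI subsetI)
  fix z assume "z \<in> generate G (g ` X)"
  then show "z \<in> g ` span X"
  proof (induction rule: generate.induct)
    case one
    show ?case
      using span_zero by auto
  next
    case (incl h)
    then show ?case
      using span_base by auto
  next
    case (inv h)
    then obtain x where "x \<in> X" "h = g x"
      by blast
    then have "inv\<^bsub>G\<^esub> h = g (- x)"
      using X coded_inv[of x] by auto
    then show ?case
      using span_neg[OF span_base[OF \<open>x \<in> X\<close>]] by simp
  next
    case (eng h1 h2)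
    then obtain x y where "x \<in> span X" "y \<in> span X" "h1 = g x" "h2 = g y"
      by blast
    moreover from this have "x \<in> A" "y \<in> A"
      using span_subset[OF X] by auto
    ultimately show ?case
      by (simp add: span_add)
  qed
next
  have sub: "subgroup (generate G (g ` X)) G"
    by (rule coded.generate_is_subgroup) (use X in auto)
  have "subspace {x \<in> A. g x \<in> generate G (g ` X)}"
  proof (rule subspace_if_diff_closed)
    show "0 \<in> {x \<in> A. g x \<in> generate G (g ` X)}"
      using subgroup.one_closed[OF sub] closed by auto
  next
    fix x y assume "x \<in> {x \<in> A. g x \<in> generate G (g ` X)}" "y \<in> {x \<in> A. g x \<in> generate G (g ` X)}"
    then have xy: "x \<in> A" "y \<in> A" "g x \<in> generate G (g ` X)" "g y \<in> generate G (g ` X)"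
      by auto
    then have "g x \<otimes>\<^bsub>G\<^esub> inv\<^bsub>G\<^esub> g y \<in> generate G (g ` X)"
      using subgroup.m_closed[OF sub] subgroup.m_inv_closed[OF sub] by blast
    then show "x - y \<in> {x \<in> A. g x \<in> generate G (g ` X)}"
      using xy closed subspace_diff[OF subspace] by (simp add: coded_inv)
  qed
  then have "span X \<subseteq> {x \<in> A. g x \<in> generate G (g ` X)}"
    by (intro span_minimal) (use X in \<open>auto intro: generate.incl\<close>)
  then show "z \<in> generate G (g ` X)" if "z \<in> g ` span X" for z
    using that by auto
qed

lemma coded_free_basis:
  assumes B: "independent B" "span B = A"
  shows "coded.free_basis (g ` B)"
proof -
  have BA: "B \<subseteq> A"
    using B span_superset by blast
  have "g b [^]\<^bsub>G\<^esub> Suc n \<noteq> \<one>\<^bsub>G\<^esub>" if b: "b \<in> B" for b n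
  proof
    assume one: "g b [^]\<^bsub>G\<^esub> Suc n = \<one>\<^bsub>G\<^esub>"
    have bA: "b \<in> A"
      using b BA by blast
    have "g (int (Suc n) *z b) = g 0"
      using one unfolding coded_pow[OF bA] coded_one .
    then have "int (Suc n) *z b = 0"
      by (rule coded_eq_iff[OF closed(4)[OF bA] closed(1), THEN iffD1])
    then have "(\<Sum>v\<in>{b}. int (Suc n) *z v) = 0"
      by (simp only: sum.insert sum.empty finite.emptyI empty_iff simp_thms add_0_right)
    then have "int (Suc n) = 0"
      by (rule independentD[OF B(1), rotated 2]) (use b in auto)
    then show False
      by simp
  qed
  moreover have "generate G {g b} \<inter> generate G (g ` B - {g b}) \<subseteq> {\<one>\<^bsub>G\<^esub>}" if b: "b \<in> B" for b
  proof -
    have img: "g ` B - {g b} = g ` (B - {b})"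
      using inj_on_image_set_diff[OF inj, of B "{b}"] b BA by auto
    have 2: "generate G (g ` B - {g b}) = g ` span (B - {b})"
      unfolding img by (rule coded_generate) (use BA in blast)
    have 1: "generate G {g b} = g ` span {b}"
      using coded_generate[of "{b}"] BA b by auto
    show ?thesis
    proof
      fix z assume "z \<in> generate G {g b} \<inter> generate G (g ` B - {g b})"
      then obtain x y where xy: "x \<in> span {b}" "y \<in> span (B - {b})" "z = g x" "z = g y"
        unfolding 1 2 by blast
      moreover have "x \<in> A" "y \<in> A"
        using xy span_subset[of "{b}"] span_subset[of "B - {b}"] b BA by auto
      ultimately have "x = y"
        using coded_eq_iff by metis
      then show "z \<in> {\<one>\<^bsub>G\<^esub>}"
        using independent_Int_span[OF B(1) b, of y] xy by simp
    qed
  qed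
  moreover have "generate G (g ` B) = carrier G"
    using coded_generate[OF BA] B by simp
  ultimately show ?thesis
    unfolding coded.free_basis_def using BA by (auto simp del: nat_pow_Suc)
qed

lemma independent_decoded:
  assumes D: "D \<subseteq> carrier G"
    and inf: "\<And>b n. b \<in> D \<Longrightarrow> b [^]\<^bsub>G\<^esub> Suc n \<noteq> \<one>\<^bsub>G\<^esub>"
    and Int: "\<And>b. b \<in> D \<Longrightarrow> generate G {b} \<inter> generate G (D - {b}) \<subseteq> {\<one>\<^bsub>G\<^esub>}"
  shows "independent {x \<in> A. g x \<in> D}"
proof (rule independentI_Int_span)
  fix b n assume b: "b \<in> {x \<in> A. g x \<in> D}"
  show "int (Suc n) *z b \<noteq> 0"
  proof
    assume "int (Suc n) *z b = 0"
    moreover have "b \<in> A" "g b \<in> D"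
      using b by auto
    ultimately have "g b [^]\<^bsub>G\<^esub> Suc n = \<one>\<^bsub>G\<^esub>"
      unfolding coded_pow[OF \<open>b \<in> A\<close>] coded_one by (simp only:)
    then show False
      using inf[OF \<open>g b \<in> D\<close>] by blast
  qed
next
  fix b x assume b: "b \<in> {x \<in> A. g x \<in> D}" and x: "x \<in> span {b}" "x \<in> span ({x \<in> A. g x \<in> D} - {b})"
  have "D - {g b} = g ` {x \<in> A. g x \<in> D} - g ` {b}"
    using D by auto
  also have "\<dots> = g ` ({x \<in> A. g x \<in> D} - {b})"
    by (rule inj_on_image_set_diff[OF inj, symmetric]) (use b in auto)
  finally have img: "D - {g b} = g ` ({x \<in> A. g x \<in> D} - {b})" .
  have "generate G (D - {g b}) = g ` span ({x \<in> A. g x \<in> D} - {b})"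
    unfolding img by (rule coded_generate) auto
  moreover have "generate G {g b} = g ` span {b}"
    using coded_generate[of "{b}"] b by auto
  ultimately have "g x = g 0"
    using Int[of "g b"] b x by auto
  moreover have "x \<in> A"
    using x span_subset[of "{b}"] b by auto
  ultimately show "x = 0"
    using coded_eq_iff closed by blast
qed

end

section \<open>Ordinals and square\<close>

lemma elts_irrefl: "x \<notin> elts x"
  using foundation wf_not_refl by fastforce

lemma elts_asym: "x \<in> elts y \<Longrightarrow> y \<notin> elts x"
  using foundation wf_not_sym by fastforce

lemma ordinal_elt: "ordinal \<alpha> \<Longrightarrow> \<beta> \<in> elts \<alpha> \<Longrightarrow> ordinal \<beta>"
  unfolding ordinal_def transitive_set_def by blast

lemma ordinal_trans: "ordinal \<gamma> \<Longrightarrow> \<alpha> \<in> elts \<beta> \<Longrightarrow> \<beta> \<in> elts \<gamma> \<Longrightarrow> \<alpha> \<in> elts \<gamma>"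
  unfolding ordinal_def transitive_set_def by blast

lemma ordinal_linear: "ordinal \<alpha> \<Longrightarrow> ordinal \<beta> \<Longrightarrow> \<alpha> \<in> elts \<beta> \<or> \<alpha> = \<beta> \<or> \<beta> \<in> elts \<alpha>"
proof (induction \<alpha> arbitrary: \<beta> rule: wf_induct_rule[OF foundation])
  case (1 \<alpha>)
  note IH\<alpha> = this
  show ?case
    using \<open>ordinal \<beta>\<close>
  proof (induction \<beta> rule: wf_induct_rule[OF foundation])
    case (1 \<beta>)
    show ?case
    proof (rule ccontr)
      assume n: "\<not> (\<alpha> \<in> elts \<beta> \<or> \<alpha> = \<beta> \<or> \<beta> \<in> elts \<alpha>)"
      have "x \<in> elts \<beta>" if x: "x \<in> elts \<alpha>" for x
      proof -
        have "x \<in> elts \<beta> \<or> x = \<beta> \<or> \<beta> \<in> elts x"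
          using IH\<alpha>(1)[of x \<beta>] IH\<alpha>(2) x 1(2) ordinal_elt by auto
        then show ?thesis
          using n x ordinal_trans[OF IH\<alpha>(2)] by blast
      qed
      moreover have "x \<in> elts \<alpha>" if x: "x \<in> elts \<beta>" for x
      proof -
        have "\<alpha> \<in> elts x \<or> \<alpha> = x \<or> x \<in> elts \<alpha>"
          using 1(1)[of x] 1(2) x ordinal_elt by auto
        then show ?thesis
          using n x ordinal_trans[OF 1(2)] by blast
      qed
      ultimately have "elts \<alpha> = elts \<beta>"
        by blast
      then show False
        using n by simp
    qed
  qed
qed

lemma ordinal_subset: "ordinal \<alpha> \<Longrightarrow> ordinal \<beta> \<Longrightarrow> elts \<alpha> \<subseteq> elts \<beta> \<Longrightarrow> \<alpha> = \<beta> \<or> \<alpha> \<in> elts \<beta>"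
  using ordinal_linear elts_irrefl by blast

lemma ordinal_elt_subset: "ordinal \<beta> \<Longrightarrow> \<alpha> \<in> elts \<beta> \<Longrightarrow> elts \<alpha> \<subseteq> elts \<beta>"
  using ordinal_trans by blast

definition osucc :: "'v::zfc_universe \<Rightarrow> 'v" where
  "osucc \<alpha> = vset (insert \<alpha> (elts \<alpha>))"

lemma elts_osucc [simp]: "elts (osucc \<alpha>) = insert \<alpha> (elts \<alpha>)"
  by (simp add: osucc_def elts_vset small_insert)

lemma ordinal_osucc: "ordinal \<alpha> \<Longrightarrow> ordinal (osucc \<alpha>)"
  unfolding ordinal_def transitive_set_def by auto

lemma ordinal_Union:
  assumes "small U" "\<And>x. x \<in> U \<Longrightarrow> ordinal x" "\<And>x. x \<in> U \<Longrightarrow> elts x \<subseteq> U"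
  shows "ordinal (vset U)"
  using assms unfolding ordinal_def transitive_set_def by (auto simp: elts_vset)

lemma ord_rel_Restr: "Restr (ord_rel X) Y = ord_rel (X \<inter> Y)"
  by (auto simp: ord_rel_def)

lemma Field_ord_rel [simp]: "Field (ord_rel X) = X"
  by (auto simp: ord_rel_def Field_def)

lemma underS_ord_rel: "a \<in> X \<Longrightarrow> underS (ord_rel X) a = X \<inter> elts a"
  using elts_irrefl by (auto simp: ord_rel_def underS_def)

lemma Well_order_ord_rel:
  assumes X: "\<And>x. x \<in> X \<Longrightarrow> ordinal x"
  shows "Well_order (ord_rel X)"
  unfolding well_order_on_def linear_order_on_def partial_order_on_def preorder_on_def Field_ord_rel
proof (intro conjI)
  show "ord_rel X \<subseteq> X \<times> X" "refl_on X (ord_rel X)"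
    by (auto simp: ord_rel_def refl_on_def)
  show "trans (ord_rel X)"
    using X ordinal_trans by (auto simp: ord_rel_def trans_def)
  show "antisym (ord_rel X)"
    using elts_asym by (auto simp: ord_rel_def antisym_def)
  show "total_on X (ord_rel X)"
    using X ordinal_linear by (fastforce simp: ord_rel_def total_on_def)
  show "wf (ord_rel X - Id)"
    by (rule wf_subset[OF foundation]) (auto simp: ord_rel_def)
qed

lemma ord_rel_initial_segment:
  assumes X: "\<And>x. x \<in> X \<Longrightarrow> ordinal x" and a: "a \<in> X"
  shows "ord_rel (X \<inter> elts a) <o ord_rel X"
proof -
  have "Well_order (ord_rel X)"
    by (rule Well_order_ord_rel) (rule X)
  then have "Restr (ord_rel X) (underS (ord_rel X) a) <o ord_rel X"
    by (rule underS_Restr_ordLess) (use a in auto)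
  then show ?thesis
    by (simp add: underS_ord_rel[OF a] ord_rel_Restr)
qed

text \<open>Provides the index \<open>\<theta>\<close> for the order type of a
  \<open>C \<delta>\<close>. The indices form the set \<open>osucc \<kappa>\<close>, as the type
  \<kappa> itself may occur.\<close>

lemma ord_rel_ordLeq_ordinal:
  assumes k: "ordinal \<kappa>" and le: "ord_rel X \<le>o ord_rel (elts \<kappa>)"
  shows "\<exists>\<theta>\<in>elts (osucc \<kappa>). ord_rel X =o ord_rel (elts \<theta>)"
proof -
  consider "ord_rel X =o ord_rel (elts \<kappa>)" | "ord_rel X <o ord_rel (elts \<kappa>)"
    using le ordLeq_iff_ordLess_or_ordIso by blast
  then show ?thesis
  proof cases
    case 2
    moreover have "Well_order (ord_rel X)" "Well_order (ord_rel (elts \<kappa>))"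
      using 2 unfolding ordLess_def by auto
    ultimately obtain a where "a \<in> elts \<kappa>" "ord_rel X =o Restr (ord_rel (elts \<kappa>)) (underS (ord_rel (elts \<kappa>)) a)"
      using ordLess_iff_ordIso_Restr[of "ord_rel (elts \<kappa>)" "ord_rel X"] by auto
    moreover have "elts \<kappa> \<inter> elts a = elts a"
      using ordinal_elt_subset[OF k \<open>a \<in> elts \<kappa>\<close>] by blast
    ultimately show ?thesis
      by (auto simp: underS_ord_rel ord_rel_Restr)
  qed auto
qed

section \<open>Ladders as witnesses of cofinality omega\<close>

definition ladder :: "'v::zfc_universe \<Rightarrow> (nat \<Rightarrow> 'v) \<Rightarrow> bool" where
  "ladder \<delta> h \<longleftrightarrow> (\<forall>n. h n \<in> elts \<delta> \<and> h n \<in> elts (h (Suc n))) \<and> (\<forall>\<beta>\<in>elts \<delta>. \<exists>n. \<beta> \<in> elts (h n))"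

lemma ladder_less:
  assumes "ladder \<delta> h" "ordinal \<delta>" "m < n"
  shows "h m \<in> elts (h n)"
  using assms(3)
proof (induction n rule: less_Suc_induct)
  case (1 i)
  then show ?case
    using assms by (simp add: ladder_def)
next
  case (2 i j k)
  then show ?case
    using assms ordinal_trans ordinal_elt unfolding ladder_def by blast
qed

lemma ladder_inject: "ladder \<delta> h \<Longrightarrow> ordinal \<delta> \<Longrightarrow> h m = h n \<longleftrightarrow> m = n"
  using ladder_less[of \<delta> h m n] ladder_less[of \<delta> h n m] elts_irrefl by (metis linorder_neqE_nat)

lemma ladder_eventually:
  assumes h: "ladder \<delta> h" "ordinal \<delta>" and b: "\<beta> \<in> elts \<delta>"
  obtains N where "\<And>n. N \<le> n \<Longrightarrow> \<beta> \<in> elts (h n)"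
proof -
  obtain N where N: "\<beta> \<in> elts (h N)"
    using h b unfolding ladder_def by blast
  have "\<beta> \<in> elts (h n)" if "N \<le> n" for n
  proof (cases "N = n")
    case False
    then have "h N \<in> elts (h n)"
      using ladder_less[OF h] that by simp
    moreover have "ordinal (h n)"
      using h ordinal_elt unfolding ladder_def by blast
    ultimately show ?thesis
      using N ordinal_trans by blast
  qed (use N in simp)
  then show ?thesis
    using that by blast
qed

section \<open>Regularity and closure points of a successor cardinal\<close>

locale successor_of_infinite =
  fixes \<kappa> \<mu> :: "'v::zfc_universe"
  assumes kappa: "infinite_cardinal \<kappa>" and mu: "successor_cardinal \<kappa> \<mu>"
begin

lemma ordinal_kappa: "ordinal \<kappa>" and infinite_kappa: "infinite (elts \<kappa>)"
  using kappa by (auto simp: infinite_cardinal_def cardinal_def)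

lemma ordinal_mu: "ordinal \<mu>" and kappa_mu: "\<kappa> \<in> elts \<mu>"
  using mu by (auto simp: successor_cardinal_def cardinal_def)

lemma card_kappa_mu: "|elts \<kappa>| <o |elts \<mu>|"
  using mu by (auto simp: successor_cardinal_def cardinal_def)

text \<open>Otherwise the least ordinal equinumerous with \<alpha> would be a cardinal above
  \<kappa> and below \<mu>.\<close>

lemma card_elt_mu:
  assumes a: "\<alpha> \<in> elts \<mu>"
  shows "|elts \<alpha>| \<le>o |elts \<kappa>|"
proof (rule ccontr)
  assume "\<not> |elts \<alpha>| \<le>o |elts \<kappa>|"
  then have less: "|elts \<kappa>| <o |elts \<alpha>|"
    using card_of_Well_order not_ordLeq_iff_ordLess by blast
  have oa: "ordinal \<alpha>"
    using a ordinal_mu ordinal_elt by blast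
  define Q where "Q = {\<nu> \<in> elts (osucc \<alpha>). |elts \<nu>| =o |elts \<alpha>| }"
  have "\<alpha> \<in> Q"
    using card_of_refl by (auto simp: Q_def)
  obtain \<nu> where \<nu>: "\<nu> \<in> Q" "\<And>y. y \<in> elts \<nu> \<Longrightarrow> y \<notin> Q"
    by (rule wfE_min[OF foundation \<open>\<alpha> \<in> Q\<close>]) auto
  have on: "ordinal \<nu>"
    using \<nu>(1) ordinal_elt[OF ordinal_osucc[OF oa]] by (auto simp: Q_def)
  have "|elts \<beta>| <o |elts \<nu>|" if b: "\<beta> \<in> elts \<nu>" for \<beta>
  proof -
    have "elts \<beta> \<subseteq> elts \<nu>"
      using b on ordinal_elt_subset by blast
    then have "|elts \<beta>| \<le>o |elts \<nu>|"
      by (rule card_of_mono1)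
    moreover have "\<beta> \<in> elts (osucc \<alpha>)"
      using ordinal_trans[OF ordinal_osucc[OF oa] b] \<nu>(1) by (simp add: Q_def)
    then have "\<not> |elts \<beta>| =o |elts \<nu>|"
      using \<nu> b ordIso_transitive unfolding Q_def by blast
    ultimately show ?thesis
      using ordLeq_iff_ordLess_or_ordIso by blast
  qed
  then have "cardinal \<nu>"
    using on by (simp add: cardinal_def)
  moreover have "\<kappa> \<in> elts \<nu>"
  proof (rule ccontr)
    assume "\<kappa> \<notin> elts \<nu>"
    then have "\<nu> \<in> elts \<kappa> \<or> \<nu> = \<kappa>"
      using ordinal_linear[OF on ordinal_kappa] by blast
    then have "elts \<nu> \<subseteq> elts \<kappa>"
      using ordinal_elt_subset[OF ordinal_kappa] by blast
    then have "|elts \<nu>| \<le>o |elts \<kappa>|"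
      by (rule card_of_mono1)
    moreover have "|elts \<kappa>| <o |elts \<nu>|"
      using less \<nu>(1) ordLess_ordIso_trans ordIso_symmetric unfolding Q_def by blast
    ultimately show False
      using not_ordLess_ordLeq by blast
  qed
  ultimately have "elts \<mu> \<subseteq> elts \<nu>"
    using mu by (simp add: successor_cardinal_def)
  then have "\<alpha> \<in> elts \<nu>"
    using a by blast
  moreover have "\<nu> = \<alpha> \<or> \<nu> \<in> elts \<alpha>"
    using \<nu>(1) by (simp add: Q_def)
  ultimately show False
    using elts_irrefl elts_asym by blast
qed

lemma ordinal_in_mu:
  assumes "ordinal \<sigma>" "|elts \<sigma>| \<le>o |elts \<kappa>|"
  shows "\<sigma> \<in> elts \<mu>"
proof (rule ccontr)
  assume "\<sigma> \<notin> elts \<mu>"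
  then have "elts \<mu> \<subseteq> elts \<sigma>"
    using ordinal_linear[OF assms(1) ordinal_mu] ordinal_elt_subset[OF assms(1)] by blast
  then have "|elts \<mu>| \<le>o |elts \<sigma>|"
    by (rule card_of_mono1)
  then have "|elts \<mu>| \<le>o |elts \<kappa>|"
    using assms(2) ordLeq_transitive by blast
  then show False
    using card_kappa_mu not_ordLess_ordLeq by blast
qed

lemma card_osucc: "|elts \<alpha>| \<le>o |elts \<kappa>| \<Longrightarrow> |elts (osucc \<alpha>)| \<le>o |elts \<kappa>|"
proof -
  assume a: "|elts \<alpha>| \<le>o |elts \<kappa>|"
  have "|{\<alpha>}| \<le>o |elts \<kappa>|"
    by (rule card_of_singl_ordLeq) (use infinite_kappa in auto)
  then show ?thesis
    using card_of_Un_ordLeq_infinite[OF infinite_kappa _ a] by fastforce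
qed

lemma osucc_mu: "\<alpha> \<in> elts \<mu> \<Longrightarrow> osucc \<alpha> \<in> elts \<mu>"
  using ordinal_in_mu ordinal_osucc ordinal_elt[OF ordinal_mu] card_osucc card_elt_mu by blast

text \<open>Regularity of successor cardinals: the union of at most \<kappa> many ordinals of size
  at most \<kappa> is an ordinal of size at most \<kappa>.\<close>

lemma mu_regular:
  assumes I: "|I| \<le>o |elts \<kappa>|" and F: "\<And>i. i \<in> I \<Longrightarrow> F i \<in> elts \<mu>"
  obtains \<beta> where "\<beta> \<in> elts \<mu>" "\<And>i. i \<in> I \<Longrightarrow> F i \<in> elts \<beta>"
proof -
  let ?U = "\<Union>i\<in>I. elts (F i)"
  have sub: "?U \<subseteq> elts \<mu>"
    using F ordinal_elt_subset[OF ordinal_mu] by blast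
  then have sm: "small ?U"
    using small_subset[OF small_elts] by blast
  have ordF: "ordinal (F i)" if "i \<in> I" for i
    using F[OF that] ordinal_elt[OF ordinal_mu] by blast
  have ord: "ordinal (vset ?U)"
  proof (rule ordinal_Union[OF sm])
    fix x assume "x \<in> ?U"
    then obtain i where i: "i \<in> I" "x \<in> elts (F i)"
      by blast
    show "ordinal x"
      using ordinal_elt[OF ordF[OF i(1)] i(2)] .
    show "elts x \<subseteq> ?U"
      using ordinal_elt_subset[OF ordF[OF i(1)] i(2)] i(1) by blast
  qed
  have "|?U| \<le>o |elts \<kappa>|"
    by (rule card_of_UNION_ordLeq_infinite[OF infinite_kappa I]) (use F card_elt_mu in blast)
  then have U: "vset ?U \<in> elts \<mu>"
    using ordinal_in_mu[OF ord] by (simp add: elts_vset sm)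
  \<comment> \<open>Some \<open>F i\<close> may equal the supremum, so a strict bound needs its
    successor.\<close>
  have "F i \<in> elts (osucc (vset ?U))" if "i \<in> I" for i
    using ordinal_subset[OF ordF[OF that] ord] that by (auto simp: elts_vset sm)
  then show ?thesis
    using that[of "osucc (vset ?U)"] osucc_mu[OF U] by blast
qed

lemma card_lists_elt_mu:
  assumes "\<beta> \<in> elts \<mu>"
  shows "|lists (elts \<beta>)| \<le>o |elts \<kappa>|"
  using ordLeq_ordIso_trans[OF card_of_lists_mono[OF card_elt_mu[OF assms]] card_of_lists_infinite[OF infinite_kappa]] .

lemma nat_le_kappa: "|UNIV :: nat set| \<le>o |elts \<kappa>|"
  using infinite_kappa infinite_iff_card_of_nat by blast

text \<open>Closing off in omega steps: each step bounds the values of all \<open>R \<theta>\<close>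
  on lists below the current ordinal, at most \<kappa> many in all. The ordinals reached in these
  steps form the ladder of the limit.\<close>

lemma closure_point:
  assumes R: "\<And>\<theta> s. \<theta> \<in> elts (osucc \<kappa>) \<Longrightarrow> s \<in> lists (elts \<mu>) \<Longrightarrow> R \<theta> s \<in> elts \<mu>"
  obtains \<delta> h where "\<delta> \<in> elts \<mu>" "limit_ordinal \<delta>" "ladder \<delta> h"
    "\<And>\<theta> s. \<theta> \<in> elts (osucc \<kappa>) \<Longrightarrow> s \<in> lists (elts \<delta>) \<Longrightarrow> R \<theta> s \<in> elts \<delta>"
proof -
  have "\<exists>\<gamma>\<in>elts \<mu>. \<beta> \<in> elts \<gamma> \<and> (\<forall>\<theta>\<in>elts (osucc \<kappa>). \<forall>s\<in>lists (elts \<beta>). R \<theta> s \<in> elts \<gamma>)"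
    if b: "\<beta> \<in> elts \<mu>" for \<beta>
  proof -
    have "|elts (osucc \<kappa>) \<times> lists (elts \<beta>)| \<le>o |elts \<kappa>|"
      by (intro card_of_Times_ordLeq_infinite infinite_kappa card_osucc card_lists_elt_mu b
          ordIso_imp_ordLeq[OF card_of_refl])
    then obtain \<gamma> where \<gamma>: "\<gamma> \<in> elts \<mu>"
      "\<And>i. i \<in> elts (osucc \<kappa>) \<times> lists (elts \<beta>) \<Longrightarrow> R (fst i) (snd i) \<in> elts \<gamma>"
    proof (rule mu_regular[where F = "\<lambda>i. R (fst i) (snd i)"])
      fix i assume "i \<in> elts (osucc \<kappa>) \<times> lists (elts \<beta>)"
      then have "fst i \<in> elts (osucc \<kappa>)" "snd i \<in> lists (elts \<mu>)"
        using lists_mono[OF ordinal_elt_subset[OF ordinal_mu b]] by (auto simp only: mem_Times_iff)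
      then show "R (fst i) (snd i) \<in> elts \<mu>"
        by (rule R)
    qed blast
    have ord: "ordinal \<beta>" "ordinal \<gamma>"
      using b \<gamma>(1) ordinal_elt[OF ordinal_mu] by auto
    \<comment> \<open>The larger of \<open>\<gamma>\<close> and \<open>osucc \<beta>\<close>, which
      makes the step strictly increasing.\<close>
    define \<gamma>' where "\<gamma>' = (if \<beta> \<in> elts \<gamma> then \<gamma> else osucc \<beta>)"
    have "\<gamma>' \<in> elts \<mu>" "\<beta> \<in> elts \<gamma>'"
      using \<gamma>(1) b osucc_mu by (auto simp: \<gamma>'_def)
    moreover have "elts \<gamma> \<subseteq> elts \<gamma>'"
      using ordinal_linear[OF ord] ordinal_elt_subset[OF ord(1)] by (auto simp: \<gamma>'_def)
    moreover have "R \<theta> s \<in> elts \<gamma>" if "\<theta> \<in> elts (osucc \<kappa>)" "s \<in> lists (elts \<beta>)" for \<theta> s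
      using \<gamma>(2)[of "(\<theta>, s)"] that by (simp only: mem_Times_iff fst_conv snd_conv simp_thms)
    ultimately show ?thesis
      by (intro bexI[of _ \<gamma>'] conjI ballI) (blast | assumption)+
  qed
  then obtain G where G: "\<And>\<beta>. \<beta> \<in> elts \<mu> \<Longrightarrow> G \<beta> \<in> elts \<mu>" "\<And>\<beta>. \<beta> \<in> elts \<mu> \<Longrightarrow> \<beta> \<in> elts (G \<beta>)"
    "\<And>\<beta> \<theta> s. \<beta> \<in> elts \<mu> \<Longrightarrow> \<theta> \<in> elts (osucc \<kappa>) \<Longrightarrow> s \<in> lists (elts \<beta>) \<Longrightarrow> R \<theta> s \<in> elts (G \<beta>)"
    by metis
  define h where "h = rec_nat \<kappa> (\<lambda>_. G)"
  have h_Suc: "h (Suc n) = G (h n)" for n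
    by (simp add: h_def)
  have h_mu: "h n \<in> elts \<mu>" for n
    by (induction n) (auto simp: h_def kappa_mu G(1))
  have h_step: "h n \<in> elts (h (Suc n))" for n
    using G(2)[OF h_mu] by (simp add: h_Suc)
  have h_ord: "ordinal (h n)" for n
    using h_mu ordinal_elt[OF ordinal_mu] by blast
  obtain \<beta> where \<beta>: "\<beta> \<in> elts \<mu>" "\<And>n. h n \<in> elts \<beta>"
    using mu_regular[OF nat_le_kappa, of h] h_mu by auto
  let ?U = "\<Union>n. elts (h n)"
  have sub: "?U \<subseteq> elts \<beta>"
    using \<beta> ordinal_elt_subset[OF ordinal_elt[OF ordinal_mu \<beta>(1)]] by blast
  then have sm: "small ?U"
    using small_subset[OF small_elts] by blast
  define \<delta> where "\<delta> = vset ?U"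
  have e: "elts \<delta> = ?U"
    by (simp add: \<delta>_def elts_vset sm)
  have ord: "ordinal \<delta>"
    unfolding \<delta>_def
  proof (rule ordinal_Union[OF sm])
    fix x assume "x \<in> ?U"
    then obtain n where n: "x \<in> elts (h n)"
      by blast
    show "ordinal x"
      by (rule ordinal_elt[OF h_ord n])
    show "elts x \<subseteq> ?U"
      using ordinal_elt_subset[OF h_ord n] by blast
  qed
  have "\<delta> = \<beta> \<or> \<delta> \<in> elts \<beta>"
    using ordinal_subset[OF ord ordinal_elt[OF ordinal_mu \<beta>(1)]] sub e by simp
  then have d: "\<delta> \<in> elts \<mu>"
    using \<beta>(1) ordinal_trans[OF ordinal_mu] by blast
  have hd: "h n \<in> elts \<delta>" for n
    using h_step e by blast
  have lad: "ladder \<delta> h"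
    unfolding ladder_def using hd h_step e by auto
  moreover have "limit_ordinal \<delta>"
    unfolding limit_ordinal_def using ord hd e by blast
  moreover have "R \<theta> s \<in> elts \<delta>" if t: "\<theta> \<in> elts (osucc \<kappa>)" and s: "s \<in> lists (elts \<delta>)" for \<theta> s
  proof -
    \<comment> \<open>A list is finite, so all its members lie below one \<open>h n\<close>, and the
      next step bounds the value of \<open>R \<theta>\<close>.\<close>
    have "\<exists>n. s \<in> lists (elts (h n))"
      using s
    proof (induction s)
      case (Cons x s)
      then obtain n where n: "s \<in> lists (elts (h n))"
        by blast
      obtain N where N: "\<And>n. N \<le> n \<Longrightarrow> x \<in> elts (h n)"
        using ladder_eventually[OF lad ord Cons.hyps(1)] by blast
      have "elts (h n) \<subseteq> elts (h (max n N))"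
      proof (cases "n < N")
        case True
        then show ?thesis
          using ordinal_elt_subset[OF h_ord ladder_less[OF lad ord True]] by (simp add: max_def)
      qed (simp add: max_def)
      then have "x # s \<in> lists (elts (h (max n N)))"
        using n N[of "max n N"] lists_mono by auto
      then show ?case
        by blast
    qed auto
    then obtain n where "s \<in> lists (elts (h n))"
      by blast
    then have "R \<theta> s \<in> elts (h (Suc n))"
      unfolding h_Suc by (rule G(3)[OF h_mu t])
    then show ?thesis
      using e by blast
  qed
  ultimately show ?thesis
    using that d by blast
qed

end

section \<open>Square sequences and disjoint tails of ladders\<close>

locale square_sequence = successor_of_infinite \<kappa> \<mu>
  for \<kappa> \<mu> :: "'v::zfc_universe" +
  fixes C :: "'v \<Rightarrow> 'v set"
  assumes club: "\<And>\<alpha>. \<alpha> \<in> elts \<mu> \<Longrightarrow> limit_ordinal \<alpha> \<Longrightarrow> club_in (C \<alpha>) \<alpha>"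
    and type_le: "\<And>\<alpha>. \<alpha> \<in> elts \<mu> \<Longrightarrow> limit_ordinal \<alpha> \<Longrightarrow> ord_rel (C \<alpha>) \<le>o ord_rel (elts \<kappa>)"
    and coherent: "\<And>\<alpha> \<beta>. \<alpha> \<in> elts \<mu> \<Longrightarrow> limit_ordinal \<alpha> \<Longrightarrow> \<beta> \<in> limit_points (C \<alpha>) \<alpha> \<Longrightarrow>
      C \<beta> = C \<alpha> \<inter> elts \<beta>"
begin

definition S :: "'v \<Rightarrow> 'v set" where
  "S \<theta> = {\<delta> \<in> elts \<mu>. limit_ordinal \<delta> \<and> (\<exists>h. ladder \<delta> h) \<and> ord_rel (C \<delta>) =o ord_rel (elts \<theta>)}"

definition \<eta> :: "'v \<Rightarrow> nat \<Rightarrow> 'v" where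
  "\<eta> \<delta> = (SOME h. ladder \<delta> h)"

lemma S_mu: "\<delta> \<in> S \<theta> \<Longrightarrow> \<delta> \<in> elts \<mu>" and S_limit: "\<delta> \<in> S \<theta> \<Longrightarrow> limit_ordinal \<delta>"
  and S_ordinal: "\<delta> \<in> S \<theta> \<Longrightarrow> ordinal \<delta>"
  by (auto simp: S_def limit_ordinal_def)

lemma ladder_\<eta>: "\<delta> \<in> S \<theta> \<Longrightarrow> ladder \<delta> (\<eta> \<delta>)"
  unfolding \<eta>_def by (rule someI_ex[of "ladder \<delta>"]) (simp add: S_def)

text \<open>For limit points \<open>x\<close> below \<open>y\<close> of \<open>C \<alpha>\<close>,
  coherence makes \<open>C x\<close> a proper initial segment of \<open>C y\<close>, because
  \<open>x\<close> belongs to the closed set \<open>C \<alpha>\<close>; hence the order types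
  differ.\<close>

lemma limit_point_type_unique:
  assumes a: "\<alpha> \<in> elts \<mu>" "limit_ordinal \<alpha>"
    and b: "\<beta> \<in> limit_points (C \<alpha>) \<alpha>" "\<beta> \<in> S \<theta>" and b': "\<beta>' \<in> limit_points (C \<alpha>) \<alpha>" "\<beta>' \<in> S \<theta>"
  shows "\<beta> = \<beta>'"
proof -
  have False if x: "x \<in> limit_points (C \<alpha>) \<alpha>" "x \<in> S \<theta>" and y: "y \<in> limit_points (C \<alpha>) \<alpha>" "y \<in> S \<theta>"
    and xy: "x \<in> elts y" for x y
  proof -
    have "x \<in> C \<alpha>"
      using club[OF a] x unfolding club_in_def by blast
    moreover have Cx: "C x = C \<alpha> \<inter> elts x" and Cy: "C y = C \<alpha> \<inter> elts y"
      using coherent[OF a] x y by auto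
    ultimately have "x \<in> C y"
      using xy by blast
    moreover have "elts x \<subseteq> elts y"
      using ordinal_elt_subset[OF S_ordinal[OF y(2)] xy] .
    then have "C x = C y \<inter> elts x"
      unfolding Cx Cy by blast
    moreover have "ordinal z" if "z \<in> C y" for z
      using that Cy ordinal_elt[OF S_ordinal[OF y(2)]] by blast
    ultimately have "ord_rel (C x) <o ord_rel (C y)"
      using ord_rel_initial_segment[of "C y" x] by simp
    moreover have "ord_rel (C x) =o ord_rel (C y)"
      using x(2) y(2) ordIso_symmetric ordIso_transitive unfolding S_def by blast
    ultimately show False
      using not_ordLess_ordIso by blast
  qed
  then show ?thesis
    using ordinal_linear[OF S_ordinal[OF b(2)] S_ordinal[OF b'(2)]] b b' by blast
qed

text \<open>At most one limit point of \<open>C \<alpha>\<close> lies in \<open>S \<theta>\<close>,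
  so a final piece of \<open>C \<alpha>\<close> meets every member of \<open>S \<theta>\<close>
  below \<alpha> in a bounded set.\<close>

lemma nowhere_reflecting:
  assumes a: "\<alpha> \<in> elts \<mu>" "limit_ordinal \<alpha>"
  obtains E where "E \<subseteq> elts \<alpha>" "\<And>\<delta>. \<delta> \<in> elts \<alpha> \<Longrightarrow> \<exists>c\<in>E. \<delta> \<in> elts c"
    "\<And>\<delta>. \<delta> \<in> S \<theta> \<Longrightarrow> \<delta> \<in> elts \<alpha> \<Longrightarrow> \<exists>\<gamma>\<in>elts \<delta>. \<forall>c\<in>E \<inter> elts \<delta>. c = \<gamma> \<or> c \<in> elts \<gamma>"
proof -
  have oa: "ordinal \<alpha>"
    using a by (simp add: limit_ordinal_def)
  have Ca: "C \<alpha> \<subseteq> elts \<alpha>" and unb: "unbounded_in (C \<alpha>) \<alpha>"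
    using club[OF a] by (auto simp: club_in_def)
  have bounded: "\<exists>\<gamma>\<in>elts \<delta>. \<forall>c\<in>C \<alpha> \<inter> elts \<delta>. c = \<gamma> \<or> c \<in> elts \<gamma>"
    if d: "\<delta> \<in> S \<theta>" "\<delta> \<in> elts \<alpha>" "\<delta> \<notin> limit_points (C \<alpha>) \<alpha>" for \<delta>
  proof -
    have "\<not> unbounded_in (C \<alpha>) \<delta>"
      using d S_limit by (auto simp: limit_points_def)
    then obtain \<gamma> where g: "\<gamma> \<in> elts \<delta>" "\<forall>c\<in>C \<alpha> \<inter> elts \<delta>. \<gamma> \<notin> elts c"
      unfolding unbounded_in_def by blast
    have "c = \<gamma> \<or> c \<in> elts \<gamma>" if "c \<in> C \<alpha> \<inter> elts \<delta>" for c
      using g that ordinal_linear[of c \<gamma>] ordinal_elt[OF S_ordinal[OF d(1)]] by blast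
    then show ?thesis
      using g by blast
  qed
  show ?thesis
  proof (cases "\<exists>\<beta>. \<beta> \<in> limit_points (C \<alpha>) \<alpha> \<and> \<beta> \<in> S \<theta>")
    case True
    then obtain \<beta> where b: "\<beta> \<in> limit_points (C \<alpha>) \<alpha>" "\<beta> \<in> S \<theta>"
      by blast
    then have ba: "\<beta> \<in> elts \<alpha>"
      by (simp add: limit_points_def)
    show ?thesis
    \<comment> \<open>Cutting \<open>C \<alpha>\<close> off at the exceptional limit point
      \<open>\<beta>\<close> leaves nothing below \<open>\<beta>\<close>; at the other points of
      \<open>S \<theta>\<close> the set \<open>C \<alpha>\<close> is already bounded.\<close>
    proof (rule that[of "C \<alpha> - elts \<beta>"])
      fix \<delta> assume d: "\<delta> \<in> elts \<alpha>"
      define \<epsilon> where "\<epsilon> = (if \<delta> \<in> elts \<beta> then \<beta> else \<delta>)"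
      have "\<epsilon> \<in> elts \<alpha>"
        using d ba by (simp add: \<epsilon>_def)
      then obtain c where c: "c \<in> C \<alpha>" "\<epsilon> \<in> elts c"
        using unb unfolding unbounded_in_def by blast
      have oc: "ordinal c"
        using c Ca ordinal_elt[OF oa] by blast
      have "(\<delta> = \<epsilon> \<or> \<delta> \<in> elts \<epsilon>) \<and> (\<beta> = \<epsilon> \<or> \<beta> \<in> elts \<epsilon>)"
        using ordinal_linear[OF ordinal_elt[OF oa d] ordinal_elt[OF oa ba]] by (auto simp: \<epsilon>_def)
      then have "\<delta> \<in> elts c" "\<beta> \<in> elts c"
        using c ordinal_trans[OF oc] by blast+
      then show "\<exists>c\<in>C \<alpha> - elts \<beta>. \<delta> \<in> elts c"
        using c elts_asym by blast
    next
      fix \<delta> assume d: "\<delta> \<in> S \<theta>" "\<delta> \<in> elts \<alpha>"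
      show "\<exists>\<gamma>\<in>elts \<delta>. \<forall>c\<in>(C \<alpha> - elts \<beta>) \<inter> elts \<delta>. c = \<gamma> \<or> c \<in> elts \<gamma>"
      proof (cases "\<delta> \<in> limit_points (C \<alpha>) \<alpha>")
        case True
        then have "\<delta> = \<beta>"
          using limit_point_type_unique[OF a] b d by blast
        moreover obtain \<gamma> where "\<gamma> \<in> elts \<delta>"
          using S_limit[OF d(1)] unfolding limit_ordinal_def by blast
        ultimately show ?thesis
          by blast
      next
        case False
        then show ?thesis
          using bounded[OF d] by blast
      qed
    qed (use Ca in blast)
  next
    case False
    show ?thesis
    proof (rule that[of "C \<alpha>"])
      show "\<exists>c\<in>C \<alpha>. \<delta> \<in> elts c" if "\<delta> \<in> elts \<alpha>" for \<delta>
        using unb that unfolding unbounded_in_def by blast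
    qed (use Ca bounded False in blast)+
  qed
qed

text \<open>Only the ladder is to be determined by the common value; within a single ladder the
  position follows from injectivity, as in \<open>gen_subset_free\<close>.\<close>

definition disjointifying :: "'v set \<Rightarrow> ('v \<Rightarrow> nat) \<Rightarrow> bool" where
  "disjointifying X f \<longleftrightarrow> (\<forall>\<delta>\<in>X. \<forall>\<delta>'\<in>X. \<forall>m n. f \<delta> \<le> m \<longrightarrow> f \<delta>' \<le> n \<longrightarrow> \<eta> \<delta> m = \<eta> \<delta>' n \<longrightarrow> \<delta> = \<delta>')"

lemma disjointifyingI:
  assumes "\<And>\<delta>. \<delta> \<in> X \<Longrightarrow> ordinal \<delta>"
    and "\<And>\<delta> \<delta>' m n. \<delta> \<in> X \<Longrightarrow> \<delta>' \<in> X \<Longrightarrow> \<delta> \<in> elts \<delta>' \<Longrightarrow> f \<delta> \<le> m \<Longrightarrow> f \<delta>' \<le> n \<Longrightarrow> \<eta> \<delta> m \<noteq> \<eta> \<delta>' n"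
  shows "disjointifying X f"
  unfolding disjointifying_def using assms ordinal_linear by metis

text \<open>Induction on \<alpha>. A successor adds at most one ladder; at a limit the set
  \<open>E\<close> of \<open>nowhere_reflecting\<close> cuts \<alpha> into blocks to which the
  induction hypothesis applies, and the tails are shortened so as to stay in their blocks.\<close>

lemma disjointifying_exists: "\<alpha> \<in> elts \<mu> \<Longrightarrow> \<exists>f. disjointifying (S \<theta> \<inter> elts \<alpha>) f"
proof (induction \<alpha> rule: wf_induct_rule[OF foundation])
  case (1 \<alpha>)
  have oa: "ordinal \<alpha>"
    using 1(2) ordinal_elt[OF ordinal_mu] by blast
  have IH: "\<exists>f. disjointifying (S \<theta> \<inter> elts \<beta>) f" if "\<beta> \<in> elts \<alpha>" for \<beta>
    using 1 that ordinal_trans[OF ordinal_mu] by blast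
  consider "elts \<alpha> = {}" | \<gamma> where "elts \<alpha> = insert \<gamma> (elts \<gamma>)" | "limit_ordinal \<alpha>"
  proof (cases "limit_ordinal \<alpha> \<or> elts \<alpha> = {}")
    case False
    then obtain \<gamma> where g: "\<gamma> \<in> elts \<alpha>" "\<forall>x\<in>elts \<alpha>. \<gamma> \<notin> elts x"
      using oa unfolding limit_ordinal_def by blast
    then have "elts \<alpha> = insert \<gamma> (elts \<gamma>)"
      using ordinal_linear[of _ \<gamma>] ordinal_elt[OF oa] ordinal_elt_subset[OF oa g(1)] by blast
    then show ?thesis
      using that by blast
  qed (use that in blast)
  then show ?case
  proof cases
    case 1
    then show ?thesis
      by (simp add: disjointifying_def)
  next
    case (2 \<gamma>)
    then have ga: "\<gamma> \<in> elts \<alpha>"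
      by simp
    then obtain f where f: "disjointifying (S \<theta> \<inter> elts \<gamma>) f"
      using IH by blast
    show ?thesis
    proof (cases "\<gamma> \<in> S \<theta>")
      case False
      then have "S \<theta> \<inter> elts \<alpha> = S \<theta> \<inter> elts \<gamma>"
        using 2 by auto
      then show ?thesis
        using f by auto
    next
      case True
      \<comment> \<open>The ladder of \<open>\<gamma>\<close> leaves \<open>\<delta>\<close> after
        finitely many steps, so it meets the ladder of \<open>\<delta>\<close> in a finite set,
        which a later start \<open>N \<delta>\<close> avoids.\<close>
      have "\<exists>N. \<forall>n\<ge>N. \<forall>m. \<eta> \<delta> n \<noteq> \<eta> \<gamma> m" if d: "\<delta> \<in> S \<theta> \<inter> elts \<gamma>" for \<delta>
      proof -
        have ld: "ladder \<delta> (\<eta> \<delta>)" "ordinal \<delta>" and lg: "ladder \<gamma> (\<eta> \<gamma>)" "ordinal \<gamma>"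
          using d True ladder_\<eta> S_ordinal by blast+
        obtain M where M: "\<And>m. M \<le> m \<Longrightarrow> \<delta> \<in> elts (\<eta> \<gamma> m)"
          using ladder_eventually[OF lg] d by blast
        have "inj (\<eta> \<delta>)"
          by (rule injI) (simp add: ladder_inject[OF ld])
        then have "finite (\<eta> \<delta> -` (\<eta> \<gamma> ` {..<M}))"
          by (intro finite_vimageI) auto
        then obtain N where N: "\<eta> \<delta> -` (\<eta> \<gamma> ` {..<M}) \<subseteq> {..<N}"
          using finite_nat_bounded by meson
        have "\<eta> \<delta> n \<noteq> \<eta> \<gamma> m" if "N \<le> n" for n m
        proof (cases "m < M")
          case True
          then show ?thesis
            using N that by fastforce
        next
          case False
          then have "\<delta> \<in> elts (\<eta> \<gamma> m)"
            using M by simp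
          moreover have "\<eta> \<delta> n \<in> elts \<delta>"
            using ld by (simp add: ladder_def)
          ultimately show ?thesis
            using elts_asym by metis
        qed
        then show ?thesis
          by blast
      qed
      then obtain N where N: "\<And>\<delta> n m. \<delta> \<in> S \<theta> \<inter> elts \<gamma> \<Longrightarrow> N \<delta> \<le> n \<Longrightarrow> \<eta> \<delta> n \<noteq> \<eta> \<gamma> m"
        by metis
      have "disjointifying (S \<theta> \<inter> elts \<alpha>) (\<lambda>\<delta>. max (f \<delta>) (N \<delta>))"
      proof (rule disjointifyingI)
        fix \<delta> \<delta>' m n
        assume d: "\<delta> \<in> S \<theta> \<inter> elts \<alpha>" "\<delta>' \<in> S \<theta> \<inter> elts \<alpha>" "\<delta> \<in> elts \<delta>'"
          and m: "max (f \<delta>) (N \<delta>) \<le> m" and n: "max (f \<delta>') (N \<delta>') \<le> n"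
        have dg: "\<delta> \<in> S \<theta> \<inter> elts \<gamma>"
          using d 2 elts_asym[of \<gamma> \<delta>'] elts_irrefl[of \<gamma>] by auto
        show "\<eta> \<delta> m \<noteq> \<eta> \<delta>' n"
        proof (cases "\<delta>' = \<gamma>")
          case True
          then show ?thesis
            using N[OF dg] m by simp
        next
          case False
          then have "\<delta>' \<in> S \<theta> \<inter> elts \<gamma>"
            using d 2 by auto
          moreover have "\<delta> \<noteq> \<delta>'"
            using d(3) elts_irrefl by blast
          ultimately show ?thesis
            using f dg m n unfolding disjointifying_def by auto
        qed
      qed (use S_ordinal in blast)
      then show ?thesis
        by blast
    qed
  next
    case 3
    obtain E where E: "E \<subseteq> elts \<alpha>" "\<And>\<delta>. \<delta> \<in> elts \<alpha> \<Longrightarrow> \<exists>c\<in>E. \<delta> \<in> elts c"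
      and bd: "\<And>\<delta>. \<delta> \<in> S \<theta> \<Longrightarrow> \<delta> \<in> elts \<alpha> \<Longrightarrow> \<exists>\<gamma>\<in>elts \<delta>. \<forall>c\<in>E \<inter> elts \<delta>. c = \<gamma> \<or> c \<in> elts \<gamma>"
      using nowhere_reflecting[OF 1(2) 3] by metis
    have "\<exists>f. disjointifying (S \<theta> \<inter> elts (osucc c)) f" if "c \<in> E" for c
    proof -
      have c: "c \<in> elts \<alpha>"
        using E that by blast
      then obtain x where x: "x \<in> elts \<alpha>" "c \<in> elts x"
        using 3 unfolding limit_ordinal_def by blast
      then have "elts (osucc c) \<subseteq> elts x"
        using ordinal_elt_subset[OF ordinal_elt[OF oa x(1)]] by auto
      moreover obtain f where "disjointifying (S \<theta> \<inter> elts x) f"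
        using IH[OF x(1)] by blast
      ultimately show ?thesis
        unfolding disjointifying_def by blast
    qed
    then obtain F where F: "\<And>c. c \<in> E \<Longrightarrow> disjointifying (S \<theta> \<inter> elts (osucc c)) (F c)"
      by metis
    \<comment> \<open>The block of \<open>\<delta>\<close> is named by the least \<open>c\<close> in
      \<open>E\<close> with \<open>\<delta> \<le> c\<close>; \<open>osucc\<close> includes the case
      of equality.\<close>
    have "\<exists>c. c \<in> E \<and> \<delta> \<in> elts (osucc c) \<and> (\<forall>c'\<in>E. \<delta> \<in> elts (osucc c') \<longrightarrow> c = c' \<or> c \<in> elts c')"
      if d: "\<delta> \<in> elts \<alpha>" for \<delta>
    proof -
      let ?Q = "{c \<in> E. \<delta> \<in> elts (osucc c)}"
      obtain c0 where c0: "c0 \<in> ?Q"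
        using E(2)[OF d] by auto
      obtain c where c: "c \<in> ?Q" "\<And>y. y \<in> elts c \<Longrightarrow> y \<notin> ?Q"
        by (rule wfE_min[OF foundation c0]) auto
      have "c = c' \<or> c \<in> elts c'" if "c' \<in> ?Q" for c'
        using ordinal_linear[of c c'] c that E(1) ordinal_elt[OF oa] by blast
      then show ?thesis
        using c(1) by blast
    qed
    then obtain nx where nx: "\<And>\<delta>. \<delta> \<in> elts \<alpha> \<Longrightarrow> nx \<delta> \<in> E" "\<And>\<delta>. \<delta> \<in> elts \<alpha> \<Longrightarrow> \<delta> \<in> elts (osucc (nx \<delta>))"
      "\<And>\<delta> c'. \<delta> \<in> elts \<alpha> \<Longrightarrow> c' \<in> E \<Longrightarrow> \<delta> \<in> elts (osucc c') \<Longrightarrow> nx \<delta> = c' \<or> nx \<delta> \<in> elts c'"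
      by metis
    \<comment> \<open>As \<open>E\<close> is bounded in \<open>\<delta>\<close>, the ladder of
      \<open>\<delta>\<close> eventually exceeds every point of \<open>E\<close> below
      \<open>\<delta>\<close> and thus stays in its block.\<close>
    have "\<exists>M. \<forall>n\<ge>M. \<forall>c\<in>E \<inter> elts \<delta>. c \<in> elts (\<eta> \<delta> n)" if d: "\<delta> \<in> S \<theta>" "\<delta> \<in> elts \<alpha>" for \<delta>
    proof -
      obtain \<gamma> where g: "\<gamma> \<in> elts \<delta>" "\<forall>c\<in>E \<inter> elts \<delta>. c = \<gamma> \<or> c \<in> elts \<gamma>"
        using bd[OF d] by blast
      have ld: "ladder \<delta> (\<eta> \<delta>)" "ordinal \<delta>"
        using d ladder_\<eta> S_ordinal by blast+
      obtain M where M: "\<And>n. M \<le> n \<Longrightarrow> \<gamma> \<in> elts (\<eta> \<delta> n)"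
        using ladder_eventually[OF ld g(1)] by blast
      have "c \<in> elts (\<eta> \<delta> n)" if "M \<le> n" "c \<in> E \<inter> elts \<delta>" for n c
      proof -
        have "ordinal (\<eta> \<delta> n)"
          using ld ordinal_elt unfolding ladder_def by blast
        moreover have "c = \<gamma> \<or> c \<in> elts \<gamma>"
          by (rule bspec[OF g(2) that(2)])
        ultimately show ?thesis
          using M[OF that(1)] ordinal_trans[of "\<eta> \<delta> n" c \<gamma>] by auto
      qed
      then show ?thesis
        by blast
    qed
    then obtain M where M: "\<And>\<delta> n c. \<delta> \<in> S \<theta> \<Longrightarrow> \<delta> \<in> elts \<alpha> \<Longrightarrow> M \<delta> \<le> n \<Longrightarrow> c \<in> E \<inter> elts \<delta> \<Longrightarrow> c \<in> elts (\<eta> \<delta> n)"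
      by metis
    have "disjointifying (S \<theta> \<inter> elts \<alpha>) (\<lambda>\<delta>. max (F (nx \<delta>) \<delta>) (M \<delta>))"
    proof (rule disjointifyingI)
      fix \<delta> \<delta>' m n
      assume d: "\<delta> \<in> S \<theta> \<inter> elts \<alpha>" "\<delta>' \<in> S \<theta> \<inter> elts \<alpha>" and dd: "\<delta> \<in> elts \<delta>'"
        and m: "max (F (nx \<delta>) \<delta>) (M \<delta>) \<le> m" and n: "max (F (nx \<delta>') \<delta>') (M \<delta>') \<le> n"
      show "\<eta> \<delta> m \<noteq> \<eta> \<delta>' n"
      proof (cases "nx \<delta> = nx \<delta>'")
        case True
        have "\<delta> \<in> S \<theta> \<inter> elts (osucc (nx \<delta>))" "\<delta>' \<in> S \<theta> \<inter> elts (osucc (nx \<delta>))"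
          using d nx(2)[of \<delta>] nx(2)[of \<delta>'] True by auto
        moreover have "\<delta> \<noteq> \<delta>'"
          using dd elts_irrefl by blast
        ultimately show ?thesis
          using F[OF nx(1)[of \<delta>]] d m n True unfolding disjointifying_def by auto
      next
        \<comment> \<open>Different blocks: with \<open>c = nx \<delta>\<close> one has
          \<open>\<eta> \<delta> m < \<delta> \<le> c < \<eta> \<delta>' n\<close>.\<close>
        case False
        let ?c = "nx \<delta>"
        have da: "\<delta> \<in> elts \<alpha>" "\<delta>' \<in> elts \<alpha>"
          using d by auto
        have oc: "ordinal ?c" "ordinal (nx \<delta>')" "ordinal \<delta>'"
          using nx(1) da E(1) ordinal_elt[OF oa] by blast+
        have "?c \<in> elts \<delta>'"
        proof (rule ccontr)
          assume "?c \<notin> elts \<delta>'"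
          then have "\<delta>' \<in> elts (osucc ?c)"
            using ordinal_linear[OF oc(1,3)] by auto
          then have 1: "nx \<delta>' \<in> elts ?c"
            using nx(3)[OF da(2) nx(1)[OF da(1)]] False by auto
          have "\<delta> \<in> elts (osucc (nx \<delta>'))"
            using nx(2)[OF da(2)] dd ordinal_trans[OF oc(2)] by auto
          then have "?c \<in> elts (nx \<delta>')"
            using nx(3)[OF da(1) nx(1)[OF da(2)]] False by auto
          then show False
            using 1 elts_asym by blast
        qed
        then have c: "?c \<in> elts (\<eta> \<delta>' n)"
          using M[of \<delta>' n ?c] d n nx(1)[OF da(1)] by auto
        have ld: "ladder \<delta> (\<eta> \<delta>)" "ladder \<delta>' (\<eta> \<delta>')"
          using d ladder_\<eta> by blast+
        have "ordinal (\<eta> \<delta>' n)"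
          using ld(2) oc(3) ordinal_elt unfolding ladder_def by blast
        then have "\<delta> \<in> elts (\<eta> \<delta>' n)"
          using c nx(2)[OF da(1)] ordinal_trans by auto
        moreover have "\<eta> \<delta> m \<in> elts \<delta>"
          using ld(1) by (simp add: ladder_def)
        ultimately show ?thesis
          using elts_asym by metis
      qed
    qed (use S_ordinal in blast)
    then show ?thesis
      by blast
  qed
qed

end

section \<open>The counterexample to the axiom of Loewenheim and Skolem\<close>

lemma carrier_code_cong: "carrier G = carrier G' \<Longrightarrow> carrier_code G = carrier_code G'"
  by (simp add: carrier_code_def)

lemma mult_code_cong:
  assumes "carrier G = carrier G'"
    and "\<And>x y. x \<in> carrier G \<Longrightarrow> y \<in> carrier G \<Longrightarrow> x \<otimes>\<^bsub>G\<^esub> y = x \<otimes>\<^bsub>G'\<^esub> y"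
  shows "mult_code G = mult_code G'"
proof -
  have "{vpair x (vpair y (x \<otimes>\<^bsub>G\<^esub> y)) | x y. x \<in> carrier G \<and> y \<in> carrier G} =
      {vpair x (vpair y (x \<otimes>\<^bsub>G'\<^esub> y)) | x y. x \<in> carrier G' \<and> y \<in> carrier G'}"
    using assms by auto
  then show ?thesis
    by (simp add: mult_code_def)
qed

context int_module
begin

text \<open>The group-theoretic residue of forcing freeness, stated for subsets of the module so
  that the main argument involves neither names and formulas nor the coding.\<close>

definition decides_basis :: "'b set \<Rightarrow> 'c set \<Rightarrow> 'c rel \<Rightarrow> 'c \<Rightarrow> ('c \<Rightarrow> 'b set) \<Rightarrow> bool" where
  "decides_basis A P leq p1 D \<longleftrightarrow> preorder_on P leq \<and> p1 \<in> P \<and>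
     (\<forall>q r. (r, q) \<in> leq \<longrightarrow> D q \<subseteq> D r) \<and>
     (\<forall>q. (q, p1) \<in> leq \<longrightarrow> D q \<subseteq> A \<and> independent (D q) \<and>
        (\<forall>x\<in>A. \<exists>r. (r, q) \<in> leq \<and> x \<in> span (D r)))"

end

context coded_subgroup
begin

lemma span_preimage:
  assumes X: "X \<subseteq> g ` A" and x: "x \<in> A" "g x \<in> generate G X"
  shows "x \<in> span {y \<in> A. g y \<in> X}"
proof -
  have "X = g ` {y \<in> A. g y \<in> X}"
    using X by auto
  then have "g x \<in> g ` span {y \<in> A. g y \<in> X}"
    using x coded_generate[of "{y \<in> A. g y \<in> X}"] by auto
  then obtain y where y: "y \<in> span {y \<in> A. g y \<in> X}" "g x = g y"
    by blast
  moreover have "y \<in> A"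
    using y span_subset[of "{y \<in> A. g y \<in> X}"] by auto
  ultimately show ?thesis
    using coded_eq_iff x by metis
qed

end

locale universe_group = coded_subgroup scale A g
  for scale :: "int \<Rightarrow> 'b::ab_group_add \<Rightarrow> 'b" (infixr \<open>*z\<close> 75) and A
    and g :: "'b \<Rightarrow> 'v::zfc_universe" +
  assumes small: "small (g ` A)"
begin

lemma group_forcing: "forcing_poset P leq p0 \<Longrightarrow> group_forcing P leq p0 G"
  by (intro group_forcing.intro poset_forcing.intro group_forcing_axioms.intro coded.comm_group_axioms)
    (simp_all add: small)

lemma potentially_free_decides_basis:
  assumes "sigma_closed_potentially_free G"
  obtains P leq p1 D where "sigma_closed (P :: 'v set) leq" "decides_basis A P leq p1 D"
proof -
  obtain P leq p0 where P: "forcing_poset P leq p0" and sc: "sigma_closed P leq" and ff: "forces_free P leq p0 G"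
    using assms unfolding sigma_closed_potentially_free_def by blast
  interpret F: group_forcing P leq p0 G
    by (rule group_forcing[OF P])
  have "F.forced (F.is_free_abelian_group F.C F.m)"
    using ff by (simp only: forces_free_def)
  then obtain p1 D where p1: "p1 \<in> P" and mono: "\<And>q r. (r, q) \<in> leq \<Longrightarrow> D q \<subseteq> D r"
    and D: "\<And>q. (q, p1) \<in> leq \<Longrightarrow> D q \<subseteq> carrier G"
      "\<And>q b n. (q, p1) \<in> leq \<Longrightarrow> b \<in> D q \<Longrightarrow> b [^]\<^bsub>G\<^esub> Suc n \<noteq> \<one>\<^bsub>G\<^esub>"
      "\<And>q b. (q, p1) \<in> leq \<Longrightarrow> b \<in> D q \<Longrightarrow> generate G {b} \<inter> generate G (D q - {b}) \<subseteq> {\<one>\<^bsub>G\<^esub>}"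
      "\<And>q a. (q, p1) \<in> leq \<Longrightarrow> a \<in> carrier G \<Longrightarrow> \<exists>r. (r, q) \<in> leq \<and> a \<in> generate G (D r)"
    by (rule F.forced_free_decides_basis) blast
  let ?D = "\<lambda>q. {x \<in> A. g x \<in> D q}"
  have "preorder_on P leq"
    using P by (simp add: forcing_poset_def)
  moreover have "?D q \<subseteq> ?D r" if "(r, q) \<in> leq" for q r
    using mono[OF that] by blast
  moreover have "independent (?D q)" if "(q, p1) \<in> leq" for q
    by (rule independent_decoded[OF D(1-3)[OF that]])
  moreover have "\<exists>r. (r, q) \<in> leq \<and> x \<in> span (?D r)" if q: "(q, p1) \<in> leq" and x: "x \<in> A" for q x
  proof -
    obtain r where r: "(r, q) \<in> leq" "g x \<in> generate G (D r)"
      using D(4)[OF q, of "g x"] x by auto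
    have "(r, p1) \<in> leq"
      using r(1) q F.le_trans by blast
    then have "D r \<subseteq> g ` A"
      using D(1) by simp
    then show ?thesis
      using span_preimage[OF _ x r(2)] r(1) by blast
  qed
  ultimately have "decides_basis A P leq p1 ?D"
    unfolding decides_basis_def using p1 by blast
  then show ?thesis
    using that sc by blast
qed

text \<open>The one-element poset forces nothing but the truth.\<close>

lemma potentially_free_if_basis:
  assumes "independent B" "span B = A"
  shows "sigma_closed_potentially_free G"
proof -
  define z :: 'v where "z = vset {}"
  have P: "forcing_poset {z} {(z, z)} z"
    by (simp add: forcing_poset_def preorder_on_def refl_on_def trans_def)
  interpret F: group_forcing "{z}" "{(z, z)}" z G
    by (rule group_forcing[OF P])
  have "F.forced (F.is_free_abelian_group F.C F.m)"
    by (rule F.forced_free_if_free_basis[OF coded_free_basis[OF assms]])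
  then have "forces_free {z} {(z, z)} z G"
    by (simp only: forces_free_def)
  moreover have "sigma_closed {z} {(z, z)}"
    by (auto simp: sigma_closed_def)
  ultimately show ?thesis
    using P unfolding sigma_closed_potentially_free_def by blast
qed

text \<open>\<open>M\<close> corresponds to a subgroup \<open>H\<close> of \<open>A\<close> inside
  the free group \<open>span B\<close>, so \<open>H\<close> is free by
  \<open>subgroup_of_free\<close>, and the one-element poset applies.\<close>

lemma substructure_potentially_free:
  assumes M: "comm_group M" and sub: "substructure M G"
    and B: "independent B" and le: "\<And>x. x \<in> A \<Longrightarrow> g x \<in> carrier M \<Longrightarrow> x \<in> span B"
  shows "sigma_closed_potentially_free M"
proof -
  interpret M: comm_group M
    by (rule M)
  define H where "H = {x \<in> A. g x \<in> carrier M}"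
  have cM: "carrier M = g ` H"
    using sub by (auto simp: H_def substructure_def)
  have one: "\<one>\<^bsub>M\<^esub> = g 0" and mult: "\<And>x y. x \<in> H \<Longrightarrow> y \<in> H \<Longrightarrow> g x \<otimes>\<^bsub>M\<^esub> g y = g (x + y)"
    using sub by (auto simp: substructure_def H_def)
  have HA: "H \<subseteq> A"
    by (auto simp: H_def)
  have zero: "0 \<in> H"
    using M.one_closed closed(1) by (simp add: H_def one)
  \<comment> \<open>The inverse taken in \<open>M\<close> is also one in \<open>G\<close>, since
    both share product and unit.\<close>
  have neg: "- x \<in> H" if x: "x \<in> H" for x
  proof -
    obtain y where y: "y \<in> H" "inv\<^bsub>M\<^esub> g x = g y"
      using M.inv_closed[of "g x"] x cM by auto
    then have "g (y + x) = g 0"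
      using M.l_inv[of "g x"] x cM mult[of y x] one by auto
    moreover have "x \<in> A" "y \<in> A"
      using x y HA by auto
    ultimately have "y + x = 0"
      using coded_eq_iff[OF closed(2) closed(1)] by blast
    then show ?thesis
      using y(1) by (simp add: eq_neg_iff_add_eq_0[symmetric])
  qed
  have add: "x + y \<in> H" if "x \<in> H" "y \<in> H" for x y
  proof -
    have "g x \<in> carrier M" "g y \<in> carrier M" "x \<in> A" "y \<in> A"
      using that by (auto simp: H_def)
    then have "g (x + y) \<in> carrier M" "x + y \<in> A"
      using M.m_closed[of "g x" "g y"] closed(2) unfolding mult[OF that] by blast+
    then show ?thesis
      by (simp add: H_def)
  qed
  have subH: "subspace H"
    by (rule subspace_if_diff_closed[OF zero]) (use add neg in \<open>simp only: diff_conv_add_uminus\<close>)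
  have inH: "inj_on g H"
    using inj HA by (rule inj_on_subset)
  interpret H: universe_group scale H g
    by unfold_locales (use subH inH small_subset[OF small image_mono[OF HA]] in auto)
  obtain B' where "independent B'" "span B' = H"
    using subgroup_of_free[OF B subH] le by (auto simp: H_def)
  then have "sigma_closed_potentially_free H.G"
    by (rule H.potentially_free_if_basis)
  \<comment> \<open>The forcing statement sees a group only through its two codes, so the coded copy
    of \<open>H\<close> may replace \<open>M\<close>, whose operation off the carrier is
    arbitrary.\<close>
  moreover have "carrier_code M = carrier_code H.G"
    by (rule carrier_code_cong) (simp add: cM)
  moreover have "mult_code M = mult_code H.G"
    by (rule mult_code_cong) (auto simp: cM mult)
  ultimately show ?thesis
    unfolding sigma_closed_potentially_free_def forces_free_def by simp
qed

end

lemma (in module) span_finite_subset: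
  assumes "x \<in> span X"
  obtains F where "finite F" "F \<subseteq> X" "x \<in> span F"
proof -
  obtain t r where t: "finite t" "t \<subseteq> X" "x = (\<Sum>a\<in>t. r a *s a)"
    using assms unfolding span_explicit by blast
  have "x \<in> span t"
    unfolding t(3) by (intro span_sum span_scale span_base)
  then show ?thesis
    using that t by blast
qed

lemma unit_vec_apply: "unit_vec i j = (if j = i then 1 else 0)"
  by (simp add: unit_vec_def)

lemma ladder_elt_Inr: "ladder_elt \<eta> \<delta> n (Inr \<epsilon>) = (if \<epsilon> = \<delta> then 1 / 2 ^ n else 0)"
  by (simp add: ladder_elt_def qscale_def zscale_def sum_apply unit_vec_apply)

section \<open>The groups, their filtrations and the choice of \<theta>\<close>

context square_sequence
begin

text \<open>\<open>gen \<theta> \<mu>\<close> is the group \<open>G \<theta>\<close> of the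
  overview; the \<open>gen \<theta> \<alpha>\<close> filter it by the generators below
  \<alpha>.\<close>

definition gen :: "'v \<Rightarrow> 'v \<Rightarrow> ('v + 'v \<Rightarrow> rat) set" where
  "gen \<theta> \<alpha> = ladder_group (elts \<alpha>) \<eta> (S \<theta> \<inter> elts \<alpha>)"

lemma gen_mono: "elts \<alpha> \<subseteq> elts \<beta> \<Longrightarrow> gen \<theta> \<alpha> \<subseteq> gen \<theta> \<beta>"
  unfolding gen_def ladder_group_def by (rule Z.span_mono) blast

lemma subspace_gen: "Z.subspace (gen \<theta> \<alpha>)"
  unfolding gen_def ladder_group_def by (rule Z.subspace_span)

lemma unit_vec_gen: "\<nu> \<in> elts \<alpha> \<Longrightarrow> unit_vec (Inl \<nu>) \<in> gen \<theta> \<alpha>"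
  unfolding gen_def ladder_group_def by (rule Z.span_base) blast

lemma ladder_elt_gen: "\<delta> \<in> S \<theta> \<Longrightarrow> \<delta> \<in> elts \<alpha> \<Longrightarrow> ladder_elt \<eta> \<delta> n \<in> gen \<theta> \<alpha>"
  unfolding gen_def ladder_group_def by (rule Z.span_base) blast

lemma gen_bounded:
  assumes "x \<in> gen \<theta> \<mu>"
  shows "\<exists>\<alpha>\<in>elts \<mu>. x \<in> gen \<theta> \<alpha>"
  using assms unfolding gen_def[of \<theta> \<mu>] ladder_group_def
proof (induction rule: Z.span_induct_alt)
  case base
  show ?case
    using kappa_mu Z.subspace_0[OF subspace_gen] by blast
next
  case (step k x y)
  obtain \<alpha> where a: "\<alpha> \<in> elts \<mu>" "y \<in> gen \<theta> \<alpha>"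
    using step by blast
  have "\<exists>\<beta>\<in>elts \<mu>. x \<in> gen \<theta> \<beta>"
    using step(1)
  proof
    assume "x \<in> unit_vec ` Inl ` elts \<mu>"
    then obtain \<nu> where "\<nu> \<in> elts \<mu>" "x = unit_vec (Inl \<nu>)"
      by blast
    then show ?thesis
      using osucc_mu unit_vec_gen[of \<nu> "osucc \<nu>"] by auto
  next
    assume "x \<in> {ladder_elt \<eta> \<delta> n | \<delta> n. \<delta> \<in> S \<theta> \<inter> elts \<mu>}"
    then obtain \<delta> n where "\<delta> \<in> S \<theta>" "\<delta> \<in> elts \<mu>" "x = ladder_elt \<eta> \<delta> n"
      by blast
    then show ?thesis
      using osucc_mu ladder_elt_gen[of \<delta> \<theta> "osucc \<delta>"] by auto
  qed
  then obtain \<beta> where b: "\<beta> \<in> elts \<mu>" "x \<in> gen \<theta> \<beta>"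
    by blast
  have ab: "ordinal \<alpha>" "ordinal \<beta>"
    using a b ordinal_elt[OF ordinal_mu] by auto
  obtain \<gamma> where g: "\<gamma> \<in> elts \<mu>" "elts \<alpha> \<subseteq> elts \<gamma>" "elts \<beta> \<subseteq> elts \<gamma>"
    using ordinal_linear[OF ab] ordinal_elt_subset[OF ab(1)] ordinal_elt_subset[OF ab(2)] a b
    by (metis order_refl)
  then have "x \<in> gen \<theta> \<gamma>" "y \<in> gen \<theta> \<gamma>"
    using a b gen_mono by blast+
  then have "zscale k x + y \<in> gen \<theta> \<gamma>"
    using subspace_gen by (intro Z.subspace_add Z.subspace_scale)
  then show ?case
    using g by blast
qed

lemma gen_bounded_set:
  assumes X: "X \<subseteq> gen \<theta> \<mu>" "|X| \<le>o |elts \<kappa>|"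
  obtains \<alpha> where "\<alpha> \<in> elts \<mu>" "X \<subseteq> gen \<theta> \<alpha>"
proof -
  have "\<exists>\<alpha>\<in>elts \<mu>. x \<in> gen \<theta> \<alpha>" if "x \<in> X" for x
    using gen_bounded[OF subsetD[OF X(1) that]] .
  then obtain r where r: "\<And>x. x \<in> X \<Longrightarrow> r x \<in> elts \<mu>" "\<And>x. x \<in> X \<Longrightarrow> x \<in> gen \<theta> (r x)"
    by metis
  obtain \<beta> where b: "\<beta> \<in> elts \<mu>" "\<And>x. x \<in> X \<Longrightarrow> r x \<in> elts \<beta>"
    using mu_regular[OF X(2), of r] r(1) by blast
  have "X \<subseteq> gen \<theta> \<beta>"
  proof
    fix x assume x: "x \<in> X"
    have "elts (r x) \<subseteq> elts \<beta>"
      using ordinal_elt_subset[OF ordinal_elt[OF ordinal_mu b(1)] b(2)[OF x]] .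
    then show "x \<in> gen \<theta> \<beta>"
      using r(2)[OF x] gen_mono by blast
  qed
  then show ?thesis
    using that b by blast
qed

lemma gen_subset_free:
  assumes a: "\<alpha> \<in> elts \<mu>"
  obtains B where "Z.independent B" "gen \<theta> \<alpha> \<subseteq> Z.span B"
proof -
  obtain f where f: "disjointifying (S \<theta> \<inter> elts \<alpha>) f"
    using disjointifying_exists[OF a] by blast
  have *: "\<delta> = \<delta>' \<and> m = n"
    if "\<delta> \<in> S \<theta> \<inter> elts \<alpha>" "\<delta>' \<in> S \<theta> \<inter> elts \<alpha>" "f \<delta> \<le> m" "f \<delta>' \<le> n" "\<eta> \<delta> m = \<eta> \<delta>' n" for \<delta> \<delta>' m n
  proof -
    have "\<delta> = \<delta>'"
      using f that unfolding disjointifying_def by blast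
    then show ?thesis
      using that ladder_inject[OF ladder_\<eta> S_ordinal] by blast
  qed
  show ?thesis
    by (rule ladder_group_subset_free[of "S \<theta> \<inter> elts \<alpha>" f \<eta> "elts \<alpha>"])
      (use * that in \<open>auto simp: gen_def\<close>)
qed

text \<open>Generators of \<open>gen \<theta> \<delta>\<close> use only indices below
  \<open>\<delta>\<close>. Since \<open>ladder_elt \<eta> \<delta> 0\<close> has coordinate 1 at
  \<open>Inr \<delta>\<close>, this keeps it out of \<open>gen \<theta> \<delta>\<close>.\<close>

lemma gen_Inr_zero:
  assumes "x \<in> gen \<theta> \<delta>"
  shows "x (Inr \<delta>) = 0"
  using assms unfolding gen_def ladder_group_def
proof (induction rule: Z.span_induct_alt)
  case (step k x y)
  have "x (Inr \<delta>) = 0"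
    using step(1) elts_irrefl[of \<delta>] by (auto simp: unit_vec_apply ladder_elt_Inr)
  then show ?case
    using step by (simp add: zscale_def)
qed simp

lemma infinite_mu: "infinite (elts \<mu>)"
  using infinite_kappa ordinal_elt_subset[OF ordinal_mu kappa_mu] infinite_super by blast

lemma card_gen: "|gen \<theta> \<mu>| \<le>o |elts \<mu>|"
  unfolding gen_def ladder_group_def
proof (rule Z.card_of_span_le[OF infinite_mu], rule card_of_Un_ordLeq_infinite[OF infinite_mu])
  show "|unit_vec ` (Inl :: 'v \<Rightarrow> 'v + 'v) ` elts \<mu>| \<le>o |elts \<mu>|"
    unfolding image_image by (rule card_of_image)
  have "{ladder_elt \<eta> \<delta> n | \<delta> n. \<delta> \<in> S \<theta> \<inter> elts \<mu>} =
      (\<lambda>(\<delta>, n). ladder_elt \<eta> \<delta> n) ` ((S \<theta> \<inter> elts \<mu>) \<times> UNIV)"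
    by auto
  then have "|{ladder_elt \<eta> \<delta> n | \<delta> n. \<delta> \<in> S \<theta> \<inter> elts \<mu>}| \<le>o |(S \<theta> \<inter> elts \<mu>) \<times> (UNIV :: nat set)|"
    by (simp add: card_of_image)
  moreover have "|(UNIV :: nat set)| \<le>o |elts \<mu>|"
    using infinite_mu infinite_iff_card_of_nat by blast
  then have "|(S \<theta> \<inter> elts \<mu>) \<times> (UNIV :: nat set)| \<le>o |elts \<mu>|"
    by (intro card_of_Times_ordLeq_infinite[OF infinite_mu] card_of_mono1) auto
  ultimately show "|{ladder_elt \<eta> \<delta> n | \<delta> n. \<delta> \<in> S \<theta> \<inter> elts \<mu>}| \<le>o |elts \<mu>|"
    by (rule ordLeq_transitive)
qed

text \<open>The conditions of the tree decide finite parts of the basis; along the ladder of a point closed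
  under the bounds of these parts they have a lower bound, which splits off a subgroup of \<open>gen \<theta> \<delta>\<close>
  modulo which \<open>unit_vec (Inr \<delta>)\<close> is divisible by all powers of 2.\<close>

lemma decided_basis_contradiction:
  assumes sc: "sigma_closed (P :: 'v set) leq" and dec: "Z.decides_basis (gen \<theta> \<mu>) P leq p1 D"
  obtains R where "\<And>s. s \<in> lists (elts \<mu>) \<Longrightarrow> R s \<in> elts \<mu>"
    "\<And>\<delta>. \<delta> \<in> S \<theta> \<Longrightarrow> \<exists>s\<in>lists (elts \<delta>). R s \<notin> elts \<delta>"
proof -
  have refl: "(p, p) \<in> leq" if "p \<in> P" for p
    using dec that by (auto simp: Z.decides_basis_def preorder_on_def refl_on_def)
  have trans: "(r, p) \<in> leq" if "(r, q) \<in> leq" "(q, p) \<in> leq" for p q r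
    using dec that unfolding Z.decides_basis_def preorder_on_def by (meson transD)
  have inP: "q \<in> P" if "(q, p) \<in> leq" for p q
    using dec that unfolding Z.decides_basis_def preorder_on_def by blast
  have p1: "p1 \<in> P" and mono: "\<And>q r. (r, q) \<in> leq \<Longrightarrow> D q \<subseteq> D r"
    and D: "\<And>q. (q, p1) \<in> leq \<Longrightarrow> D q \<subseteq> gen \<theta> \<mu>" "\<And>q. (q, p1) \<in> leq \<Longrightarrow> Z.independent (D q)"
    and Dspan: "\<And>q x. (q, p1) \<in> leq \<Longrightarrow> x \<in> gen \<theta> \<mu> \<Longrightarrow> \<exists>r. (r, q) \<in> leq \<and> x \<in> Z.span (D r)"
    using dec unfolding Z.decides_basis_def by auto
  define e :: "'v \<Rightarrow> 'v + 'v \<Rightarrow> rat" where "e \<nu> = unit_vec (Inl \<nu>)" for \<nu>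
  \<comment> \<open>The tree of conditions: lists grow at the head, and
    \<open>pt (\<nu> # s)\<close> extends \<open>pt s\<close> so as to decide enough of the basis to
    span \<open>e \<nu>\<close>.\<close>
  define pt where "pt = rec_list p1 (\<lambda>\<nu> _ p. SOME r. (r, p) \<in> leq \<and> e \<nu> \<in> Z.span (D r))"
  have pt_Cons: "(pt (\<nu> # s), pt s) \<in> leq \<and> e \<nu> \<in> Z.span (D (pt (\<nu> # s)))"
    if "\<nu> \<in> elts \<mu>" "(pt s, p1) \<in> leq" for \<nu> s
  proof -
    have "\<exists>r. (r, pt s) \<in> leq \<and> e \<nu> \<in> Z.span (D r)"
      using Dspan[OF that(2)] unit_vec_gen[OF that(1)] by (simp add: e_def)
    then show ?thesis
      unfolding pt_def list.rec by (rule someI_ex)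
  qed
  have pt_le: "(pt s, p1) \<in> leq" if "s \<in> lists (elts \<mu>)" for s
    using that
  proof (induction s)
    case Nil
    then show ?case
      using refl p1 by (simp add: pt_def)
  next
    case (Cons \<nu> s)
    then show ?case
      using pt_Cons trans by blast
  qed
  \<comment> \<open>A finite part \<open>F\<close> of the decided basis already spans
    \<open>e \<nu>\<close>, and it lies in some \<open>gen \<theta> \<beta>\<close> with
    \<open>\<beta>\<close> below \<mu>; these bounds are the function to be closed off.\<close>
  have "\<exists>F \<beta>. F \<subseteq> D (pt (\<nu> # s)) \<and> e \<nu> \<in> Z.span F \<and> \<beta> \<in> elts \<mu> \<and> F \<subseteq> gen \<theta> \<beta>"
    if "\<nu> \<in> elts \<mu>" "s \<in> lists (elts \<mu>)" for \<nu> s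
  proof -
    have "e \<nu> \<in> Z.span (D (pt (\<nu> # s)))"
      using pt_Cons pt_le that by blast
    then obtain F where F: "finite F" "F \<subseteq> D (pt (\<nu> # s))" "e \<nu> \<in> Z.span F"
      by (rule Z.span_finite_subset)
    have "|F| \<le>o |elts \<kappa>|"
      using F(1) infinite_kappa by (meson card_of_ordLeq_infinite card_of_Well_order ordLeq_total)
    moreover have "F \<subseteq> gen \<theta> \<mu>"
      using F(2) D(1)[OF pt_le[of "\<nu> # s"]] that by auto
    ultimately obtain \<beta> where "\<beta> \<in> elts \<mu>" "F \<subseteq> gen \<theta> \<beta>"
      using gen_bounded_set by blast
    then show ?thesis
      using F by blast
  qed
  then obtain F b where Fb: "\<And>\<nu> s. \<nu> \<in> elts \<mu> \<Longrightarrow> s \<in> lists (elts \<mu>) \<Longrightarrow>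
      F \<nu> s \<subseteq> D (pt (\<nu> # s)) \<and> e \<nu> \<in> Z.span (F \<nu> s) \<and> b \<nu> s \<in> elts \<mu> \<and> F \<nu> s \<subseteq> gen \<theta> (b \<nu> s)"
    by metis
  \<comment> \<open>The empty list carries no bound; \<kappa> is an arbitrary default in
    \<mu>.\<close>
  define R where "R = case_list \<kappa> b"
  have "R s \<in> elts \<mu>" if "s \<in> lists (elts \<mu>)" for s
    using that kappa_mu Fb by (cases s) (auto simp: R_def)
  moreover have "\<exists>s\<in>lists (elts \<delta>). R s \<notin> elts \<delta>" if \<delta>: "\<delta> \<in> S \<theta>" for \<delta>
  proof (rule ccontr)
    assume "\<not> ?thesis"
    then have closed: "R s \<in> elts \<delta>" if "s \<in> lists (elts \<delta>)" for s
      using that by blast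
    have \<delta>\<mu>: "\<delta> \<in> elts \<mu>" "elts \<delta> \<subseteq> elts \<mu>"
      using S_mu[OF \<delta>] ordinal_elt_subset[OF ordinal_mu] by auto
    have \<eta>\<delta>: "\<eta> \<delta> n \<in> elts \<delta>" for n
      using ladder_\<eta>[OF \<delta>] by (simp add: ladder_def)
    \<comment> \<open>The initial segments of the ladder in reverse order form a branch through the
      tree, and \<sigma>-closure gives it a lower bound \<open>q\<close>.\<close>
    define s where "s = rec_nat [] (\<lambda>n l. \<eta> \<delta> n # l)"
    have s_Suc: "s (Suc n) = \<eta> \<delta> n # s n" for n
      by (simp add: s_def)
    have s\<delta>: "s n \<in> lists (elts \<delta>)" for n
      by (induction n) (use \<eta>\<delta> in \<open>auto simp: s_def\<close>)
    then have s\<mu>: "s n \<in> lists (elts \<mu>)" for n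
      using lists_mono[OF \<delta>\<mu>(2)] by blast
    have \<eta>\<mu>: "\<eta> \<delta> n \<in> elts \<mu>" for n
      using \<eta>\<delta> \<delta>\<mu>(2) by blast
    have "(pt (s (Suc n)), pt (s n)) \<in> leq" for n
      unfolding s_Suc using pt_Cons[OF \<eta>\<mu> pt_le[OF s\<mu>]] by blast
    moreover have "pt (s n) \<in> P" for n
      using pt_le[OF s\<mu>] inP by blast
    ultimately obtain q where q: "q \<in> P" "\<And>n. (q, pt (s n)) \<in> leq"
      using sc[unfolded sigma_closed_def, rule_format, of "\<lambda>n. pt (s n)"] by blast
    \<comment> \<open>\<open>X\<close> is decided by \<open>q\<close>, lies in
      \<open>gen \<theta> \<delta>\<close> by closure of \<open>\<delta>\<close>, and spans all
      \<open>e (\<eta> \<delta> n)\<close>.\<close>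
    define X where "X = (\<Union>n. F (\<eta> \<delta> n) (s n))"
    have F: "F (\<eta> \<delta> n) (s n) \<subseteq> D (pt (s (Suc n)))" "e (\<eta> \<delta> n) \<in> Z.span (F (\<eta> \<delta> n) (s n))"
      "F (\<eta> \<delta> n) (s n) \<subseteq> gen \<theta> (b (\<eta> \<delta> n) (s n))" for n
      using Fb[OF \<eta>\<mu> s\<mu>, of n n] by (auto simp: s_Suc)
    have "X \<subseteq> gen \<theta> \<delta>"
    proof -
      have "b (\<eta> \<delta> n) (s n) \<in> elts \<delta>" for n
        using closed[OF s\<delta>, of "Suc n"] by (simp add: s_Suc R_def)
      then have "gen \<theta> (b (\<eta> \<delta> n) (s n)) \<subseteq> gen \<theta> \<delta>" for n
        using ordinal_elt_subset[OF S_ordinal[OF \<delta>]] gen_mono by blast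
      then show ?thesis
        unfolding X_def using F(3) by blast
    qed
    have XD: "X \<subseteq> D q"
      unfolding X_def using F(1) mono[OF q(2)] by blast
    have eX: "e (\<eta> \<delta> n) \<in> Z.span X" for n
      using F(2)[of n] Z.span_mono[of "F (\<eta> \<delta> n) (s n)" X] unfolding X_def by blast
    have qp1: "(q, p1) \<in> leq"
      using trans[OF q(2) pt_le[OF s\<mu>]] .
    let ?y = "ladder_elt \<eta> \<delta>"
    have yG: "?y n \<in> gen \<theta> \<mu>" for n
      by (rule ladder_elt_gen[OF \<delta> \<delta>\<mu>(1)])
    obtain r where r: "(r, q) \<in> leq" "?y 0 \<in> Z.span (D r)"
      using Dspan[OF qp1 yG] by blast
    have rp1: "(r, p1) \<in> leq"
      using trans[OF r(1) qp1] .
    \<comment> \<open>The divisor is \<open>y\<^sub>k\<close>, which is spanned after a further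
      extension \<open>r'\<close> depending on \<open>k\<close>; the difference of
      \<open>y\<^sub>0\<close> and \<open>2\<^sup>k y\<^sub>k\<close> is a combination of the
      \<open>e (\<eta> \<delta> i)\<close> and hence in \<open>span X\<close>.\<close>
    have "?y 0 \<in> Z.span X"
    proof (rule Z.divisible_mod_span)
      show "X \<subseteq> D r"
        using XD mono[OF r(1)] by blast
      show "?y 0 \<in> Z.span (D r)"
        by (rule r(2))
      fix k
      obtain r' where r': "(r', r) \<in> leq" "?y k \<in> Z.span (D r')"
        using Dspan[OF rp1 yG] by blast
      have "?y 0 - zscale (2 ^ k) (?y k) = (\<Sum>i<k. zscale (2 ^ i) (e (\<eta> \<delta> i)))"
        by (simp add: zscale_ladder_elt ladder_elt_0 e_def)
      also have "\<dots> \<in> Z.span X"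
        by (intro Z.span_sum Z.span_scale eX)
      finally show "\<exists>D' z. D r \<subseteq> D' \<and> Z.independent D' \<and> z \<in> Z.span D' \<and>
          ?y 0 - zscale (2 ^ k) z \<in> Z.span X"
        using r' mono[OF r'(1)] D(2)[OF trans[OF r'(1) rp1]] by blast
    qed
    moreover have "Z.span X \<subseteq> gen \<theta> \<delta>"
      by (rule Z.span_minimal[OF \<open>X \<subseteq> gen \<theta> \<delta>\<close> subspace_gen])
    ultimately have "?y 0 (Inr \<delta>) = 0"
      using gen_Inr_zero by blast
    then show False
      by (simp add: ladder_elt_Inr)
  qed
  ultimately show ?thesis
    by (rule that)
qed

theorem almost_free_not_potentially_free:
  obtains G :: "'v monoid" where "G \<in> not_potentially_free_groups"
    "\<forall>M\<in>not_potentially_free_groups. substructure M G \<longrightarrow> \<not> |carrier M| \<le>o |elts \<kappa>|"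
proof -
  have "\<exists>g :: ('v + 'v \<Rightarrow> rat) \<Rightarrow> 'v. inj_on g (gen \<theta> \<mu>) \<and> small (g ` gen \<theta> \<mu>)" for \<theta>
  proof (rule small_if_card_le[OF card_gen[of \<theta>]])
    fix g :: "('v + 'v \<Rightarrow> rat) \<Rightarrow> 'v"
    assume "inj_on g (gen \<theta> \<mu>)" "small (g ` gen \<theta> \<mu>)"
    then show ?thesis
      by (intro exI conjI)
  qed
  then have "\<exists>g :: 'v \<Rightarrow> ('v + 'v \<Rightarrow> rat) \<Rightarrow> 'v. \<forall>\<theta>. inj_on (g \<theta>) (gen \<theta> \<mu>) \<and> small (g \<theta> ` gen \<theta> \<mu>)"
    by (intro choice allI)
  then obtain g :: "'v \<Rightarrow> ('v + 'v \<Rightarrow> rat) \<Rightarrow> 'v"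
    where g: "\<And>\<theta>. inj_on (g \<theta>) (gen \<theta> \<mu>)" "\<And>\<theta>. small (g \<theta> ` gen \<theta> \<mu>)"
    by auto
  have ug: "universe_group zscale (gen \<theta> \<mu>) (g \<theta>)" for \<theta>
    by (intro universe_group.intro coded_subgroup.intro coded_subgroup_axioms.intro
        universe_group_axioms.intro Z.int_module_axioms subspace_gen g)
  let ?G = "\<lambda>\<theta>. coded_group (gen \<theta> \<mu>) (g \<theta>)"
  \<comment> \<open>If every group were potentially free, closing off the functions
    \<open>R \<theta>\<close> for all \<theta> up to \<kappa> would yield a \<open>\<delta>\<close>
    of cofinality omega in none of these \<open>S \<theta>\<close>, contrary to the bound on the
    order type of \<open>C \<delta>\<close>.\<close>
  have "\<exists>\<theta>. \<not> sigma_closed_potentially_free (?G \<theta>)"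
  proof (rule ccontr)
    assume "\<nexists>\<theta>. \<not> sigma_closed_potentially_free (?G \<theta>)"
    then have pf: "sigma_closed_potentially_free (?G \<theta>)" for \<theta>
      by blast
    have "\<exists>R. (\<forall>s\<in>lists (elts \<mu>). R s \<in> elts \<mu>) \<and>
        (\<forall>\<delta>\<in>S \<theta>. \<exists>s\<in>lists (elts \<delta>). R s \<notin> elts \<delta>)" for \<theta>
    proof -
      interpret universe_group zscale "gen \<theta> \<mu>" "g \<theta>"
        by (rule ug)
      show ?thesis
        by (rule potentially_free_decides_basis[OF pf], rule decided_basis_contradiction) blast+
    qed
    then obtain R where R: "\<And>\<theta> s. s \<in> lists (elts \<mu>) \<Longrightarrow> R \<theta> s \<in> elts \<mu>"
      "\<And>\<theta> \<delta>. \<delta> \<in> S \<theta> \<Longrightarrow> \<exists>s\<in>lists (elts \<delta>). R \<theta> s \<notin> elts \<delta>"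
      by metis
    obtain \<delta> h where \<delta>: "\<delta> \<in> elts \<mu>" "limit_ordinal \<delta>" "ladder \<delta> h"
      "\<And>\<theta> s. \<theta> \<in> elts (osucc \<kappa>) \<Longrightarrow> s \<in> lists (elts \<delta>) \<Longrightarrow> R \<theta> s \<in> elts \<delta>"
      using closure_point[of R] R(1) by blast
    obtain \<theta> where "\<theta> \<in> elts (osucc \<kappa>)" "ord_rel (C \<delta>) =o ord_rel (elts \<theta>)"
      using ord_rel_ordLeq_ordinal[OF ordinal_kappa type_le[OF \<delta>(1,2)]] by blast
    moreover from this have "\<delta> \<in> S \<theta>"
      using \<delta> by (auto simp: S_def)
    ultimately show False
      using R(2) \<delta>(4) by blast
  qed
  then obtain \<theta> where \<theta>: "\<not> sigma_closed_potentially_free (?G \<theta>)"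
    by blast
  interpret universe_group zscale "gen \<theta> \<mu>" "g \<theta>"
    by (rule ug)
  have "sigma_closed_potentially_free M"
    if M: "comm_group M" "substructure M (?G \<theta>)" and le: "|carrier M| \<le>o |elts \<kappa>|" for M
  proof -
    let ?H = "{x \<in> gen \<theta> \<mu>. g \<theta> x \<in> carrier M}"
    have "inj_on (g \<theta>) ?H"
      by (rule inj_on_subset[OF g(1)]) auto
    moreover have "g \<theta> ` ?H \<subseteq> carrier M"
      by auto
    ultimately have "|?H| \<le>o |carrier M|"
      using card_of_ordLeq by blast
    then have "|?H| \<le>o |elts \<kappa>|"
      using le ordLeq_transitive by blast
    \<comment> \<open>By regularity of \<mu> the subgroup lies in a single
      \<open>gen \<theta> \<alpha>\<close>, which is contained in a free group.\<close>
    then obtain \<alpha> where a: "\<alpha> \<in> elts \<mu>" "?H \<subseteq> gen \<theta> \<alpha>"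
      using gen_bounded_set[of ?H] by blast
    obtain B where "Z.independent B" "gen \<theta> \<alpha> \<subseteq> Z.span B"
      using gen_subset_free[OF a(1)] by blast
    then show ?thesis
      using substructure_potentially_free[OF M] a(2) by blast
  qed
  moreover have "?G \<theta> \<in> not_potentially_free_groups"
    using \<theta> coded.comm_group_axioms small by (simp add: not_potentially_free_groups_def)
  ultimately show ?thesis
    using that[of "?G \<theta>"] unfolding not_potentially_free_groups_def by blast
qed

end

theorem theorem5p14:
  assumes "proper_class {\<kappa> :: 'v::zfc_universe. infinite_cardinal \<kappa> \<and> square \<kappa>}"
  shows "\<not> abstract_elementary_class
           (not_potentially_free_groups :: 'v monoid set) pure_substructure"
proof
  assume "abstract_elementary_class (not_potentially_free_groups :: 'v monoid set) pure_substructure"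
  then have "loewenheim_skolem (not_potentially_free_groups :: 'v monoid set) pure_substructure"
    by (simp only: abstract_elementary_class_def)
  then obtain \<rho> :: 'v where \<rho>: "cardinal \<rho>"
    and LS: "\<forall>B\<in>(not_potentially_free_groups :: 'v monoid set). \<forall>A\<subseteq>carrier B. \<exists>A'\<in>not_potentially_free_groups.
      A \<subseteq> carrier A' \<and> pure_substructure A' B \<and> |carrier A'| \<le>o |A| +c |elts \<rho>|"
    unfolding loewenheim_skolem_def by (elim exE conjE) (rule that; assumption)
  \<comment> \<open>A proper class is not contained in the set \<open>\<rho>\<close>, so some
    \<kappa> with square is at least \<open>\<rho>\<close>.\<close>
  have "\<not> {\<kappa>. infinite_cardinal \<kappa> \<and> square \<kappa>} \<subseteq> elts \<rho>"
    using assms small_subset[OF small_elts[of \<rho>]] by (rule contrapos_nn)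
  then obtain \<kappa> :: 'v where \<kappa>: "infinite_cardinal \<kappa>" "square \<kappa>" "\<kappa> \<notin> elts \<rho>"
    by auto
  have "elts \<rho> \<subseteq> elts \<kappa>"
    using ordinal_linear[of \<kappa> \<rho>] \<kappa> \<rho> ordinal_elt_subset[of \<kappa> \<rho>]
    by (auto simp: infinite_cardinal_def cardinal_def)
  then have \<rho>\<kappa>: "|elts \<rho>| \<le>o |elts \<kappa>|"
    by (rule card_of_mono1)
  obtain \<mu> C where "successor_cardinal \<kappa> \<mu>" and C: "\<forall>\<alpha>\<in>elts \<mu>. limit_ordinal \<alpha> \<longrightarrow>
           club_in (C \<alpha>) \<alpha> \<and> ord_rel (C \<alpha>) \<le>o ord_rel (elts \<kappa>) \<and>
           (\<forall>\<beta>\<in>limit_points (C \<alpha>) \<alpha>. C \<beta> = C \<alpha> \<inter> elts \<beta>)"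
    using \<kappa>(2) unfolding square_def by blast
  then interpret square_sequence \<kappa> \<mu> C
    by unfold_locales (use \<kappa> in auto)
  obtain G :: "'v monoid" where G: "G \<in> not_potentially_free_groups"
    "\<forall>M\<in>not_potentially_free_groups. substructure M G \<longrightarrow> \<not> |carrier M| \<le>o |elts \<kappa>|"
    by (rule almost_free_not_potentially_free) (rule that; assumption)
  \<comment> \<open>The axiom is applied to the empty set, so the bound reduces to the size of
    \<open>\<rho>\<close> and is at most \<kappa>.\<close>
  have "\<exists>M\<in>not_potentially_free_groups.
      {} \<subseteq> carrier M \<and> pure_substructure M G \<and> |carrier M| \<le>o |{} :: 'v set| +c |elts \<rho>|"
    using LS[rule_format, OF G(1), of "{}"] by simp
  then obtain M where M: "M \<in> not_potentially_free_groups" "pure_substructure M G"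
    "|carrier M| \<le>o |{} :: 'v set| +c |elts \<rho>|"
    by (elim bexE conjE) (rule that; assumption)
  have "|({} :: 'v set) <+> elts \<rho>| \<le>o |elts \<kappa>|"
    by (rule card_of_Plus_ordLeq_infinite[OF infinite_kappa card_of_empty \<rho>\<kappa>])
  then have "|{} :: 'v set| +c |elts \<rho>| \<le>o |elts \<kappa>|"
    by (simp add: csum_def Field_card_of)
  then have "|carrier M| \<le>o |elts \<kappa>|"
    using M(3) ordLeq_transitive by blast
  moreover have "substructure M G"
    using M(2) by (simp add: pure_substructure_def)
  ultimately show False
    using bspec[OF G(2) M(1)] by simp
qed

end
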